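(* (Quasi-orthogonality of the velocity) Let $\mathcal T_k$ be a refinement of $\mathcal T_{k-1}$, let $(u,p)$ be the solution of the Stokes problem, and let $(u_k,p_k)$ and $(u_{k-1},p_{k-1})$ be the discrete solutions on $\mathcal T_k$ and $\mathcal T_{k-1}$, respectively. Then there is a constant $C>0$, independent of the mesh sizes and of the level $k$, such that $$|a_k(u-u_k,u_k-u_{k-1})|\le C\,\|\nabla_k(u-u_k)\|_{L^2(\Omega)}\Big(\sum_{K\in\mathcal T_{k-1}\setminus\mathcal T_k}h_K^2\|g\|_{L^2(K)}^2\Big)^{1/2}.$$
   Context: Stokes problem: $\Omega\subset\mathbb R^2$ is a polygonal domain, $\mu>0$, $g\in L^2(\Omega)^2$, $V:=(H_0^1(\Omega))^2$, $Q:=L^2_0(\Omega)=\{q\in L^2(\Omega):\int_\Omega q\,dx=0\}$, $a(u,v):=\mu(\nabla u,\nabla v)_{L^2(\Omega)}$, $b(v,q):=(\operatorname{div}v,q)_{L^2(\Omega)}$; $(u,p)\in V\times Q$ satisfies $a(u,v)+b(v,p)+b(u,q)=(g,v)_{L^2(\Omega)}$ for all $(v,q)\in V\times Q$. Meshes: $\mathcal T_0$ is an initial shape-regular (conforming) triangulation of $\overline\Omega$ into triangles; every $\mathcal T_k$ is a nested conforming refinement of $\mathcal T_{k-1}$ by newest vertex bisection. $\mathcal E_k$ is the set of edges of $\mathcal T_k$, $\mathcal E_k(\Omega)$ the interior edges, $h_K:=|K|^{1/2}$, and $[v]$ is the jump of $v$ across an edge. Discrete problem (nonconforming $P_1$):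 $V_k:=\{v_k\in L^2(\Omega)^2: v_k|_K\in P_1(K)^2\ \forall K\in\mathcal T_k,\ \int_E[v_k]\,ds=0\ \forall E\in\mathcal E_k(\Omega),\ \int_Ev_k\,ds=0\ \forall E\in\mathcal E_k,\ E\subset\partial\Omega\}$, $Q_k:=\{q_k\in Q: q_k|_K\in P_0(K)\ \forall K\in\mathcal T_k\}$. $\nabla_k,\operatorname{div}_k$ are the element-by-element operators with respect to $\mathcal T_k$, $a_k(u,v):=\mu(\nabla_ku,\nabla_kv)_{L^2(\Omega)}$, $b_k(v,q):=(\operatorname{div}_kv,q)_{L^2(\Omega)}$; $(u_k,p_k)\in V_k\times Q_k$ satisfies $a_k(u_k,v)+b_k(v,p_k)+b_k(u_k,q)=(g,v)_{L^2(\Omega)}$ for all $(v,q)\in V_k\times Q_k$; likewise on $\mathcal T_{k-1}$. *)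

theory Defs
  imports "HOL-Analysis.Analysis"
begin

type_synonym point = "real^2"

section \<open>Lebesgue and Sobolev spaces\<close>

text \<open>Elements of \<open>L\<^sup>2\<close> are represented by functions on the whole plane; only their values
  almost everywhere on the set in question matter.\<close>

definition L2 :: "point set \<Rightarrow> (point \<Rightarrow> 'b::euclidean_space) set" where
  "L2 S = {f. f \<in> borel_measurable (lebesgue_on S) \<and>
              integrable (lebesgue_on S) (\<lambda>x. (norm (f x))\<^sup>2)}"

definition L2_inner ::
    "point set \<Rightarrow> (point \<Rightarrow> 'b::euclidean_space) \<Rightarrow> (point \<Rightarrow> 'b) \<Rightarrow> real" where
  "L2_inner S f g = (LINT x|lebesgue_on S. f x \<bullet> g x)"

definition L2_norm :: "point set \<Rightarrow> (point \<Rightarrow> 'b::euclidean_space) \<Rightarrow> real" where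
  "L2_norm S f = sqrt (L2_inner S f f)"

definition L2_0 :: "point set \<Rightarrow> (point \<Rightarrow> real) set" where
  "L2_0 S = {q \<in> L2 S. (LINT x|lebesgue_on S. q x) = 0}"

definition partial :: "2 \<Rightarrow> (point \<Rightarrow> real) \<Rightarrow> point \<Rightarrow> real" where
  "partial j f x = frechet_derivative f (at x) (axis j 1)"

primrec Ck :: "nat \<Rightarrow> (point \<Rightarrow> real) \<Rightarrow> bool" where
  "Ck 0 f \<longleftrightarrow> continuous_on UNIV f"
| "Ck (Suc n) f \<longleftrightarrow> (\<forall>x. f differentiable (at x)) \<and> (\<forall>j. Ck n (partial j f))"

definition test_function :: "point set \<Rightarrow> (point \<Rightarrow> real) \<Rightarrow> bool" where
  "test_function S \<phi> \<longleftrightarrow> (\<forall>n. Ck n \<phi>) \<and>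
     compact (closure {x. \<phi> x \<noteq> 0}) \<and> closure {x. \<phi> x \<noteq> 0} \<subseteq> S"

text \<open>The gradient of a vector field is its Jacobian, \<open>G x $ i $ j\<close> being the \<open>j\<close>-th partial
  derivative of the \<open>i\<close>-th component. The norm and inner product of \<open>real^2^2\<close> are those of
  Frobenius.\<close>

definition has_weak_gradient ::
    "point set \<Rightarrow> (point \<Rightarrow> real^2) \<Rightarrow> (point \<Rightarrow> real^2^2) \<Rightarrow> bool" where
  "has_weak_gradient S v G \<longleftrightarrow> v \<in> L2 S \<and> G \<in> L2 S \<and>
     (\<forall>\<phi> i j. test_function S \<phi> \<longrightarrow>
        (LINT x|lebesgue_on S. v x $ i * partial j \<phi> x) =
        - (LINT x|lebesgue_on S. G x $ i $ j * \<phi> x))"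

definition H1 :: "point set \<Rightarrow> (point \<Rightarrow> real^2) set" where
  "H1 S = {v. \<exists>G. has_weak_gradient S v G}"

text \<open>For \<open>v \<in> H1 S\<close> the weak gradient is unique up to null sets.\<close>

definition weak_grad :: "point set \<Rightarrow> (point \<Rightarrow> real^2) \<Rightarrow> point \<Rightarrow> real^2^2" where
  "weak_grad S v = (SOME G. has_weak_gradient S v G)"

definition H1_norm :: "point set \<Rightarrow> (point \<Rightarrow> real^2) \<Rightarrow> real" where
  "H1_norm S v = sqrt ((L2_norm S v)\<^sup>2 + (L2_norm S (weak_grad S v))\<^sup>2)"

definition H1_0 :: "point set \<Rightarrow> (point \<Rightarrow> real^2) set" where
  "H1_0 S = {v \<in> H1 S. \<exists>\<phi> :: nat \<Rightarrow> point \<Rightarrow> real^2.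
      (\<forall>n i. test_function S (\<lambda>x. \<phi> n x $ i)) \<and>
      (\<lambda>n. H1_norm S (\<lambda>x. \<phi> n x - v x)) \<longlonglongrightarrow> 0}"

section \<open>The Stokes problem\<close>

text \<open>The third condition excludes slits.\<close>

definition polygonal_domain :: "point set \<Rightarrow> bool" where
  "polygonal_domain \<Omega> \<longleftrightarrow>
     open \<Omega> \<and> connected \<Omega> \<and> \<Omega> \<noteq> {} \<and> bounded \<Omega> \<and>
     interior (closure \<Omega>) = \<Omega> \<and>
     (\<exists>S :: (point \<times> point) set. finite S \<and> frontier \<Omega> = (\<Union>(a, b)\<in>S. closed_segment a b))"

definition form_a ::
    "real \<Rightarrow> point set \<Rightarrow> (point \<Rightarrow> real^2) \<Rightarrow> (point \<Rightarrow> real^2) \<Rightarrow> real" where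
  "form_a \<mu> \<Omega> u v = \<mu> * L2_inner \<Omega> (weak_grad \<Omega> u) (weak_grad \<Omega> v)"

definition form_b :: "point set \<Rightarrow> (point \<Rightarrow> real^2) \<Rightarrow> (point \<Rightarrow> real) \<Rightarrow> real" where
  "form_b \<Omega> v q = L2_inner \<Omega> (\<lambda>x. trace (weak_grad \<Omega> v x)) q"

definition stokes_solution ::
    "real \<Rightarrow> point set \<Rightarrow> (point \<Rightarrow> real^2) \<Rightarrow> (point \<Rightarrow> real^2) \<Rightarrow> (point \<Rightarrow> real) \<Rightarrow> bool" where
  "stokes_solution \<mu> \<Omega> g u p \<longleftrightarrow> u \<in> H1_0 \<Omega> \<and> p \<in> L2_0 \<Omega> \<and>
     (\<forall>v \<in> H1_0 \<Omega>. \<forall>q \<in> L2_0 \<Omega>.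
        form_a \<mu> \<Omega> u v + form_b \<Omega> v p + form_b \<Omega> u q = L2_inner \<Omega> g v)"

section \<open>Meshes and newest vertex bisection\<close>

text \<open>Triangles are closed point sets. The library's \<^const>\<open>triangulation\<close> is finite and any two
  of its members meet in a common (possibly empty) face, so it is conforming.\<close>

definition conforming_triangulation :: "point set \<Rightarrow> point set set \<Rightarrow> bool" where
  "conforming_triangulation \<Omega> \<T> \<longleftrightarrow>
     triangulation \<T> \<and> (\<forall>K\<in>\<T>. 2 simplex K) \<and> \<Union>\<T> = closure \<Omega>"

definition mesh_size :: "point set \<Rightarrow> real" where
  "mesh_size K = sqrt (measure lebesgue K)"

text \<open>Since \<open>|K| \<le> (diam K)\<^sup>2\<close> this bounds the aspect ratio; it is equivalent to a bound on
  \<open>diam K\<close> over the inradius of \<open>K\<close>.\<close>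

definition shape_regular :: "real \<Rightarrow> point set set \<Rightarrow> bool" where
  "shape_regular \<sigma> \<T> \<longleftrightarrow> (\<forall>K\<in>\<T>. diameter K \<le> \<sigma> * mesh_size K)"

text \<open>For newest vertex bisection every triangle carries a distinguished vertex, its newest
  vertex; the opposite edge is its refinement edge. The marks of the initial mesh are arbitrary.\<close>

type_synonym marked_mesh = "(point set \<times> point) set"

definition elements :: "marked_mesh \<Rightarrow> point set set" where
  "elements M = fst ` M"

definition marked_triangulation :: "point set \<Rightarrow> marked_mesh \<Rightarrow> bool" where
  "marked_triangulation \<Omega> M \<longleftrightarrow> conforming_triangulation \<Omega> (elements M) \<and> inj_on fst M \<and>
     (\<forall>(K, z)\<in>M. z extreme_point_of K)"

inductive bisect :: "marked_mesh \<Rightarrow> marked_mesh \<Rightarrow> bool" where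
  "\<lbrakk>(K, z) \<in> M; K = convex hull {z, x, y}; 2 simplex K; m = midpoint x y;
    M' = (M - {(K, z)}) \<union> {(convex hull {z, x, m}, m), (convex hull {z, y, m}, m)}\<rbrakk>
   \<Longrightarrow> bisect M M'"

text \<open>Intermediate meshes may have hanging nodes; the refined mesh may not.\<close>

definition nvb_refinement :: "point set \<Rightarrow> marked_mesh \<Rightarrow> marked_mesh \<Rightarrow> bool" where
  "nvb_refinement \<Omega> M M' \<longleftrightarrow> bisect\<^sup>*\<^sup>* M M' \<and> marked_triangulation \<Omega> M'"

section \<open>The nonconforming discretisation\<close>

definition P0_on :: "point set \<Rightarrow> (point \<Rightarrow> real) \<Rightarrow> bool" where
  "P0_on K q \<longleftrightarrow> (\<exists>c. AE x in lebesgue_on K. q x = c)"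

definition P1_rep :: "point set \<Rightarrow> (point \<Rightarrow> real^2) \<Rightarrow> (point \<Rightarrow> real^2) \<Rightarrow> bool" where
  "P1_rep K v f \<longleftrightarrow> (\<exists>(A::real^2^2) b. f = (\<lambda>x. A *v x + b)) \<and>
     (AE x in lebesgue_on K. v x = f x)"

text \<open>The polynomial which agrees with \<open>v\<close> on \<open>K\<close>; its values on the edges of \<open>K\<close> are the trace
  of \<open>v\<close> taken from \<open>K\<close>.\<close>

definition P1_restrict :: "point set \<Rightarrow> (point \<Rightarrow> real^2) \<Rightarrow> point \<Rightarrow> real^2" where
  "P1_restrict K v = (THE f. P1_rep K v f)"

definition segment_integral :: "point \<Rightarrow> point \<Rightarrow> (point \<Rightarrow> real^2) \<Rightarrow> real^2" where
  "segment_integral a b f =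
     dist a b *\<^sub>R integral {0..1} (\<lambda>t. f ((1 - t) *\<^sub>R a + t *\<^sub>R b))"

text \<open>In the jump condition \<open>K\<close> and \<open>K'\<close> are the two triangles sharing the interior edge.\<close>

definition V_nc :: "point set \<Rightarrow> point set set \<Rightarrow> (point \<Rightarrow> real^2) set" where
  "V_nc \<Omega> \<T> = {v \<in> L2 \<Omega>.
     (\<forall>K\<in>\<T>. \<exists>f. P1_rep K v f) \<and>
     (\<forall>K\<in>\<T>. \<forall>K'\<in>\<T>. \<forall>a b. K \<noteq> K' \<longrightarrow>
        closed_segment a b edge_of K \<longrightarrow> closed_segment a b edge_of K' \<longrightarrow>
        \<not> closed_segment a b \<subseteq> frontier \<Omega> \<longrightarrow>
        segment_integral a b (\<lambda>x. P1_restrict K v x - P1_restrict K' v x) = 0) \<and>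
     (\<forall>K\<in>\<T>. \<forall>a b. closed_segment a b edge_of K \<longrightarrow> closed_segment a b \<subseteq> frontier \<Omega> \<longrightarrow>
        segment_integral a b (P1_restrict K v) = 0)}"

definition Q_nc :: "point set \<Rightarrow> point set set \<Rightarrow> (point \<Rightarrow> real) set" where
  "Q_nc \<Omega> \<T> = {q \<in> L2_0 \<Omega>. \<forall>K\<in>\<T>. P0_on K q}"

definition broken_grad :: "point set set \<Rightarrow> (point \<Rightarrow> real^2) \<Rightarrow> point \<Rightarrow> real^2^2" where
  "broken_grad \<T> v x =
     (\<Sum>K\<in>\<T>. indicator (interior K) x *\<^sub>R weak_grad (interior K) v x)"

definition broken_a :: "real \<Rightarrow> point set \<Rightarrow> point set set \<Rightarrow>
    (point \<Rightarrow> real^2) \<Rightarrow> (point \<Rightarrow> real^2) \<Rightarrow> real" where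
  "broken_a \<mu> \<Omega> \<T> u v = \<mu> * L2_inner \<Omega> (broken_grad \<T> u) (broken_grad \<T> v)"

definition broken_b :: "point set \<Rightarrow> point set set \<Rightarrow>
    (point \<Rightarrow> real^2) \<Rightarrow> (point \<Rightarrow> real) \<Rightarrow> real" where
  "broken_b \<Omega> \<T> v q = L2_inner \<Omega> (\<lambda>x. trace (broken_grad \<T> v x)) q"

definition discrete_solution :: "real \<Rightarrow> point set \<Rightarrow> point set set \<Rightarrow>
    (point \<Rightarrow> real^2) \<Rightarrow> (point \<Rightarrow> real^2) \<Rightarrow> (point \<Rightarrow> real) \<Rightarrow> bool" where
  "discrete_solution \<mu> \<Omega> \<T> g u p \<longleftrightarrow> u \<in> V_nc \<Omega> \<T> \<and> p \<in> Q_nc \<Omega> \<T> \<and>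
     (\<forall>v \<in> V_nc \<Omega> \<T>. \<forall>q \<in> Q_nc \<Omega> \<T>.
        broken_a \<mu> \<Omega> \<T> u v + broken_b \<Omega> \<T> v p + broken_b \<Omega> \<T> u q = L2_inner \<Omega> g v)"

end

theory Submission
  imports Defs
begin

text \<open>Let \<open>I\<close> denote interpolation that keeps the mean values on all edges of a mesh: \<open>I\<^sub>k\<close> maps
  into the nonconforming space on the fine mesh and \<open>I\<^sub>c\<close> into that on the coarse one. By the
  divergence theorem both replace a gradient by its mean values on the elements. Put
  \<open>w = I\<^sub>k u - u\<^sub>k\<close>, write \<open>u'\<close> for the coarse solution, and suppress the viscosity. The broken
  gradient of \<open>u\<^sub>k - u'\<close> is constant on fine elements, hence
  \<open>a\<^sub>k(u - u\<^sub>k, u\<^sub>k - u') = a\<^sub>k(w, u\<^sub>k) - a\<^sub>k(w, u')\<close>, and \<open>a\<^sub>k(w, u')\<close> equals \<open>a\<^sub>c(I\<^sub>c w, u')\<close>. Now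
  \<open>w\<close> and \<open>I\<^sub>c w\<close> are elementwise divergence free, so both pressures drop out of the
  discrete equations and what is left is \<open>(g, w - I\<^sub>c w)\<close>. This vanishes on the elements common to
  both meshes; on a refined element \<open>K\<close> it is bounded through
  \<open>\<parallel>w - I\<^sub>c w\<parallel> \<le> C h\<^sub>K \<parallel>\<nabla>\<^sub>k w\<parallel>\<close>. Finally \<open>\<parallel>\<nabla>\<^sub>k w\<parallel> \<le> \<parallel>\<nabla>\<^sub>k(u - u\<^sub>k)\<parallel>\<close>, because taking mean
  values is an orthogonal projection.

  Two steps need more than this. The first is the interpolation error of the discontinuous function
  \<open>w\<close> with a constant that does not see how often \<open>K\<close> was bisected. The lemma
  \<open>nvb_local_estimate\<close> follows the binary tree of bisections: the interpolants on a triangle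
  and on one of its halves agree in the midpoint of a common edge, so they differ by at most the
  size of the triangle times the difference of the gradients, and the sizes decrease geometrically
  along the tree. The size is measured by \<open>|x - z|\<^sup>2 + |y - z|\<^sup>2\<close> for the triangle \<open>z x y\<close> with
  newest vertex \<open>z\<close>. By the parallelogram law this is halved exactly by a bisection, as is
  the area. One identity thus gives the decay as well as the preservation of shape regularity.

  The second is that edge means of \<open>u\<close> would call for traces of Sobolev functions. Instead \<open>u\<close>
  is replaced by test functions \<open>\<phi>\<close> that approximate it. Then \<open>w = I\<^sub>k \<phi> - u\<^sub>k\<close> is divergence free
  only up to \<open>\<parallel>\<nabla>(\<phi> - u)\<parallel>\<close>, which tends to zero; see \<open>quasi_orthogonality_test_function\<close>.

  The analytic basis is the uniqueness of weak gradients, which identifies the broken gradients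
  with the classical ones, and the divergence theorem on a triangle, which yields both the
  mean value property of the interpolation and integration by parts.\<close>

section \<open>Square integrable functions\<close>

lemma L2_add: "f \<in> L2 S \<Longrightarrow> g \<in> L2 S \<Longrightarrow> (\<lambda>x. f x + g x) \<in> L2 S"
proof -
  assume f: "f \<in> L2 S" and g: "g \<in> L2 S"
  have [measurable]: "f \<in> borel_measurable (lebesgue_on S)" "g \<in> borel_measurable (lebesgue_on S)"
    using f g by (auto simp: L2_def)
  have "integrable (lebesgue_on S) (\<lambda>x. 2 * (norm (f x))\<^sup>2 + 2 * (norm (g x))\<^sup>2)"
    using f g by (auto simp: L2_def)
  moreover have "(norm (f x + g x))\<^sup>2 \<le> 2 * (norm (f x))\<^sup>2 + 2 * (norm (g x))\<^sup>2" for x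
  proof -
    have "(norm (f x + g x))\<^sup>2 \<le> (norm (f x) + norm (g x))\<^sup>2"
      by (simp add: norm_triangle_ineq power_mono)
    also have "\<dots> \<le> 2 * (norm (f x))\<^sup>2 + 2 * (norm (g x))\<^sup>2"
      using sum_squares_bound[of "norm (f x)" "norm (g x)"] by (simp add: power2_sum)
    finally show ?thesis .
  qed
  ultimately have "integrable (lebesgue_on S) (\<lambda>x. (norm (f x + g x))\<^sup>2)"
    by (elim Bochner_Integration.integrable_bound) (auto intro!: AE_I2 order_trans[OF _ abs_ge_self])
  then show ?thesis by (auto simp: L2_def)
qed

lemma L2_linear:
  assumes "f \<in> L2 S" "bounded_linear h"
  shows "(\<lambda>x. h (f x)) \<in> L2 S"
proof -
  have [measurable]: "f \<in> borel_measurable (lebesgue_on S)"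
    using assms by (auto simp: L2_def)
  obtain B where B: "\<And>x. norm (h x) \<le> norm x * B"
    using bounded_linear.bounded[OF assms(2)] by blast
  have [measurable]: "h \<in> borel_measurable borel"
    using assms(2) by (intro borel_measurable_continuous_onI linear_continuous_on)
  have "integrable (lebesgue_on S) (\<lambda>x. B\<^sup>2 * (norm (f x))\<^sup>2)"
    using assms by (auto simp: L2_def)
  moreover have "(norm (h (f x)))\<^sup>2 \<le> B\<^sup>2 * (norm (f x))\<^sup>2" for x
    using power_mono[OF B[of "f x"], of 2] by (simp add: power_mult_distrib mult.commute)
  ultimately have "integrable (lebesgue_on S) (\<lambda>x. (norm (h (f x)))\<^sup>2)"
    by (elim Bochner_Integration.integrable_bound) (auto intro!: AE_I2 order_trans[OF _ abs_ge_self])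
  then show ?thesis by (auto simp: L2_def)
qed

lemma L2_scaleR: "f \<in> L2 S \<Longrightarrow> (\<lambda>x. c *\<^sub>R f x) \<in> L2 S"
  by (rule L2_linear[OF _ bounded_linear_scaleR_right])

lemma L2_diff: "f \<in> L2 S \<Longrightarrow> g \<in> L2 S \<Longrightarrow> (\<lambda>x. f x - g x) \<in> L2 S"
  using L2_add[of f S "\<lambda>x. (-1) *\<^sub>R g x"] L2_scaleR[of g S "-1"] by simp

lemma L2_integrable_inner:
  assumes "f \<in> L2 S" "g \<in> L2 S"
  shows "integrable (lebesgue_on S) (\<lambda>x. f x \<bullet> g x)"
proof -
  have [measurable]: "f \<in> borel_measurable (lebesgue_on S)" "g \<in> borel_measurable (lebesgue_on S)"
    using assms by (auto simp: L2_def)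
  have "integrable (lebesgue_on S) (\<lambda>x. (norm (f x))\<^sup>2 + (norm (g x))\<^sup>2)"
    using assms by (auto simp: L2_def)
  moreover have "\<bar>f x \<bullet> g x\<bar> \<le> (norm (f x))\<^sup>2 + (norm (g x))\<^sup>2" for x
  proof -
    have "\<bar>f x \<bullet> g x\<bar> \<le> norm (f x) * norm (g x)" by (rule Cauchy_Schwarz_ineq2)
    also have "\<dots> \<le> (norm (f x))\<^sup>2 + (norm (g x))\<^sup>2"
      using sum_squares_bound[of "norm (f x)" "norm (g x)"]
        mult_nonneg_nonneg[OF norm_ge_zero[of "f x"] norm_ge_zero[of "g x"]] by linarith
    finally show ?thesis .
  qed
  ultimately show ?thesis
    by (elim Bochner_Integration.integrable_bound) (auto intro!: AE_I2 order_trans[OF _ abs_ge_self])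
qed

lemma L2_inner_commute: "L2_inner S f g = L2_inner S g f"
  by (simp add: L2_inner_def inner_commute)

lemma L2_inner_diff_left:
  "f \<in> L2 S \<Longrightarrow> g \<in> L2 S \<Longrightarrow> h \<in> L2 S \<Longrightarrow>
    L2_inner S (\<lambda>x. f x - g x) h = L2_inner S f h - L2_inner S g h"
  by (simp add: L2_inner_def inner_diff_left L2_integrable_inner)

lemma L2_inner_diff_right:
  "f \<in> L2 S \<Longrightarrow> g \<in> L2 S \<Longrightarrow> h \<in> L2 S \<Longrightarrow>
    L2_inner S h (\<lambda>x. f x - g x) = L2_inner S h f - L2_inner S h g"
  by (simp add: L2_inner_def inner_diff_right L2_integrable_inner)

lemma L2_inner_add_left:
  "f \<in> L2 S \<Longrightarrow> g \<in> L2 S \<Longrightarrow> h \<in> L2 S \<Longrightarrow>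
    L2_inner S (\<lambda>x. f x + g x) h = L2_inner S f h + L2_inner S g h"
  by (simp add: L2_inner_def inner_add_left L2_integrable_inner)

lemma L2_inner_add_right:
  "f \<in> L2 S \<Longrightarrow> g \<in> L2 S \<Longrightarrow> h \<in> L2 S \<Longrightarrow>
    L2_inner S h (\<lambda>x. f x + g x) = L2_inner S h f + L2_inner S h g"
  by (simp add: L2_inner_def inner_add_right L2_integrable_inner)

lemma L2_inner_scaleR_right: "L2_inner S f (\<lambda>x. c *\<^sub>R g x) = c * L2_inner S f g"
  by (simp add: L2_inner_def)

lemma L2_inner_scaleR_left: "L2_inner S (\<lambda>x. c *\<^sub>R f x) g = c * L2_inner S f g"
  by (simp add: L2_inner_def)

lemma L2_inner_self_nonneg: "0 \<le> L2_inner S f f"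
  by (simp add: L2_inner_def)

lemma L2_norm_nonneg: "0 \<le> L2_norm S f"
  by (simp add: L2_norm_def L2_inner_self_nonneg)

lemma L2_norm_power2: "(L2_norm S f)\<^sup>2 = L2_inner S f f"
  by (simp add: L2_norm_def L2_inner_self_nonneg)

lemma L2_Cauchy_Schwarz:
  assumes f: "f \<in> L2 S" and g: "g \<in> L2 S"
  shows "\<bar>L2_inner S f g\<bar> \<le> L2_norm S f * L2_norm S g"
proof -
  define a b c where "a = L2_inner S f f" and "b = L2_inner S f g" and "c = L2_inner S g g"
  have pos: "0 \<le> s\<^sup>2 * a - 2 * s * t * b + t\<^sup>2 * c" for s t
  proof -
    have fs: "(\<lambda>x. s *\<^sub>R f x) \<in> L2 S" "(\<lambda>x. t *\<^sub>R g x) \<in> L2 S" using f g by (auto intro: L2_scaleR)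
    have "0 \<le> L2_inner S (\<lambda>x. s *\<^sub>R f x - t *\<^sub>R g x) (\<lambda>x. s *\<^sub>R f x - t *\<^sub>R g x)"
      by (rule L2_inner_self_nonneg)
    also have "\<dots> = s\<^sup>2 * a - 2 * s * t * b + t\<^sup>2 * c"
      unfolding L2_inner_diff_left[OF fs L2_diff[OF fs]]
        L2_inner_diff_right[OF fs fs(1)] L2_inner_diff_right[OF fs fs(2)]
      by (simp add: L2_inner_scaleR_left L2_inner_scaleR_right a_def b_def c_def power2_eq_square
          L2_inner_commute[of S g f] algebra_simps)
    finally show ?thesis .
  qed
  have ac: "a \<ge> 0" "c \<ge> 0" by (auto simp: a_def c_def L2_inner_self_nonneg)
  have "b\<^sup>2 \<le> a * c"
  proof (cases "c = 0")
    case True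
    have "b = 0"
    proof (rule ccontr)
      \<comment> \<open>The quadratic form is affine in \<open>t\<close>; this \<open>t\<close> makes it equal to \<open>-1\<close>.\<close>
      assume "b \<noteq> 0"
      have "0 \<le> a - 2 * ((a + 1) / (2 * b)) * b" using pos[of 1 "(a + 1) / (2 * b)"] True by simp
      also have "\<dots> = -1" using \<open>b \<noteq> 0\<close> by (simp add: field_simps)
      finally show False by simp
    qed
    then show ?thesis using ac by simp
  next
    case False
    then have "c > 0" using ac by simp
    have "0 \<le> c\<^sup>2 * a - 2 * c * b * b + b\<^sup>2 * c" using pos[of c b] .
    then have "0 \<le> c * (a * c - b\<^sup>2)" by (simp add: power2_eq_square algebra_simps)
    then show ?thesis using \<open>c > 0\<close> by (simp add: zero_le_mult_iff)
  qed
  then have "\<bar>b\<bar> \<le> sqrt (a * c)" by (metis real_sqrt_abs real_sqrt_le_mono)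
  then show ?thesis by (simp add: L2_norm_def a_def b_def c_def real_sqrt_mult)
qed

lemma L2_norm_add_le:
  assumes f: "f \<in> L2 S" and g: "g \<in> L2 S"
  shows "L2_norm S (\<lambda>x. f x + g x) \<le> L2_norm S f + L2_norm S g"
proof (rule power2_le_imp_le)
  have "(L2_norm S (\<lambda>x. f x + g x))\<^sup>2 = L2_inner S f f + 2 * L2_inner S f g + L2_inner S g g"
    unfolding L2_norm_power2
    by (simp add: L2_inner_add_left L2_inner_add_right L2_add f g L2_inner_commute[of S g f])
  also have "\<dots> \<le> (L2_norm S f + L2_norm S g)\<^sup>2"
    using L2_Cauchy_Schwarz[OF f g] by (simp add: power2_sum L2_norm_power2)
  finally show "(L2_norm S (\<lambda>x. f x + g x))\<^sup>2 \<le> (L2_norm S f + L2_norm S g)\<^sup>2" .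
qed (simp add: L2_norm_nonneg)

text \<open>Lebesgue measure is complete, so that an almost-everywhere statement is one about the
  exceptional set itself.\<close>

lemma AE_lebesgue_on_iff_negligible:
  assumes "S \<in> sets lebesgue"
  shows "(AE x in lebesgue_on S. P x) \<longleftrightarrow> negligible {x \<in> S. \<not> P x}"
proof -
  have "(AE x in lebesgue_on S. P x) \<longleftrightarrow> (AE x in lebesgue. x \<in> S \<longrightarrow> P x)"
    using assms by (simp add: AE_restrict_space_iff)
  also have "\<dots> \<longleftrightarrow> {x. \<not> (x \<in> S \<longrightarrow> P x)} \<in> null_sets lebesgue"
    by (simp add: completion.AE_iff_null_sets)
  finally show ?thesis by (simp add: negligible_iff_null_sets)
qed

lemma L2_continuous:
  assumes "continuous_on UNIV f" "bounded S" "S \<in> sets lebesgue"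
  shows "f \<in> L2 S"
proof -
  have m: "f \<in> borel_measurable (lebesgue_on S)"
    by (meson assms(1) assms(3) continuous_imp_measurable_on_sets_lebesgue continuous_on_subset subset_UNIV)
  have S: "S \<in> lmeasurable"
    using assms bounded_set_imp_lmeasurable by blast
  have "compact (f ` closure S)"
    using assms by (intro compact_continuous_image) (auto intro: continuous_on_subset)
  then obtain B where B: "\<And>x. x \<in> closure S \<Longrightarrow> norm (f x) \<le> B"
    by (meson bounded_iff compact_imp_bounded imageI)
  interpret finite_measure "lebesgue_on S" by (rule finite_measure_lebesgue_on[OF S])
  have "integrable (lebesgue_on S) (\<lambda>x. (norm (f x))\<^sup>2)"
  proof (rule integrable_const_bound)
    show "AE x in lebesgue_on S. norm ((norm (f x))\<^sup>2) \<le> B\<^sup>2"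
      using B closure_subset by (intro AE_I2) (auto intro!: power_mono)
  qed (use m in auto)
  then show ?thesis using m by (simp add: L2_def)
qed

lemma L2_integrable:
  fixes f :: "point \<Rightarrow> real"
  assumes "f \<in> L2 S" "bounded S" "S \<in> sets lebesgue"
  shows "integrable (lebesgue_on S) f"
  using L2_integrable_inner[OF assms(1) L2_continuous[OF continuous_on_const assms(2,3), of 1]] by simp

section \<open>Smooth functions and the uniqueness of weak gradients\<close>

lemma partial_eq: "(f has_derivative f') (at x) \<Longrightarrow> partial j f x = f' (axis j 1)"
  by (simp add: partial_def frechet_derivative_at[symmetric])

lemma Ck_SucD: "Ck (Suc n) f \<Longrightarrow> Ck n f"
proof (induction n arbitrary: f)
  case 0
  then show ?case
    by (auto simp: continuous_on_eq_continuous_at intro: differentiable_imp_continuous_within)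
next
  case (Suc n)
  show ?case using Suc.prems Suc.IH by (auto simp del: Ck.simps simp: Ck.simps(2)[of "Suc n" f] Ck.simps(2)[of n f])
qed

lemma Ck_const: "Ck n (\<lambda>x. c)"
proof (induction n arbitrary: c)
  case (Suc n)
  have "partial j (\<lambda>x. c) = (\<lambda>x. 0)" for j
    by (auto simp: fun_eq_iff partial_def)
  then show ?case using Suc by auto
qed auto

lemma Ck_add: "Ck n f \<Longrightarrow> Ck n g \<Longrightarrow> Ck n (\<lambda>x. f x + g x)"
proof (induction n arbitrary: f g)
  case (Suc n)
  have "partial j (\<lambda>x. f x + g x) = (\<lambda>x. partial j f x + partial j g x)" for j
  proof
    fix x
    have "(f has_derivative frechet_derivative f (at x)) (at x)"
      "(g has_derivative frechet_derivative g (at x)) (at x)"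
      using Suc.prems by (auto simp: frechet_derivative_works)
    from partial_eq[OF has_derivative_add[OF this]]
    show "partial j (\<lambda>x. f x + g x) x = partial j f x + partial j g x"
      by (simp add: partial_def)
  qed
  then show ?case using Suc by auto
qed (auto intro: continuous_intros)

lemma partial_mult:
  assumes "f differentiable (at x)" "g differentiable (at x)"
  shows "partial j (\<lambda>x. f x * g x) x = f x * partial j g x + partial j f x * g x"
proof -
  have "(f has_derivative frechet_derivative f (at x)) (at x)"
    "(g has_derivative frechet_derivative g (at x)) (at x)"
    using assms by (auto simp: frechet_derivative_works)
  from partial_eq[OF has_derivative_mult[OF this]] show ?thesis
    by (simp add: partial_def)
qed

lemma Ck_mult: "Ck n f \<Longrightarrow> Ck n g \<Longrightarrow> Ck n (\<lambda>x. f x * g x)"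
proof (induction n arbitrary: f g)
  case (Suc n)
  have "partial j (\<lambda>x. f x * g x) = (\<lambda>x. f x * partial j g x + partial j f x * g x)" for j
    using Suc.prems by (auto simp: partial_mult)
  moreover have "Ck n f" "Ck n g" using Suc.prems Ck_SucD by blast+
  ultimately show ?case using Suc by (auto intro!: Ck_add)
qed (auto intro: continuous_intros)

lemma Ck_nth: "Ck n (\<lambda>x. x $ i)"
proof (cases n)
  case (Suc m)
  have d: "((\<lambda>x::point. x $ i) has_derivative (\<lambda>x. x $ i)) (at x)" for x
    by (intro bounded_linear_imp_has_derivative bounded_linear_vec_nth)
  have "partial j (\<lambda>x. x $ i) = (\<lambda>x. axis j 1 $ i)" for j
    using partial_eq[OF d] by auto
  then show ?thesis using Suc d by (auto simp: Ck_const intro: differentiableI)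
qed (auto intro: continuous_intros)

lemma Ck_affine: "Ck n (\<lambda>x. (A *v x + b) $ i)" for A :: "real^2^2"
  unfolding matrix_vector_mult_def
  by (simp add: sum_2) (intro Ck_add Ck_mult Ck_const Ck_nth)

text \<open>The functions \<open>p(1/t) exp(-1/t)\<close> with a polynomial \<open>p\<close> are closed under derivatives, while
  \<open>exp(-1/t)\<close> alone is not. For the whole class smoothness is an induction.\<close>

definition flat :: "real poly \<Rightarrow> real \<Rightarrow> real" where
  "flat p t = (if t > 0 then poly p (1 / t) * exp (- (1 / t)) else 0)"

lemma poly_times_exp_tendsto_0: "((\<lambda>s::real. poly p s * exp (- s)) \<longlongrightarrow> 0) at_top"
proof -
  have "((\<lambda>s. \<Sum>i\<le>degree p. coeff p i * (s ^ i / exp s)) \<longlongrightarrow> (\<Sum>i\<le>degree p. coeff p i * 0)) at_top"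
    by (intro tendsto_sum tendsto_mult tendsto_const tendsto_power_div_exp_0)
  then show ?thesis
    by (simp add: poly_altdef sum_divide_distrib exp_minus field_simps)
qed

lemma flat_has_derivative:
  "(flat p has_real_derivative flat (monom 1 2 * (p - pderiv p)) t) (at t)"
proof -
  consider "t > 0" | "t < 0" | "t = 0" by linarith
  then show ?thesis
  proof cases
    case 1
    have "((\<lambda>t. poly p (1 / t) * exp (- (1 / t))) has_real_derivative
        flat (monom 1 2 * (p - pderiv p)) t) (at t)"
      using 1 by (auto intro!: derivative_eq_intros DERIV_chain2[OF poly_DERIV]
          simp: flat_def poly_monom field_simps power2_eq_square)
    then show ?thesis
      by (rule has_field_derivative_transform_within_open[where S = "{0<..}"])
        (use 1 in \<open>auto simp: flat_def\<close>)
  next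
    case 2
    have "((\<lambda>t. 0) has_real_derivative flat (monom 1 2 * (p - pderiv p)) t) (at t)"
      using 2 by (simp add: flat_def)
    then show ?thesis
      by (rule has_field_derivative_transform_within_open[where S = "{..<0}"])
        (use 2 in \<open>auto simp: flat_def\<close>)
  next
    case 3
    have "((\<lambda>h. (flat p h) / h) \<longlongrightarrow> 0) (at 0)"
      unfolding filterlim_at_split
    proof
      show "((\<lambda>h. flat p h / h) \<longlongrightarrow> 0) (at_left 0)"
        by (rule tendsto_eventually)
          (auto simp: flat_def eventually_at_filter)
      have "((\<lambda>s. flat p (inverse s) / inverse s) \<longlongrightarrow> 0) at_top"
      proof (rule Lim_transform_eventually[OF poly_times_exp_tendsto_0[of "pCons 0 p"]])
        show "\<forall>\<^sub>F s in at_top. poly (pCons 0 p) s * exp (- s) = flat p (inverse s) / inverse s"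
          using eventually_gt_at_top[of 0]
          by eventually_elim (auto simp: flat_def field_simps)
      qed
      then show "((\<lambda>h. flat p h / h) \<longlongrightarrow> 0) (at_right 0)"
        by (simp add: filterlim_at_right_to_top)
    qed
    then show ?thesis using 3 by (simp add: DERIV_def) (simp add: flat_def)
  qed
qed

lemma Ck_flat: "Ck n (\<lambda>x. flat p (c * x $ i + d))"
proof (induction n arbitrary: p)
  case 0
  have "continuous_on UNIV (flat p)"
    by (meson DERIV_isCont continuous_at_imp_continuous_on flat_has_derivative)
  then show ?case
    by (auto intro!: continuous_on_compose2[of UNIV "flat p"] continuous_intros)
next
  case (Suc n)
  let ?q = "monom 1 2 * (p - pderiv p)"
  have l: "((\<lambda>x::point. c * x $ i + d) has_derivative (\<lambda>h. c * h $ i)) (at x)" for x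
    by (auto intro!: derivative_eq_intros bounded_linear_imp_has_derivative bounded_linear_vec_nth)
  have d: "((\<lambda>x. flat p (c * x $ i + d)) has_derivative (\<lambda>h. (c * h $ i) * flat ?q (c * x $ i + d))) (at x)" for x
    using has_derivative_compose[OF l flat_has_derivative[unfolded has_field_derivative_def]]
    by (simp add: mult.commute)
  have "partial j (\<lambda>x. flat p (c * x $ i + d)) = (\<lambda>x. (c * axis j 1 $ i) * flat ?q (c * x $ i + d))" for j
    using partial_eq[OF d] by auto
  moreover have "\<forall>x. (\<lambda>x. flat p (c * x $ i + d)) differentiable at x"
    using d differentiableI by blast
  ultimately show ?case
    using Suc by (simp add: Ck_mult Ck_const)
qed

text \<open>For growing \<open>r\<close> this tends to the indicator of the box, so that integrals against test functions
  determine integrals over boxes.\<close>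

definition bump :: "point \<Rightarrow> point \<Rightarrow> real \<Rightarrow> point \<Rightarrow> real" where
  "bump a b r x = flat 1 (r * (x $ 1 - a $ 1)) * flat 1 (r * (b $ 1 - x $ 1)) *
                  (flat 1 (r * (x $ 2 - a $ 2)) * flat 1 (r * (b $ 2 - x $ 2)))"

lemma flat_1: "0 \<le> flat 1 t" "flat 1 t \<le> 1" "flat 1 t = 0 \<longleftrightarrow> t \<le> 0"
  by (auto simp: flat_def)

lemma bump_eq_0_iff: "r > 0 \<Longrightarrow> bump a b r x = 0 \<longleftrightarrow> x \<notin> box a b"
  by (auto simp: bump_def flat_1(3) mem_box_cart forall_2 mult_le_0_iff)

lemma abs_bump_le_1: "\<bar>bump a b r x\<bar> \<le> 1"
proof -
  have *: "\<bar>flat 1 t\<bar> \<le> 1" for t using flat_1[of t] by simp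
  show ?thesis unfolding bump_def abs_mult by (intro mult_le_one mult_nonneg_nonneg * abs_ge_zero)
qed

lemma test_function_bump:
  assumes "r > 0" "cbox a b \<subseteq> S"
  shows "test_function S (bump a b r)"
proof -
  have "Ck n (bump a b r)" for n
  proof -
    have "bump a b r = (\<lambda>x. flat 1 (r * x $ 1 + - r * a $ 1) * flat 1 (- r * x $ 1 + r * b $ 1) *
                  (flat 1 (r * x $ 2 + - r * a $ 2) * flat 1 (- r * x $ 2 + r * b $ 2)))"
      by (simp add: fun_eq_iff bump_def algebra_simps)
    then show ?thesis by (simp only:) (intro Ck_mult Ck_flat)
  qed
  moreover have "closure {x. bump a b r x \<noteq> 0} \<subseteq> cbox a b"
    using assms by (intro closure_minimal) (auto simp: bump_eq_0_iff box_subset_cbox[THEN subsetD])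
  moreover from this have "compact (closure {x. bump a b r x \<noteq> 0})"
    by (meson bounded_cbox bounded_subset compact_eq_bounded_closed closed_closure)
  ultimately show ?thesis using assms by (auto simp: test_function_def)
qed

lemma bump_tendsto: "(\<lambda>n. bump a b (real (Suc n)) x) \<longlonglongrightarrow> indicator (box a b) x"
proof -
  have f: "(\<lambda>n. flat 1 (real (Suc n) * t)) \<longlonglongrightarrow> 1" if "t > 0" for t
  proof -
    have "(\<lambda>n. inverse (real (Suc n)) * (1 / t)) \<longlonglongrightarrow> 0 * (1 / t)"
      by (intro tendsto_mult tendsto_const LIMSEQ_inverse_real_of_nat)
    then have "(\<lambda>n. exp (- (inverse (real (Suc n)) * (1 / t)))) \<longlonglongrightarrow> exp (- (0 * (1 / t)))"
      by (intro tendsto_exp tendsto_minus)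
    moreover have "flat 1 (real (Suc n) * t) = exp (- (inverse (real (Suc n)) * (1 / t)))" for n
      using that by (simp add: flat_def field_simps add_pos_nonneg)
    ultimately show ?thesis by simp
  qed
  show ?thesis
  proof (cases "x \<in> box a b")
    case True
    then have "0 < x $ 1 - a $ 1" "0 < b $ 1 - x $ 1" "0 < x $ 2 - a $ 2" "0 < b $ 2 - x $ 2"
      by (auto simp: mem_box_cart)
    from tendsto_mult[OF tendsto_mult[OF f[OF this(1)] f[OF this(2)]] tendsto_mult[OF f[OF this(3)] f[OF this(4)]]]
    show ?thesis using True by (simp add: bump_def)
  next
    case False
    then have "bump a b (real (Suc n)) x = 0" for n
      by (subst bump_eq_0_iff) auto
    then show ?thesis using False by simp
  qed
qed

text \<open>Approximating the indicators of boxes by bumps shows that \<open>G\<close> has zero integral over every box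
  inside \<open>S\<close>, and at almost every point \<open>G\<close> is the limit of its averages over shrinking boxes.\<close>

lemma fundamental_lemma:
  fixes G :: "point \<Rightarrow> real"
  assumes S: "open S" and G: "integrable (lebesgue_on S) G"
    and zero: "\<And>\<phi>. test_function S \<phi> \<Longrightarrow> (LINT x|lebesgue_on S. G x * \<phi> x) = 0"
  shows "AE x in lebesgue_on S. G x = 0"
proof -
  have Sm[simp]: "S \<in> sets lebesgue" using S by auto
  define G' where "G' = (\<lambda>x. if x \<in> S then G x else 0)"
  have "G absolutely_integrable_on S"
    using G by (simp add: set_integrable_def integrable_restrict_space)
  then have "G' absolutely_integrable_on UNIV"
    unfolding G'_def by (simp add: absolutely_integrable_restrict_UNIV)
  then have int: "G' integrable_on cbox a b" for a b
    by (meson absolutely_integrable_on_subcbox set_lebesgue_integral_eq_integral(1) subset_UNIV)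
  have box0: "integral (cbox a b) G' = 0" if ab: "cbox a b \<subseteq> S" for a b
  proof -
    have [measurable]: "G \<in> borel_measurable (lebesgue_on S)" using G by auto
    have mb[measurable]: "box a b \<in> sets lebesgue" by auto
    have bm[measurable]: "bump a b r \<in> borel_measurable (lebesgue_on S)" if "r > 0" for r
    proof -
      have "continuous_on S (bump a b r)"
        using test_function_bump[OF that ab] continuous_on_subset unfolding test_function_def
        by (metis Ck.simps(1) subset_UNIV)
      then show ?thesis by (rule continuous_imp_measurable_on_sets_lebesgue) simp
    qed
    have [measurable]: "indicat_real (box a b) \<in> borel_measurable (lebesgue_on S)"
      by (intro borel_measurable_indicator measurable_restrict_space1) (auto simp: sets_restrict_space)
    have "(\<lambda>n. LINT x|lebesgue_on S. G x * bump a b (real (Suc n)) x)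
        \<longlonglongrightarrow> (LINT x|lebesgue_on S. G x * indicator (box a b) x)"
    proof (rule integral_dominated_convergence[where w = "\<lambda>x. \<bar>G x\<bar>"])
      show "AE x in lebesgue_on S. (\<lambda>n. G x * bump a b (real (Suc n)) x) \<longlonglongrightarrow> G x * indicator (box a b) x"
        by (intro AE_I2 tendsto_mult tendsto_const bump_tendsto)
      show "AE x in lebesgue_on S. norm (G x * bump a b (real (Suc n)) x) \<le> \<bar>G x\<bar>" for n
        using abs_bump_le_1 by (intro AE_I2) (simp add: abs_mult mult_left_le)
    qed (use G in auto)
    moreover have "(LINT x|lebesgue_on S. G x * bump a b (real (Suc n)) x) = 0" for n
      by (rule zero[OF test_function_bump[OF _ ab]]) simp
    ultimately have "(LINT x|lebesgue_on S. G x * indicator (box a b) x) = 0"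
      by (simp add: LIMSEQ_const_iff)
    moreover have "integrable (lebesgue_on S) (\<lambda>x. G x * indicator (box a b) x)"
    proof (rule Bochner_Integration.integrable_bound[OF G])
      show "(\<lambda>x. G x * indicator (box a b) x) \<in> borel_measurable (lebesgue_on S)" by measurable
    qed (auto simp: indicator_def)
    ultimately have "integral S (\<lambda>x. G x * indicator (box a b) x) = 0"
      by (simp add: lebesgue_integral_eq_integral)
    also have "integral S (\<lambda>x. G x * indicator (box a b) x) = integral (box a b) G'"
      unfolding integral_restrict_UNIV[of S, symmetric] integral_restrict_UNIV[of "box a b", symmetric]
      by (rule arg_cong[where f = "integral UNIV"]) (auto simp: G'_def fun_eq_iff)
    finally show ?thesis by (simp add: integral_open_interval)
  qed
  obtain N where N: "negligible N" and
    lim: "\<And>x e. \<lbrakk>x \<notin> N; 0 < e\<rbrakk> \<Longrightarrow> \<exists>d>0. \<forall>h. 0 < h \<and> h < d \<longrightarrow>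
       norm (integral (cbox x (x + h *\<^sub>R One)) G' /\<^sub>R h ^ DIM(point) - G' x) < e"
    using integrable_ccontinuous_explicit[OF int] by blast
  have "G x = 0" if x: "x \<in> S" "x \<notin> N" for x
  proof (rule ccontr)
    assume "G x \<noteq> 0"
    then obtain d where d: "d > 0" "\<And>h. 0 < h \<Longrightarrow> h < d \<Longrightarrow>
       norm (integral (cbox x (x + h *\<^sub>R One)) G' /\<^sub>R h ^ DIM(point) - G' x) < norm (G x)"
      using lim[OF x(2), of "norm (G x)"] by auto
    obtain e where e: "e > 0" "ball x e \<subseteq> S" using S x open_contains_ball by blast
    define h where "h = min (d / 2) (e / 4)"
    have h: "0 < h" "h < d" "2 * h < e" using d e by (auto simp: h_def)
    have "cbox x (x + h *\<^sub>R One) \<subseteq> ball x e"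
    proof
      fix y assume y: "y \<in> cbox x (x + h *\<^sub>R One)"
      have "norm (y - x) \<le> (\<Sum>b\<in>Basis. \<bar>(y - x) \<bullet> b\<bar>)" by (rule norm_le_l1)
      also have "\<dots> \<le> real (card (Basis :: point set)) * h"
        using y by (intro sum_bounded_above) (auto simp: mem_box inner_diff_left inner_add_left)
      finally show "y \<in> ball x e" using h by (simp add: dist_norm norm_minus_commute)
    qed
    then have "integral (cbox x (x + h *\<^sub>R One)) G' = 0" using box0 e by blast
    then show False using d(2)[OF h(1,2)] x by (simp add: G'_def)
  qed
  then have "negligible {x \<in> S. G x \<noteq> 0}" using N negligible_subset by (metis (mono_tags, lifting) mem_Collect_eq subsetI)
  then show ?thesis by (simp add: AE_lebesgue_on_iff_negligible)
qed

lemma test_function_L2: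
  assumes "test_function S \<phi>" "bounded T" "T \<in> sets lebesgue"
  shows "\<phi> \<in> L2 T" "partial j \<phi> \<in> L2 T"
proof -
  have "Ck 0 \<phi>" "Ck (Suc 0) \<phi>" using assms(1) by (auto simp: test_function_def simp del: Ck.simps)
  then have "continuous_on UNIV \<phi>" "continuous_on UNIV (partial j \<phi>)" by auto
  then show "\<phi> \<in> L2 T" "partial j \<phi> \<in> L2 T" using assms by (auto intro: L2_continuous)
qed

lemma L2_nth: "f \<in> L2 S \<Longrightarrow> (\<lambda>x. f x $ i) \<in> L2 S"
  by (rule L2_linear[OF _ bounded_linear_vec_nth])

lemma weak_gradient_unique:
  assumes S: "open S" "bounded S" and G: "has_weak_gradient S v G" and H: "has_weak_gradient S v H"
  shows "AE x in lebesgue_on S. G x = H x"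
proof -
  have Sm: "S \<in> sets lebesgue" using S by auto
  have "AE x in lebesgue_on S. G x $ i $ j - H x $ i $ j = 0" for i j
  proof (rule fundamental_lemma[OF S(1)])
    have L: "(\<lambda>x. G x $ i $ j) \<in> L2 S" "(\<lambda>x. H x $ i $ j) \<in> L2 S"
      using G H by (auto simp: has_weak_gradient_def intro!: L2_nth[of "\<lambda>x. _ x $ i"] L2_nth)
    then show "integrable (lebesgue_on S) (\<lambda>x. G x $ i $ j - H x $ i $ j)"
      by (intro L2_integrable L2_diff S Sm)
    fix \<phi> assume t: "test_function S \<phi>"
    have i: "integrable (lebesgue_on S) (\<lambda>x. G x $ i $ j * \<phi> x)"
      "integrable (lebesgue_on S) (\<lambda>x. H x $ i $ j * \<phi> x)"
      using L2_integrable_inner[OF L(1) test_function_L2(1)[OF t S(2) Sm]]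
        L2_integrable_inner[OF L(2) test_function_L2(1)[OF t S(2) Sm]] by simp_all
    have "(LINT x|lebesgue_on S. (G x $ i $ j - H x $ i $ j) * \<phi> x) =
        (LINT x|lebesgue_on S. G x $ i $ j * \<phi> x) - (LINT x|lebesgue_on S. H x $ i $ j * \<phi> x)"
      using i by (simp add: left_diff_distrib)
    also have "\<dots> = 0"
    proof -
      have "(LINT x|lebesgue_on S. v x $ i * partial j \<phi> x) = - (LINT x|lebesgue_on S. G x $ i $ j * \<phi> x)"
        "(LINT x|lebesgue_on S. v x $ i * partial j \<phi> x) = - (LINT x|lebesgue_on S. H x $ i $ j * \<phi> x)"
        using G H t unfolding has_weak_gradient_def by blast+
      then show ?thesis by linarith
    qed
    finally show "(LINT x|lebesgue_on S. (G x $ i $ j - H x $ i $ j) * \<phi> x) = 0" .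
  qed
  then have "AE x in lebesgue_on S. \<forall>i j. G x $ i $ j - H x $ i $ j = 0"
    by (simp add: forall_2)
  then show ?thesis by eventually_elim (simp add: vec_eq_iff)
qed

section \<open>The divergence theorem on a triangle\<close>

definition det2 :: "point \<Rightarrow> point \<Rightarrow> real" where
  "det2 a b = a $ 1 * b $ 2 - a $ 2 * b $ 1"

lemma Basis_point: "(Basis :: point set) = {axis 1 1, axis 2 1}"
  unfolding Basis_vec_def by (auto simp: UNIV_2)

text \<open>Transports Fubini's theorem for a product of two lines to the plane. In the pair \<open>(t, s)\<close> the
  first coordinate \<open>s\<close> of the point comes last, which makes it the inner variable of integration.\<close>

lemma lborel_plane:
  "lborel = distr (lborel \<Otimes>\<^sub>M lborel) borel (\<lambda>(t, s). s *\<^sub>R axis 1 1 + t *\<^sub>R axis 2 1 :: point)"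
  (is "_ = ?D" is "_ = distr _ _ ?V")
proof (rule lborel_eqI)
  fix l u :: point assume le: "\<And>b. b \<in> Basis \<Longrightarrow> l \<bullet> b \<le> u \<bullet> b"
  have "l \<bullet> axis 1 1 \<le> u \<bullet> axis 1 1" "l \<bullet> axis 2 1 \<le> u \<bullet> axis 2 1"
    by (rule le, simp add: Basis_point)+
  then have le': "l $ 1 \<le> u $ 1" "l $ 2 \<le> u $ 2" by (simp_all add: inner_axis)
  have "?V -` box l u =
      {l $ 2 <..< u $ 2} \<times> {l $ 1 <..< u $ 1}"
    by (auto simp: mem_box_cart forall_2 axis_def)
  then have "emeasure (?D) (box l u)
    = emeasure (lborel \<Otimes>\<^sub>M lborel) ({l $ 2 <..< u $ 2} \<times> {l $ 1 <..< u $ 1})"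
    by (subst emeasure_distr) (auto simp: space_pair_measure)
  also have "\<dots> = (\<Prod>b\<in>Basis. (u - l) \<bullet> b)"
    using le' by (subst lborel.emeasure_pair_measure_Times)
      (auto simp: Basis_point inner_axis axis_eq_axis ennreal_mult mult.commute)
  finally show "emeasure (?D) (box l u)
    = (\<Prod>b\<in>Basis. (u - l) \<bullet> b)" .
qed simp

definition ref_triangle :: "point set" where
  "ref_triangle = {y. 0 \<le> y $ 1 \<and> 0 \<le> y $ 2 \<and> y $ 1 + y $ 2 \<le> 1}"

lemma compact_ref_triangle: "compact ref_triangle"
proof -
  have "ref_triangle \<subseteq> cbox 0 1"
    by (auto simp: ref_triangle_def mem_box_cart forall_2)
  moreover have "closed ref_triangle"
    unfolding ref_triangle_def by (intro closed_Collect_conj closed_Collect_le continuous_intros)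
  ultimately show ?thesis
    by (meson bounded_cbox bounded_subset compact_eq_bounded_closed)
qed

lemma absolutely_integrable_continuous_compact:
  fixes f :: "point \<Rightarrow> 'b::euclidean_space"
  assumes "continuous_on UNIV f" "compact K"
  shows "f absolutely_integrable_on K"
proof -
  obtain a b where "K \<subseteq> cbox a b" using assms compact_imp_bounded bounded_subset_cbox_symmetric by metis
  moreover have "f absolutely_integrable_on cbox a b"
    using assms by (intro absolutely_integrable_continuous) (auto intro: continuous_on_subset)
  moreover have "K \<in> sets lebesgue" using assms by (simp add: borel_compact sets_completionI_sets)
  ultimately show ?thesis by (meson set_integrable_subset)
qed

text \<open>Fubini's theorem, with the fundamental theorem of calculus for the inner integral over
  \<open>0 \<le> s \<le> 1 - t\<close>.\<close>

lemma integral_ref_triangle_partial: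
  fixes \<psi> \<theta> :: "real \<Rightarrow> real \<Rightarrow> real"
  assumes d: "\<And>s t. ((\<lambda>s. \<psi> s t) has_real_derivative \<theta> s t) (at s)"
    and c: "continuous_on UNIV (\<lambda>(s, t). \<psi> s t)"
    and c1: "continuous_on UNIV (\<lambda>(s, t). \<theta> s t)"
  shows "integral ref_triangle (\<lambda>y. \<theta> (y $ 1) (y $ 2)) =
    integral {0..1} (\<lambda>t. \<psi> (1 - t) t) - integral {0..1} (\<lambda>t. \<psi> 0 t)"
proof -
  let ?f = "\<lambda>y::point. indicator ref_triangle y * \<theta> (y $ 1) (y $ 2)"
  have cy: "continuous_on UNIV (\<lambda>y::point. \<theta> (y $ 1) (y $ 2))"
    by (rule continuous_on_compose2[OF c1, of UNIV "\<lambda>y. (y $ 1, y $ 2)", simplified])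
      (intro continuous_intros)
  have ai: "(\<lambda>y::point. \<theta> (y $ 1) (y $ 2)) absolutely_integrable_on ref_triangle"
    by (intro absolutely_integrable_continuous_compact cy compact_ref_triangle)
  have rb[measurable]: "ref_triangle \<in> sets borel" by (simp add: borel_compact compact_ref_triangle)
  have [measurable]: "(\<lambda>y::point. \<theta> (y $ 1) (y $ 2)) \<in> borel_measurable borel"
    using cy by (rule borel_measurable_continuous_onI)
  have fm[measurable]: "?f \<in> borel_measurable borel" by measurable
  have fi: "integrable lborel ?f"
    using ai unfolding set_integrable_def by (subst (asm) integrable_completion) auto
  let ?V = "\<lambda>(t, s). s *\<^sub>R axis 1 1 + t *\<^sub>R axis 2 1 :: point"
  have Vm[measurable]: "?V \<in> lborel \<Otimes>\<^sub>M lborel \<rightarrow>\<^sub>M borel" by measurable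
  have V: "?f (?V (t, s)) = indicator {0..1} t * (\<theta> s t * indicator {0..1 - t} s)" for s t
    by (auto simp: ref_triangle_def axis_def indicator_def)
  have "integral ref_triangle (\<lambda>y. \<theta> (y $ 1) (y $ 2)) = integral\<^sup>L lborel ?f"
    using set_lebesgue_integral_eq_integral(2)[OF ai]
    unfolding set_lebesgue_integral_def by (simp add: integral_completion)
  also have "\<dots> = integral\<^sup>L (lborel \<Otimes>\<^sub>M lborel) (\<lambda>p. ?f (?V p))"
    by (subst lborel_plane, subst integral_distr) auto
  also have "\<dots> = (\<integral>t. (\<integral>s. ?f (?V (t, s)) \<partial>lborel) \<partial>lborel)"
  proof (rule lborel_pair.integral_fst'[symmetric])
    have "integrable (distr (lborel \<Otimes>\<^sub>M lborel) borel ?V) ?f"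
      using fi by (subst lborel_plane[symmetric])
    then show "integrable (lborel \<Otimes>\<^sub>M lborel) (\<lambda>p. ?f (?V p))"
      by (subst (asm) integrable_distr_eq) auto
  qed
  also have "\<dots> = (\<integral>t. indicator {0..1} t *\<^sub>R (\<psi> (1 - t) t - \<psi> 0 t) \<partial>lborel)"
  proof (rule Bochner_Integration.integral_cong)
    fix t :: real
    have "(\<integral>s. \<theta> s t * indicator {0..1 - t} s \<partial>lborel) = \<psi> (1 - t) t - \<psi> 0 t" if "t \<in> {0..1}"
    proof (rule integral_FTC_Icc_real)
      show "isCont (\<lambda>s. \<theta> s t) s" for s
      proof -
        have "continuous_on UNIV (\<lambda>s. \<theta> s t)"
          by (rule continuous_on_compose2[OF c1, of UNIV "\<lambda>s. (s, t)", simplified])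
            (intro continuous_intros)
        then show ?thesis by (simp add: continuous_on_eq_continuous_at)
      qed
    qed (use that d in auto)
    then show "(\<integral>s. ?f (?V (t, s)) \<partial>lborel) = indicator {0..1} t *\<^sub>R (\<psi> (1 - t) t - \<psi> 0 t)"
      unfolding V by (cases "t \<in> {0..1}") auto
  qed simp
  also have "\<dots> = integral {0..1} (\<lambda>t. \<psi> (1 - t) t - \<psi> 0 t)"
  proof -
    have cc: "continuous_on {0..1} (\<lambda>t. \<psi> (1 - t) t - \<psi> 0 t)"
    proof (intro continuous_on_diff)
      show "continuous_on {0..1} (\<lambda>t. \<psi> (1 - t) t)"
        by (rule continuous_on_compose2[OF c, of _ "\<lambda>t. (1 - t, t)", simplified]) (intro continuous_intros)
      show "continuous_on {0..1} (\<lambda>t. \<psi> 0 t)"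
        by (rule continuous_on_compose2[OF c, of _ "\<lambda>t. (0, t)", simplified]) (intro continuous_intros)
    qed
    have "set_integrable lborel {0..1} (\<lambda>t. \<psi> (1 - t) t - \<psi> 0 t)"
      unfolding set_integrable_def using cc by (rule borel_integrable_atLeastAtMost'[unfolded set_integrable_def])
    from set_borel_integral_eq_integral(2)[OF this] show ?thesis
      by (simp add: set_lebesgue_integral_def)
  qed
  also have "\<dots> = integral {0..1} (\<lambda>t. \<psi> (1 - t) t) - integral {0..1} (\<lambda>t. \<psi> 0 t)"
  proof (rule Henstock_Kurzweil_Integration.integral_diff)
    show "(\<lambda>t. \<psi> (1 - t) t) integrable_on {0..1}"
      by (rule integrable_continuous_real)
        (rule continuous_on_compose2[OF c, of _ "\<lambda>t. (1 - t, t)", simplified], intro continuous_intros)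
    show "(\<lambda>t. \<psi> 0 t) integrable_on {0..1}"
      by (rule integrable_continuous_real)
        (rule continuous_on_compose2[OF c, of _ "\<lambda>t. (0, t)", simplified], intro continuous_intros)
  qed
  finally show ?thesis .
qed

lemma triangle_eq_image:
  "convex hull {z, z + a, z + b} = (\<lambda>y. z + (y $ 1 *\<^sub>R a + y $ 2 *\<^sub>R b)) ` ref_triangle"
proof (intro equalityI subsetI)
  fix x assume "x \<in> convex hull {z, z + a, z + b}"
  then obtain u v w where *: "0 \<le> u" "0 \<le> v" "0 \<le> w" "u + v + w = 1"
    "x = u *\<^sub>R z + v *\<^sub>R (z + a) + w *\<^sub>R (z + b)"
    by (auto simp: convex_hull_3)
  have "x = (u + v + w) *\<^sub>R z + (v *\<^sub>R a + w *\<^sub>R b)"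
    unfolding *(5) by (simp add: algebra_simps)
  then have "x = z + ((v *\<^sub>R axis 1 1 + w *\<^sub>R axis 2 1 :: point) $ 1 *\<^sub>R a + (v *\<^sub>R axis 1 1 + w *\<^sub>R axis 2 1 :: point) $ 2 *\<^sub>R b)"
    using * by (simp add: axis_def)
  moreover have "v *\<^sub>R axis 1 1 + w *\<^sub>R axis 2 1 \<in> ref_triangle"
    using * by (auto simp: ref_triangle_def axis_def)
  ultimately show "x \<in> (\<lambda>y. z + (y $ 1 *\<^sub>R a + y $ 2 *\<^sub>R b)) ` ref_triangle" by blast
next
  fix x assume "x \<in> (\<lambda>y. z + (y $ 1 *\<^sub>R a + y $ 2 *\<^sub>R b)) ` ref_triangle"
  then obtain y :: point where y: "0 \<le> y $ 1" "0 \<le> y $ 2" "y $ 1 + y $ 2 \<le> 1" "x = z + (y $ 1 *\<^sub>R a + y $ 2 *\<^sub>R b)"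
    by (auto simp: ref_triangle_def)
  have "x = (1 - y $ 1 - y $ 2) *\<^sub>R z + y $ 1 *\<^sub>R (z + a) + y $ 2 *\<^sub>R (z + b)"
    using y by (simp add: algebra_simps)
  then show "x \<in> convex hull {z, z + a, z + b}"
    unfolding convex_hull_3 using y by (intro CollectI exI[of _ "1 - y $ 1 - y $ 2"] exI[of _ "y $ 1"] exI[of _ "y $ 2"]) auto
qed

lemma det2_independent:
  assumes "det2 a b \<noteq> 0" "s *\<^sub>R a + t *\<^sub>R b = 0"
  shows "s = 0" "t = 0"
proof -
  have e: "s * a $ 1 + t * b $ 1 = 0" "s * a $ 2 + t * b $ 2 = 0"
    using assms(2) by (auto simp: vec_eq_iff forall_2)
  have "s * det2 a b = (s * a $ 1 + t * b $ 1) * b $ 2 - (s * a $ 2 + t * b $ 2) * b $ 1"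
    by (simp add: det2_def algebra_simps)
  then show "s = 0" using e assms by simp
  have "t * det2 a b = (s * a $ 2 + t * b $ 2) * a $ 1 - (s * a $ 1 + t * b $ 1) * a $ 2"
    by (simp add: det2_def algebra_simps)
  then show "t = 0" using e assms by simp
qed

lemma integral_triangle:
  fixes F :: "point \<Rightarrow> real"
  assumes d: "det2 a b \<noteq> 0" and F: "continuous_on UNIV F"
  shows "integral (convex hull {z, z + a, z + b}) F =
    \<bar>det2 a b\<bar> * integral ref_triangle (\<lambda>y. F (z + (y $ 1 *\<^sub>R a + y $ 2 *\<^sub>R b)))"
proof -
  define g where "g = (\<lambda>y::point. z + (y $ 1 *\<^sub>R a + y $ 2 *\<^sub>R b))"
  define g' where "g' = (\<lambda>y::point. y $ 1 *\<^sub>R a + y $ 2 *\<^sub>R b)"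
  have lin: "linear g'" unfolding g'_def by (intro linearI) (auto simp: algebra_simps)
  have det: "det (matrix g') = det2 a b"
    by (simp add: det_2 matrix_def g'_def det2_def axis_def)
  have der: "(g has_derivative g') (at y within ref_triangle)" for y
    using has_derivative_add[OF has_derivative_const linear_imp_has_derivative[OF lin]]
    by (simp add: g_def g'_def)
  have inj: "inj_on g ref_triangle"
  proof (rule inj_onI)
    fix x y assume "g x = g y"
    then have "(x $ 1 - y $ 1) *\<^sub>R a + (x $ 2 - y $ 2) *\<^sub>R b = 0" by (simp add: g_def algebra_simps)
    from det2_independent[OF d this] show "x = y" by (simp add: vec_eq_iff forall_2)
  qed
  \<comment> \<open>The change of variables formula is one for functions into \<open>real^'n\<close>.\<close>
  define f :: "point \<Rightarrow> real^1" where "f = (\<lambda>x. F x *\<^sub>R axis 1 1)"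
  have cf: "continuous_on UNIV f" unfolding f_def using F by (intro continuous_intros)
  have S: "ref_triangle \<in> sets lebesgue" by (simp add: borel_compact compact_ref_triangle sets_completionI_sets)
  have cg: "continuous_on UNIV g" unfolding g_def by (intro continuous_intros)
  have cFg: "continuous_on UNIV (\<lambda>y. F (g y))" by (rule continuous_on_compose2[OF F cg]) auto
  have fi: "f absolutely_integrable_on g ` ref_triangle"
    by (intro absolutely_integrable_continuous_compact[OF cf] compact_continuous_image compact_ref_triangle
        continuous_on_subset[OF cg]) auto
  have "integral ref_triangle (\<lambda>x. \<bar>det (matrix g')\<bar> *\<^sub>R f (g x)) = integral (g ` ref_triangle) f"
    using has_absolute_integral_change_of_variables[OF S der inj, of f "integral (g ` ref_triangle) f"] fi by blast
  moreover have "integral ref_triangle (\<lambda>x. \<bar>det (matrix g')\<bar> *\<^sub>R f (g x)) =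
     (\<bar>det2 a b\<bar> * integral ref_triangle (\<lambda>x. F (g x))) *\<^sub>R axis 1 1"
  proof -
    have "(\<lambda>y. F (g y)) integrable_on ref_triangle"
      using absolutely_integrable_continuous_compact[OF cFg compact_ref_triangle]
      by (rule set_lebesgue_integral_eq_integral(1))
    from has_integral_scaleR_left[OF has_integral_mult_right[OF integrable_integral[OF this]], of "\<bar>det2 a b\<bar>" "axis 1 1 :: real^1"]
    show ?thesis unfolding det f_def by (intro integral_unique) simp
  qed
  moreover have "integral (g ` ref_triangle) f = integral (g ` ref_triangle) F *\<^sub>R axis 1 1"
  proof -
    have "F integrable_on g ` ref_triangle"
      by (rule set_lebesgue_integral_eq_integral(1), rule absolutely_integrable_continuous_compact[OF F])
        (intro compact_continuous_image compact_ref_triangle continuous_on_subset[OF cg], auto)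
    from has_integral_scaleR_left[OF integrable_integral[OF this]] show ?thesis
      unfolding f_def by (intro integral_unique) 
  qed
  ultimately have "integral (g ` ref_triangle) F = \<bar>det2 a b\<bar> * integral ref_triangle (\<lambda>x. F (g x))"
    by (metis axis_nth vector_scaleR_component real_scaleR_def mult.right_neutral)
  then show ?thesis unfolding triangle_eq_image g_def .
qed

lemma Ck_1_has_derivative:
  assumes "Ck (Suc 0) h"
  shows "(h has_derivative (\<lambda>v. v $ 1 * partial 1 h x + v $ 2 * partial 2 h x)) (at x)"
proof -
  have d: "(h has_derivative frechet_derivative h (at x)) (at x)"
    using assms by (simp add: frechet_derivative_works)
  then have l: "linear (frechet_derivative h (at x))" by (rule has_derivative_linear)
  have "frechet_derivative h (at x) v = v $ 1 * partial 1 h x + v $ 2 * partial 2 h x" for v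
  proof -
    have v: "v = v $ 1 *\<^sub>R axis 1 1 + v $ 2 *\<^sub>R axis 2 1"
      by (simp add: vec_eq_iff forall_2 axis_def)
    show ?thesis
      by (subst v, unfold linear_add[OF l] linear_scale[OF l]) (simp add: partial_def)
  qed
  then show ?thesis using d by (metis (no_types, lifting) ext)
qed

text \<open>The derivative along the side \<open>a\<close> sees only the other two sides, and of these only the mean
  values of \<open>h\<close>. Taking for \<open>a\<close> either side at \<open>z\<close> gives the integral of the whole gradient.\<close>

lemma integral_triangle_derivative:
  assumes d: "det2 a b \<noteq> 0" and h: "Ck (Suc 0) h"
  shows "integral (convex hull {z, z + a, z + b}) (\<lambda>x. a $ 1 * partial 1 h x + a $ 2 * partial 2 h x) =
    \<bar>det2 a b\<bar> * (integral {0..1} (\<lambda>t. h (z + ((1 - t) *\<^sub>R a + t *\<^sub>R b))) - integral {0..1} (\<lambda>t. h (z + t *\<^sub>R b)))"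
proof -
  let ?F = "\<lambda>x. a $ 1 * partial 1 h x + a $ 2 * partial 2 h x"
  have ch: "continuous_on UNIV h" using Ck_SucD[OF h] by simp
  have cF: "continuous_on UNIV ?F" using h by (auto intro!: continuous_intros)
  let ?g = "\<lambda>(s, t). z + (s *\<^sub>R a + t *\<^sub>R b)"
  have cg: "continuous_on UNIV ?g" by (auto intro!: continuous_intros simp: case_prod_beta)
  have "integral ref_triangle (\<lambda>y. ?F (z + (y $ 1 *\<^sub>R a + y $ 2 *\<^sub>R b))) =
    integral {0..1} (\<lambda>t. h (z + ((1 - t) *\<^sub>R a + t *\<^sub>R b))) - integral {0..1} (\<lambda>t. h (z + (0 *\<^sub>R a + t *\<^sub>R b)))"
  proof (rule integral_ref_triangle_partial[where \<psi> = "\<lambda>s t. h (z + (s *\<^sub>R a + t *\<^sub>R b))" and \<theta> = "\<lambda>s t. ?F (z + (s *\<^sub>R a + t *\<^sub>R b))"])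
    fix s t :: real
    have "((\<lambda>s. z + (s *\<^sub>R a + t *\<^sub>R b)) has_derivative (\<lambda>s. s *\<^sub>R a)) (at s)"
      by (auto intro!: derivative_eq_intros)
    from has_derivative_compose[OF this Ck_1_has_derivative[OF h]]
    have "((\<lambda>s. h (z + (s *\<^sub>R a + t *\<^sub>R b))) has_derivative (\<lambda>r. ?F (z + (s *\<^sub>R a + t *\<^sub>R b)) * r)) (at s)"
      by (rule has_derivative_eq_rhs) (simp add: fun_eq_iff algebra_simps)
    then show "((\<lambda>s. h (z + (s *\<^sub>R a + t *\<^sub>R b))) has_real_derivative ?F (z + (s *\<^sub>R a + t *\<^sub>R b))) (at s)"
      by (simp add: has_field_derivative_def)
  next
    show "continuous_on UNIV (\<lambda>(s, t). h (z + (s *\<^sub>R a + t *\<^sub>R b)))"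
      using continuous_on_compose2[OF ch cg] by (simp add: case_prod_beta)
    show "continuous_on UNIV (\<lambda>(s, t). ?F (z + (s *\<^sub>R a + t *\<^sub>R b)))"
      using continuous_on_compose2[OF cF cg] by (simp add: case_prod_beta)
  qed
  then show ?thesis by (simp add: integral_triangle[OF d cF])
qed

section \<open>Weak gradients\<close>

lemma partial_outside_support:
  assumes "x \<notin> closure {x. \<psi> x \<noteq> 0}"
  shows "partial j \<psi> x = 0"
proof -
  have 0: "\<psi> y = 0" if "y \<in> - closure {x. \<psi> x \<noteq> 0}" for y
    using that closure_subset[of "{x. \<psi> x \<noteq> 0}"] by blast
  have "((\<lambda>x. 0) has_derivative (\<lambda>v. 0)) (at x)" by simp
  then have "(\<psi> has_derivative (\<lambda>v. 0)) (at x)"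
  proof (rule has_derivative_transform_within_open)
    show "open (- closure {x. \<psi> x \<noteq> 0})" by (rule open_Compl[OF closed_closure])
    show "x \<in> - closure {x. \<psi> x \<noteq> 0}" using assms by simp
  qed (rule 0[symmetric])
  then show ?thesis using partial_eq by fastforce
qed

text \<open>In a large right triangle around the support with legs parallel to the axes, \<open>h\<close> vanishes on
  the two sides that enter \<open>integral_triangle_derivative\<close>.\<close>

lemma integral_partial_compact_support:
  assumes h: "Ck (Suc 0) h" and C: "bounded C" and out: "\<And>x. x \<notin> C \<Longrightarrow> h x = 0"
    and out': "\<And>x. x \<notin> C \<Longrightarrow> partial j h x = 0"
  shows "integral UNIV (partial j h) = 0"
proof -
  obtain R where R: "R > 0" "C \<subseteq> ball 0 R"
    using C bounded_subset_ballD by blast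
  define i :: 2 where "i = (if j = 1 then 2 else 1)"
  have ij: "(i = 1 \<and> j = 2) \<or> (i = 2 \<and> j = 1)"
    using exhaust_2[of j] by (auto simp: i_def)
  define a b z :: point where "a = (4 * R) *\<^sub>R axis j 1" and "b = (4 * R) *\<^sub>R axis i 1" and "z = (\<chi> k. - R)"
  have d: "det2 a b \<noteq> 0"
    using ij R by (auto simp: det2_def a_def b_def axis_def)
  have hz: "h x = 0" if "R \<le> \<bar>x $ k\<bar>" for x k
    using component_le_norm_cart[of x k] that R(2) by (intro out) auto
  have "h (z + t *\<^sub>R b) = 0" for t
    using ij R by (intro hz[of _ j]) (auto simp: z_def b_def axis_def)
  moreover have "h (z + ((1 - t) *\<^sub>R a + t *\<^sub>R b)) = 0" for t
  proof (cases "t \<le> 1/2")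
    case True
    then have "R * t * 2 \<le> R" using R by simp
    then show ?thesis using ij by (intro hz[of _ j]) (auto simp: z_def a_def b_def axis_def algebra_simps)
  next
    case False
    then have "R * t * 2 \<ge> R" using R by simp
    then show ?thesis using ij by (intro hz[of _ i]) (auto simp: z_def a_def b_def axis_def algebra_simps)
  qed
  ultimately have 0: "integral (convex hull {z, z + a, z + b}) (\<lambda>x. a $ 1 * partial 1 h x + a $ 2 * partial 2 h x) = 0"
    using integral_triangle_derivative[OF d h, of z] by simp
  have "(\<lambda>x. a $ 1 * partial 1 h x + a $ 2 * partial 2 h x) = (\<lambda>x. (4 * R) *\<^sub>R partial j h x)"
    using ij by (auto simp: a_def axis_def)
  with 0 have "(4 * R) *\<^sub>R integral (convex hull {z, z + a, z + b}) (partial j h) = 0"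
    by (metis integral_cmul)
  then have "integral (convex hull {z, z + a, z + b}) (partial j h) = 0" using R by simp
  moreover have "C \<subseteq> convex hull {z, z + a, z + b}"
  proof
    fix x assume "x \<in> C"
    then have "norm x < R" using R by auto
    then have x: "\<bar>x $ 1\<bar> < R" "\<bar>x $ 2\<bar> < R" using component_le_norm_cart[of x] by (meson le_less_trans)+
    define y :: point where "y = ((x $ j + R) / (4 * R)) *\<^sub>R axis 1 1 + ((x $ i + R) / (4 * R)) *\<^sub>R axis 2 1"
    have "0 \<le> (x $ k + R) / (4 * R)" "(x $ k + R) / (4 * R) \<le> 1 / 2" for k
      using exhaust_2[of k] x R by (auto simp: field_simps)
    from this(1)[of i] this(1)[of j] add_mono[OF this(2)[of j] this(2)[of i]]
    have "y \<in> ref_triangle" by (simp add: ref_triangle_def y_def axis_def)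
    moreover have "x = z + (y $ 1 *\<^sub>R a + y $ 2 *\<^sub>R b)"
      using ij R by (auto simp: vec_eq_iff forall_2 z_def y_def a_def b_def axis_def)
    ultimately show "x \<in> convex hull {z, z + a, z + b}" unfolding triangle_eq_image by blast
  qed
  then have "integral (convex hull {z, z + a, z + b}) (partial j h) = integral UNIV (partial j h)"
    using out' by (intro integral_spike_set) (auto intro!: negligible_subset[OF negligible_empty])
  ultimately show ?thesis by simp
qed

lemma LINT_lebesgue_on_vanishing:
  fixes F :: "point \<Rightarrow> 'b::euclidean_space"
  assumes "T \<subseteq> S" "T \<in> sets lebesgue" "S \<in> sets lebesgue" "\<And>x. x \<in> S - T \<Longrightarrow> F x = 0"
  shows "(LINT x|lebesgue_on S. F x) = (LINT x|lebesgue_on T. F x)"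
proof -
  have "(\<lambda>x. indicat_real S x *\<^sub>R F x) = (\<lambda>x. indicat_real T x *\<^sub>R F x)"
    using assms by (auto simp: fun_eq_iff indicator_def)
  then show ?thesis using assms by (simp add: integral_restrict_space)
qed

lemma integration_by_parts:
  assumes S: "open S" "bounded S" and f: "Ck (Suc 0) f" and t: "test_function S \<psi>"
  shows "(LINT x|lebesgue_on S. f x * partial j \<psi> x) = - (LINT x|lebesgue_on S. partial j f x * \<psi> x)"
proof -
  have Sm: "S \<in> sets lebesgue" using S by auto
  define C where "C = closure {x. \<psi> x \<noteq> 0}"
  have C: "compact C" "C \<subseteq> S" using t by (auto simp: test_function_def C_def)
  have p: "Ck (Suc 0) \<psi>" using t unfolding test_function_def by blast
  have h: "Ck (Suc 0) (\<lambda>x. f x * \<psi> x)" by (intro Ck_mult f p)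
  have ph: "partial j (\<lambda>x. f x * \<psi> x) = (\<lambda>x. f x * partial j \<psi> x + partial j f x * \<psi> x)"
    using f p by (auto simp: partial_mult)
  have out: "\<psi> x = 0" "partial j \<psi> x = 0" if "x \<notin> C" for x
    using that partial_outside_support[of x \<psi>] closure_subset[of "{x. \<psi> x \<noteq> 0}"] by (auto simp: C_def)
  have c: "continuous_on UNIV f" "continuous_on UNIV \<psi>" "continuous_on UNIV (partial j f)" "continuous_on UNIV (partial j \<psi>)"
    using f p Ck_SucD[OF f] Ck_SucD[OF p] by auto
  have i1: "integrable (lebesgue_on S) (\<lambda>x. f x * partial j \<psi> x)"
    using L2_integrable_inner[OF L2_continuous[OF c(1) S(2) Sm] L2_continuous[OF c(4) S(2) Sm]] by simp
  have i2: "integrable (lebesgue_on S) (\<lambda>x. partial j f x * \<psi> x)"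
    using L2_integrable_inner[OF L2_continuous[OF c(3) S(2) Sm] L2_continuous[OF c(2) S(2) Sm]] by simp
  have "(LINT x|lebesgue_on S. f x * partial j \<psi> x) + (LINT x|lebesgue_on S. partial j f x * \<psi> x)
      = (LINT x|lebesgue_on S. partial j (\<lambda>x. f x * \<psi> x) x)"
    using i1 i2 by (simp add: ph)
  also have "\<dots> = integral S (partial j (\<lambda>x. f x * \<psi> x))"
    using i1 i2 Sm by (intro lebesgue_integral_eq_integral) (auto simp: ph)
  also have "\<dots> = integral UNIV (partial j (\<lambda>x. f x * \<psi> x))"
  proof (intro integral_spike_set)
    have "partial j (\<lambda>x. f x * \<psi> x) x = 0" if "x \<notin> S" for x
    proof -
      have "x \<notin> C" using that C by auto
      then show ?thesis by (simp add: ph out)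
    qed
    then have empty: "{x \<in> UNIV - S. partial j (\<lambda>x. f x * \<psi> x) x \<noteq> 0} = {}" by blast
    show "negligible {x \<in> UNIV - S. partial j (\<lambda>x. f x * \<psi> x) x \<noteq> 0}"
      unfolding empty by (rule negligible_empty)
  qed simp
  also have "\<dots> = 0"
    using compact_imp_bounded[OF C(1)] out
    by (intro integral_partial_compact_support[OF h, where C = C]) (auto simp: ph)
  finally show ?thesis by simp
qed

lemma has_weak_gradient_C1:
  assumes S: "open S" "bounded S" and v: "\<And>i. Ck (Suc 0) (\<lambda>x. v x $ i)"
  shows "has_weak_gradient S v (\<lambda>x. \<chi> i j. partial j (\<lambda>x. v x $ i) x)"
proof -
  have Sm: "S \<in> sets lebesgue" using S by auto
  have "continuous_on UNIV (\<lambda>x. \<chi> i. v x $ i)"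
    using Ck_SucD[OF v] by (intro continuous_on_vec_lambda) auto
  then have "v \<in> L2 S" by (intro L2_continuous S Sm) simp
  moreover have "continuous_on UNIV (\<lambda>x. \<chi> i j. partial j (\<lambda>x. v x $ i) x)"
    using v by (intro continuous_on_vec_lambda) auto
  then have "(\<lambda>x. \<chi> i j. partial j (\<lambda>x. v x $ i) x) \<in> L2 S" by (intro L2_continuous S Sm)
  ultimately show ?thesis
    unfolding has_weak_gradient_def using integration_by_parts[OF S v] by simp
qed

lemma partial_affine: "partial j (\<lambda>x. (A *v x + b) $ i) = (\<lambda>x. A $ i $ j)" for A :: "real^2^2"
proof
  fix x :: point
  have "((\<lambda>x. (A *v x + b) $ i) has_derivative (\<lambda>v. (A *v v) $ i)) (at x)"
    using has_derivative_add[OF bounded_linear_imp_has_derivative[OF bounded_linear_compose[OF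
          bounded_linear_vec_nth matrix_vector_mul_bounded_linear]] has_derivative_const]
    by simp
  from partial_eq[OF this, of j] show "partial j (\<lambda>x. (A *v x + b) $ i) x = A $ i $ j"
    by (simp add: matrix_vector_mult_basis column_def)
qed

lemma has_weak_gradient_affine:
  assumes "open S" "bounded S"
  shows "has_weak_gradient S (\<lambda>x. A *v x + b) (\<lambda>x. A)"
  using has_weak_gradient_C1[OF assms Ck_affine[of "Suc 0" A b]]
  unfolding partial_affine by (simp add: vec_lambda_eta)

lemma L2_AE_cong:
  assumes S: "S \<in> sets lebesgue" and f: "f \<in> L2 S" and ae: "AE x in lebesgue_on S. f x = g x"
  shows "g \<in> L2 S"
proof -
  have fm[measurable]: "f \<in> borel_measurable (lebesgue_on S)" using f by (simp add: L2_def)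
  have gm[measurable]: "g \<in> borel_measurable (lebesgue_on S)"
  proof -
    let ?f = "\<lambda>x. if x \<in> S then f x else 0" and ?g = "\<lambda>x. if x \<in> S then g x else 0"
    have "?f \<in> borel_measurable lebesgue" using fm S by (simp add: borel_measurable_if)
    moreover have "AE x in lebesgue. ?f x = ?g x"
      using ae S by (simp add: AE_restrict_space_iff)
    ultimately have "?g \<in> borel_measurable lebesgue"
      by (rule borel_measurable_AE)
    then show ?thesis using S by (simp add: borel_measurable_if)
  qed
  have "integrable (lebesgue_on S) (\<lambda>x. (norm (f x))\<^sup>2) = integrable (lebesgue_on S) (\<lambda>x. (norm (g x))\<^sup>2)"
    by (rule integrable_cong_AE) (simp, simp, use ae in eventually_elim, simp)
  then show ?thesis using f gm by (simp add: L2_def)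
qed

lemma L2_inner_AE_cong:
  assumes "S \<in> sets lebesgue" "f \<in> L2 S" "g \<in> L2 S"
    and "AE x in lebesgue_on S. f x = f' x" "AE x in lebesgue_on S. g x = g' x"
  shows "L2_inner S f g = L2_inner S f' g'"
proof -
  have [measurable]: "f \<in> borel_measurable (lebesgue_on S)" "g \<in> borel_measurable (lebesgue_on S)"
    "f' \<in> borel_measurable (lebesgue_on S)" "g' \<in> borel_measurable (lebesgue_on S)"
    using assms L2_AE_cong unfolding L2_def by blast+
  show ?thesis unfolding L2_inner_def
    by (rule integral_cong_AE) (simp, simp, use assms(4,5) in eventually_elim, simp)
qed

lemma has_weak_gradient_AE_cong:
  assumes S: "S \<in> sets lebesgue" "bounded S" and G: "has_weak_gradient S v G" and ae: "AE x in lebesgue_on S. v x = w x"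
  shows "has_weak_gradient S w G"
proof -
  have "(LINT x|lebesgue_on S. v x $ i * partial j \<phi> x) = (LINT x|lebesgue_on S. w x $ i * partial j \<phi> x)"
    if t: "test_function S \<phi>" for \<phi> i j
  proof -
    have "v \<in> L2 S" using G by (simp add: has_weak_gradient_def)
    moreover have "AE x in lebesgue_on S. v x $ i = w x $ i" using ae by eventually_elim simp
    ultimately have "L2_inner S (\<lambda>x. v x $ i) (partial j \<phi>) = L2_inner S (\<lambda>x. w x $ i) (partial j \<phi>)"
      by (intro L2_inner_AE_cong[OF S(1)] L2_nth test_function_L2(2)[OF t S(2,1)]) auto
    then show ?thesis by (simp add: L2_inner_def)
  qed
  then show ?thesis using G L2_AE_cong[OF S(1) _ ae] unfolding has_weak_gradient_def by simp
qed

lemma L2_subset: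
  assumes "f \<in> L2 S" "T \<subseteq> S" "T \<in> sets lebesgue" "S \<in> sets lebesgue"
  shows "f \<in> L2 T"
proof -
  have "f \<in> borel_measurable (lebesgue_on T)"
    using assms measurable_restrict_mono unfolding L2_def by blast
  moreover have "set_integrable lebesgue S (\<lambda>x. (norm (f x))\<^sup>2)"
    using assms by (simp add: L2_def set_integrable_def integrable_restrict_space)
  then have "set_integrable lebesgue T (\<lambda>x. (norm (f x))\<^sup>2)"
    using assms by (meson set_integrable_subset)
  ultimately show ?thesis
    using assms by (simp add: L2_def set_integrable_def integrable_restrict_space)
qed

text \<open>A test function on the smaller set is one on the larger set.\<close>

lemma has_weak_gradient_subset:
  assumes G: "has_weak_gradient S v G" and T: "T \<subseteq> S" "open T" and S: "open S"
  shows "has_weak_gradient T v G"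
proof -
  have m: "T \<in> sets lebesgue" "S \<in> sets lebesgue" using T S by auto
  have "(LINT x|lebesgue_on T. v x $ i * partial j \<phi> x) = - (LINT x|lebesgue_on T. G x $ i $ j * \<phi> x)"
    if t: "test_function T \<phi>" for \<phi> i j
  proof -
    have sub: "closure {x. \<phi> x \<noteq> 0} \<subseteq> T" using t by (simp add: test_function_def)
    then have t': "test_function S \<phi>" using t T by (auto simp: test_function_def)
    have out: "\<phi> x = 0" "partial j \<phi> x = 0" if "x \<notin> T" for x
      using that sub closure_subset[of "{x. \<phi> x \<noteq> 0}"] partial_outside_support[of x \<phi>] by auto
    have "(LINT x|lebesgue_on S. v x $ i * partial j \<phi> x) = (LINT x|lebesgue_on T. v x $ i * partial j \<phi> x)"
      "(LINT x|lebesgue_on S. G x $ i $ j * \<phi> x) = (LINT x|lebesgue_on T. G x $ i $ j * \<phi> x)"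
      using out by (auto intro!: LINT_lebesgue_on_vanishing T m)
    moreover have "(LINT x|lebesgue_on S. v x $ i * partial j \<phi> x) = - (LINT x|lebesgue_on S. G x $ i $ j * \<phi> x)"
      using G t' unfolding has_weak_gradient_def by blast
    ultimately show ?thesis by simp
  qed
  moreover have "v \<in> L2 T" "G \<in> L2 T"
    using G L2_subset[OF _ T(1) m] by (auto simp: has_weak_gradient_def)
  ultimately show ?thesis by (simp add: has_weak_gradient_def)
qed

lemma has_weak_gradient_diff:
  assumes S: "S \<in> sets lebesgue" "bounded S" and v: "has_weak_gradient S v G" and w: "has_weak_gradient S w H"
  shows "has_weak_gradient S (\<lambda>x. v x - w x) (\<lambda>x. G x - H x)"
proof -
  have L: "v \<in> L2 S" "G \<in> L2 S" "w \<in> L2 S" "H \<in> L2 S" using v w by (auto simp: has_weak_gradient_def)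
  have "(LINT x|lebesgue_on S. (v x - w x) $ i * partial j \<phi> x) = - (LINT x|lebesgue_on S. (G x - H x) $ i $ j * \<phi> x)"
    if t: "test_function S \<phi>" for \<phi> i j
  proof -
    note p = test_function_L2[OF t S(2,1)]
    have "L2_inner S (\<lambda>x. v x $ i - w x $ i) (partial j \<phi>) = - L2_inner S (\<lambda>x. G x $ i $ j - H x $ i $ j) \<phi>"
      using v w t
      by (subst (1 2) L2_inner_diff_left) (auto simp: L2_nth L p has_weak_gradient_def L2_inner_def intro!: L2_nth[of "\<lambda>x. _ x $ i"])
    then show ?thesis by (simp add: L2_inner_def)
  qed
  then show ?thesis using L by (auto simp: has_weak_gradient_def L2_diff)
qed

lemma weak_grad_eq:
  assumes "open S" "bounded S" "has_weak_gradient S v G"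
  shows "AE x in lebesgue_on S. weak_grad S v x = G x"
  using weak_gradient_unique[OF assms(1,2) _ assms(3)] someI[of "has_weak_gradient S v", OF assms(3)]
  by (simp add: weak_grad_def)

section \<open>Triangles and their bisection\<close>

lemma measure_triangle:
  "measure lebesgue (convex hull {z, x, y}) = \<bar>det2 (x - z) (y - z)\<bar> / 2" for x y z :: point
proof -
  have "measure lebesgue (convex hull {z, x, y}) = measure lborel (convex hull {z, x, y})"
    by (intro measure_completion) (simp add: borel_compact finite_imp_compact_convex_hull)
  then show ?thesis unfolding content_triangle
    by (simp add: det2_def abs_minus_commute mult.commute)
qed

lemma det2_nonzero_imp_affine_independent:
  assumes "det2 (x - z) (y - z) \<noteq> 0"
  shows "\<not> affine_dependent {z, x, y}" "z \<noteq> x" "z \<noteq> y" "x \<noteq> y"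
proof -
  show ne: "z \<noteq> x" "z \<noteq> y" "x \<noteq> y" using assms by (auto simp: det2_def)
  have "independent {x - z, y - z}"
  proof (rule independent_if_scalars_zero)
    fix f v assume *: "(\<Sum>v\<in>{x - z, y - z}. f v *\<^sub>R v) = 0" "v \<in> {x - z, y - z}"
    have "f (x - z) *\<^sub>R (x - z) + f (y - z) *\<^sub>R (y - z) = 0"
      using *(1) ne by simp
    from det2_independent[OF assms this] show "f v = 0" using *(2) by auto
  qed simp
  then show "\<not> affine_dependent {z, x, y}"
    using affine_dependent_iff_dependent[of z "{x, y}"] ne by simp
qed

lemma compact_triangle: "compact (convex hull {z, x, y :: point})"
  by (simp add: finite_imp_compact_convex_hull)

lemma simplex2_iff:
  "2 simplex (convex hull {z, x, y}) \<longleftrightarrow> det2 (x - z) (y - z) \<noteq> 0" for x y z :: point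
proof
  assume s: "2 simplex (convex hull {z, x, y})"
  then have "aff_dim (convex hull {z, x, y}) = 2" by (rule aff_dim_simplex)
  then have "interior (convex hull {z, x, y}) \<noteq> {}"
    using interior_rel_interior[of "convex hull {z, x, y}"] rel_interior_eq_empty[of "convex hull {z, x, y}"]
    by (simp add: convex_convex_hull)
  then have "\<not> negligible (convex hull {z, x, y})"
    by (simp add: negligible_convex_interior convex_convex_hull)
  then have "measure lebesgue (convex hull {z, x, y}) \<noteq> 0"
    using negligible_iff_measure[of "convex hull {z, x, y}"] lmeasurable_compact[OF compact_triangle] by blast
  then show "det2 (x - z) (y - z) \<noteq> 0" unfolding measure_triangle by auto
next
  assume d: "det2 (x - z) (y - z) \<noteq> 0"
  from det2_nonzero_imp_affine_independent[OF this]
  show "2 simplex (convex hull {z, x, y})"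
    unfolding simplex_def by (intro exI[of _ "{z, x, y}"]) auto
qed

lemma simplex2_obtain:
  assumes "2 simplex K"
  obtains z x y :: point where "K = convex hull {z, x, y}" "det2 (x - z) (y - z) \<noteq> 0"
proof -
  obtain C where "card C = 3" "K = convex hull C"
    using assms by (auto simp: simplex_def)
  then obtain z x y where "K = convex hull {z, x, y}" by (metis card_3_iff)
  then show ?thesis using that simplex2_iff assms by blast
qed

lemma extreme_point_of_triangle_iff:
  assumes "det2 (x - z) (y - z) \<noteq> 0"
  shows "v extreme_point_of (convex hull {z, x, y}) \<longleftrightarrow> v \<in> {z, x, y}"
  using extreme_point_of_convex_hull_affine_independent[OF det2_nonzero_imp_affine_independent(1)[OF assms]] .

lemma edge_of_triangle_iff:
  assumes d: "det2 (x - z) (y - z) \<noteq> 0"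
  shows "closed_segment a b edge_of (convex hull {z, x, y}) \<longleftrightarrow> a \<in> {z, x, y} \<and> b \<in> {z, x, y} \<and> a \<noteq> b"
proof
  assume e: "closed_segment a b edge_of (convex hull {z, x, y})"
  then obtain c where c: "c \<subseteq> {z, x, y}" "closed_segment a b = convex hull c"
    unfolding edge_of_def face_of_convex_hull_affine_independent[OF det2_nonzero_imp_affine_independent(1)[OF d]]
    by auto
  have "a extreme_point_of convex hull c" "b extreme_point_of convex hull c"
    unfolding c(2)[symmetric] extreme_point_of_segment by auto
  then have "a \<in> {z, x, y}" "b \<in> {z, x, y}" using c extreme_point_of_convex_hull by blast+
  moreover have "a \<noteq> b" using e by (auto simp: edge_of_def)
  ultimately show "a \<in> {z, x, y} \<and> b \<in> {z, x, y} \<and> a \<noteq> b" by blast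
next
  assume *: "a \<in> {z, x, y} \<and> b \<in> {z, x, y} \<and> a \<noteq> b"
  then have "closed_segment a b face_of convex hull {z, x, y}"
    unfolding segment_convex_hull face_of_convex_hull_affine_independent[OF det2_nonzero_imp_affine_independent(1)[OF d]]
    by (intro exI[of _ "{a, b}"]) auto
  moreover have "aff_dim (closed_segment a b) = 1"
    using * by (simp add: segment_convex_hull aff_dim_convex_hull aff_dim_2)
  ultimately show "closed_segment a b edge_of (convex hull {z, x, y})" by (simp add: edge_of_def)
qed

lemma triangle_vertices_unique:
  assumes "convex hull {z, x, y} = convex hull {z, x', y'}" "det2 (x - z) (y - z) \<noteq> 0"
  shows "(x' = x \<and> y' = y) \<or> (x' = y \<and> y' = x)"
proof -
  have d': "det2 (x' - z) (y' - z) \<noteq> 0" using assms simplex2_iff by metis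
  have eq: "v \<in> {z, x, y} \<longleftrightarrow> v \<in> {z, x', y'}" for v
    unfolding extreme_point_of_triangle_iff[OF assms(2), symmetric]
      extreme_point_of_triangle_iff[OF d', symmetric] assms(1) by (rule refl)
  from eq[of x'] eq[of y'] have "x' \<in> {z, x, y}" "y' \<in> {z, x, y}" by simp_all
  then show ?thesis
    using det2_nonzero_imp_affine_independent(2-4)[OF d'] by (elim insertE emptyE) auto
qed

text \<open>The children of a triangle have half its area, and by the parallelogram law the sum of
  the squared lengths of the two sides at the newest vertex halves too. The quotient of the two
  quantities, a measure of the aspect ratio, is therefore constant under newest vertex bisection.\<close>

lemma bisection_det2:
  fixes x y z :: point
  shows "det2 (z - midpoint x y) (x - midpoint x y) = det2 (x - z) (y - z) / 2"
    and "det2 (z - midpoint x y) (y - midpoint x y) = - det2 (x - z) (y - z) / 2"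
  by (auto simp: det2_def midpoint_def field_simps)

lemma bisection_sides:
  fixes x y z :: "'a::real_inner"
  shows "(norm (z - midpoint x y))\<^sup>2 + (norm (x - midpoint x y))\<^sup>2 = ((norm (x - z))\<^sup>2 + (norm (y - z))\<^sup>2) / 2"
proof -
  have z: "z - midpoint x y = (-1/2) *\<^sub>R ((x - z) + (y - z))"
    and x: "x - midpoint x y = (1/2) *\<^sub>R ((x - z) - (y - z))"
    by (auto simp: midpoint_def algebra_simps simp flip: scaleR_2)
  show ?thesis unfolding z x
    by (simp add: power_mult_distrib power2_norm_eq_inner inner_add_left inner_add_right
        inner_diff_left inner_diff_right inner_commute field_simps)
qed

lemma bisection_union:
  fixes x y z :: point
  shows "convex hull {z, x, y} = convex hull {midpoint x y, z, x} \<union> convex hull {midpoint x y, z, y}"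
proof (intro equalityI subsetI)
  fix p assume "p \<in> convex hull {z, x, y}"
  then obtain u v w where *: "0 \<le> u" "0 \<le> v" "0 \<le> w" "u + v + w = 1" "p = u *\<^sub>R z + v *\<^sub>R x + w *\<^sub>R y"
    by (auto simp: convex_hull_3)
  show "p \<in> convex hull {midpoint x y, z, x} \<union> convex hull {midpoint x y, z, y}"
  proof (cases "w \<le> v")
    case True
    have "p = (2 * w) *\<^sub>R midpoint x y + u *\<^sub>R z + (v - w) *\<^sub>R x"
      using * by (simp add: midpoint_def algebra_simps)
    then have "p \<in> convex hull {midpoint x y, z, x}" unfolding convex_hull_3
      using * True by (intro CollectI exI[of _ "2 * w"] exI[of _ u] exI[of _ "v - w"]) auto
    then show ?thesis by blast
  next
    case False
    have "p = (2 * v) *\<^sub>R midpoint x y + u *\<^sub>R z + (w - v) *\<^sub>R y"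
      using * by (simp add: midpoint_def algebra_simps)
    then have "p \<in> convex hull {midpoint x y, z, y}" unfolding convex_hull_3
      using * False by (intro CollectI exI[of _ "2 * v"] exI[of _ u] exI[of _ "w - v"]) auto
    then show ?thesis by blast
  qed
next
  fix p assume p: "p \<in> convex hull {midpoint x y, z, x} \<union> convex hull {midpoint x y, z, y}"
  have "midpoint x y \<in> convex hull {x, y}"
    by (metis midpoint_in_closed_segment segment_convex_hull)
  then have "midpoint x y \<in> convex hull {z, x, y}" using hull_mono[of "{x, y}" "{z, x, y}"] by auto
  then have "{midpoint x y, z, x} \<subseteq> convex hull {z, x, y}" "{midpoint x y, z, y} \<subseteq> convex hull {z, x, y}"
    by (auto intro: hull_inc)
  then have "convex hull {midpoint x y, z, x} \<subseteq> convex hull {z, x, y}"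
    "convex hull {midpoint x y, z, y} \<subseteq> convex hull {z, x, y}"
    by (simp_all add: hull_minimal)
  with p show "p \<in> convex hull {z, x, y}" by blast
qed

lemma bisection_negligible_Int:
  fixes x y z :: point
  shows "negligible (convex hull {midpoint x y, z, x} \<inter> convex hull {midpoint x y, z, y})"
proof -
  let ?A = "convex hull {midpoint x y, z, x}" and ?B = "convex hull {midpoint x y, z, y}"
  have l: "?A \<in> lmeasurable" "?B \<in> lmeasurable" by (auto intro: lmeasurable_compact compact_triangle)
  then have "measure lebesgue (?A \<union> ?B) = measure lebesgue ?A + measure lebesgue ?B - measure lebesgue (?A \<inter> ?B)"
    by (rule measure_Un3)
  then have "measure lebesgue (?A \<inter> ?B) = 0"
    unfolding bisection_union[symmetric] measure_triangle bisection_det2 by simp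
  then show ?thesis using l by (simp add: negligible_iff_measure fmeasurable.Int)
qed

text \<open>The two sides that meet at the newest vertex, squared and added, are at most \<open>s\<close> times the area.
  This bounds the diameter too, since the third side is no longer than the sum of the other two.\<close>

definition regular :: "real \<Rightarrow> point set \<times> point \<Rightarrow> bool" where
  "regular s Kz \<longleftrightarrow> (\<exists>x y. fst Kz = convex hull {snd Kz, x, y} \<and> det2 (x - snd Kz) (y - snd Kz) \<noteq> 0 \<and>
     (norm (x - snd Kz))\<^sup>2 + (norm (y - snd Kz))\<^sup>2 \<le> s * measure lebesgue (fst Kz))"

lemma bisect_regular:
  assumes "bisect M M'" "\<forall>Kz\<in>M. regular s Kz"
  shows "\<forall>Kz\<in>M'. regular s Kz"
  using assms(1)
proof cases
  case (1 K z x y m)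
  have d: "det2 (x - z) (y - z) \<noteq> 0" using 1 simplex2_iff by blast
  have "regular s (K, z)" using assms 1 by blast
  then obtain x' y' where *: "K = convex hull {z, x', y'}" "(norm (x' - z))\<^sup>2 + (norm (y' - z))\<^sup>2 \<le> s * measure lebesgue K"
    by (auto simp: regular_def)
  have "(x' = x \<and> y' = y) \<or> (x' = y \<and> y' = x)"
    by (rule triangle_vertices_unique[OF _ d]) (use * 1 in simp)
  then have r: "(norm (x - z))\<^sup>2 + (norm (y - z))\<^sup>2 \<le> s * measure lebesgue (convex hull {z, x, y})"
    using * 1 by auto
  have m: "m = midpoint x y" and M': "M' = M - {(K, z)} \<union> {(convex hull {m, z, x}, m), (convex hull {m, z, y}, m)}"
    using 1 by (simp_all add: insert_commute)
  have "regular s (convex hull {m, z, x}, m)"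
    unfolding regular_def fst_conv snd_conv unfolding m
  proof (rule exI[of _ z], rule exI[of _ x], intro conjI)
    show "(norm (z - midpoint x y))\<^sup>2 + (norm (x - midpoint x y))\<^sup>2
        \<le> s * measure lebesgue (convex hull {midpoint x y, z, x})"
      using r unfolding bisection_sides measure_triangle bisection_det2 by simp
    show "det2 (z - midpoint x y) (x - midpoint x y) \<noteq> 0" using d by (simp add: bisection_det2)
  qed (rule refl)
  moreover have "regular s (convex hull {m, z, y}, m)"
    unfolding regular_def fst_conv snd_conv unfolding m
  proof (rule exI[of _ z], rule exI[of _ y], intro conjI)
    show "(norm (z - midpoint x y))\<^sup>2 + (norm (y - midpoint x y))\<^sup>2
        \<le> s * measure lebesgue (convex hull {midpoint x y, z, y})"
      using r bisection_sides[of z y x] unfolding measure_triangle bisection_det2 by (simp add: midpoint_sym[of y x])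
    show "det2 (z - midpoint x y) (y - midpoint x y) \<noteq> 0" using d by (simp add: bisection_det2)
  qed (rule refl)
  ultimately show ?thesis using assms(2) unfolding M' by blast
qed

lemma bisect_rtranclp_regular:
  assumes "bisect\<^sup>*\<^sup>* M M'" "\<forall>Kz\<in>M. regular s Kz"
  shows "\<forall>Kz\<in>M'. regular s Kz"
  using assms by (induction rule: rtranclp_induct) (auto dest: bisect_regular)

text \<open>Each of the two sides is at most the diameter; hence the factor 2.\<close>

lemma initial_regular:
  assumes M: "marked_triangulation \<Omega> M" and s: "shape_regular \<sigma> (elements M)" and Kz: "Kz \<in> M"
  shows "regular (2 * \<sigma>\<^sup>2) Kz"
proof -
  obtain K z where Kz': "Kz = (K, z)" by (cases Kz)
  have K: "K \<in> elements M" using Kz Kz' by (force simp: elements_def)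
  have z: "z extreme_point_of K" using M Kz Kz' by (auto simp: marked_triangulation_def)
  have "2 simplex K" using M K by (auto simp: marked_triangulation_def conforming_triangulation_def)
  then obtain a b c where abc: "K = convex hull {a, b, c}" "det2 (b - a) (c - a) \<noteq> 0"
    by (rule simplex2_obtain)
  have "z \<in> {a, b, c}" using z abc extreme_point_of_triangle_iff[OF abc(2)] by simp
  then obtain x y where "{a, b, c} = {z, x, y}" by auto
  then have xy: "K = convex hull {z, x, y}" using abc by simp
  then have d: "det2 (x - z) (y - z) \<noteq> 0" using \<open>2 simplex K\<close> simplex2_iff by blast
  have "bounded K" using xy compact_triangle compact_imp_bounded by blast
  then have "dist x z \<le> diameter K" "dist y z \<le> diameter K"
    by (auto intro!: diameter_bounded_bound simp: xy hull_inc)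
  moreover have h: "diameter K \<le> \<sigma> * mesh_size K" using s K by (auto simp: shape_regular_def)
  ultimately have "norm (x - z) \<le> \<sigma> * mesh_size K" "norm (y - z) \<le> \<sigma> * mesh_size K"
    by (auto simp: dist_norm)
  then have "(norm (x - z))\<^sup>2 \<le> (\<sigma> * mesh_size K)\<^sup>2" "(norm (y - z))\<^sup>2 \<le> (\<sigma> * mesh_size K)\<^sup>2"
    by (auto intro: power_mono)
  moreover have "(\<sigma> * mesh_size K)\<^sup>2 = \<sigma>\<^sup>2 * measure lebesgue K"
    by (simp add: power_mult_distrib mesh_size_def)
  ultimately show ?thesis using xy d Kz' unfolding regular_def by (intro exI[of _ x] exI[of _ y]) auto
qed

lemma bisect_Union:
  assumes "bisect M M'" "(K, z) \<in> M" "(K, z) \<notin> M'"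
  shows "\<exists>x y. K = convex hull {z, x, y} \<and> det2 (x - z) (y - z) \<noteq> 0 \<and>
    (convex hull {midpoint x y, z, x}, midpoint x y) \<in> M' \<and> (convex hull {midpoint x y, z, y}, midpoint x y) \<in> M'"
  using assms(1)
proof cases
  case (1 K' z' x y m)
  then have Kz: "K = K'" "z = z'" using assms(2,3) by blast+
  have d: "det2 (x - z') (y - z') \<noteq> 0" using 1 simplex2_iff by blast
  have "{z', x, m} = {midpoint x y, z', x}" "{z', y, m} = {midpoint x y, z', y}"
    unfolding \<open>m = midpoint x y\<close> by auto
  then have "(convex hull {midpoint x y, z', x}, midpoint x y) \<in> M'"
    "(convex hull {midpoint x y, z', y}, midpoint x y) \<in> M'"
    unfolding \<open>M' = _\<close> using \<open>m = midpoint x y\<close> by simp_all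
  then show ?thesis unfolding Kz using d \<open>K' = _\<close> by blast
qed

text \<open>Meshes between two conforming ones may have hanging nodes. Properties of their triangles are
  obtained from the final mesh by means of this decomposition.\<close>

lemma bisect_rtranclp_cover:
  assumes "bisect\<^sup>*\<^sup>* N M" "(K, z) \<in> N"
  shows "K = \<Union> {L \<in> elements M. L \<subseteq> K}"
  using assms
proof (induction arbitrary: K z rule: converse_rtranclp_induct)
  case base
  then show ?case by (force simp: elements_def)
next
  case (step N N')
  show ?case
  proof (cases "(K, z) \<in> N'")
    case True
    then show ?thesis using step by blast
  next
    case False
    from bisect_Union[OF step(1) step(4) False] obtain x y where
      K: "K = convex hull {z, x, y}" and ch: "(convex hull {midpoint x y, z, x}, midpoint x y) \<in> N'"
       "(convex hull {midpoint x y, z, y}, midpoint x y) \<in> N'" by blast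
    have sub: "convex hull {midpoint x y, z, x} \<subseteq> K" "convex hull {midpoint x y, z, y} \<subseteq> K"
      unfolding K bisection_union[of z x y] by auto
    define F where "F T = \<Union> {L \<in> elements M. L \<subseteq> T}" for T
    have F: "F T \<subseteq> F K" if "T \<subseteq> K" for T using that by (auto simp: F_def)
    have "K = F (convex hull {midpoint x y, z, x}) \<union> F (convex hull {midpoint x y, z, y})"
      using step.IH[OF ch(1)] step.IH[OF ch(2)] bisection_union[of z x y] K by (simp add: F_def)
    then have "K \<subseteq> F K" using F[OF sub(1)] F[OF sub(2)] by simp
    moreover have "F K \<subseteq> K" by (auto simp: F_def)
    ultimately show ?thesis by (simp add: F_def)
  qed
qed

section \<open>Edges of a conforming mesh\<close>

definition triangle_mesh :: "point set set \<Rightarrow> bool" where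
  "triangle_mesh T \<longleftrightarrow> triangulation T \<and> (\<forall>K\<in>T. 2 simplex K)"

lemma triangle_mesh_face: "triangle_mesh T \<Longrightarrow> K \<in> T \<Longrightarrow> L \<in> T \<Longrightarrow> K \<inter> L face_of K"
  by (auto simp: triangle_mesh_def triangulation_def)

lemma triangle_mesh_finite: "triangle_mesh T \<Longrightarrow> finite T"
  by (auto simp: triangle_mesh_def triangulation_def)

lemma simplex2_convex_compact: "2 simplex (K :: point set) \<Longrightarrow> convex K \<and> compact K"
  by (metis compact_triangle convex_convex_hull simplex2_obtain)

lemma simplex2_interior: "2 simplex (K :: point set) \<Longrightarrow> interior K \<noteq> {}"
  using interior_rel_interior[of K] rel_interior_eq_empty[of K] aff_dim_simplex[of 2 K] simplex2_convex_compact[of K]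
  by auto

lemma triangle_mesh_Int_interior:
  assumes T: "triangle_mesh T" and KL: "K \<in> T" "L \<in> T" "K \<noteq> L"
  shows "(K \<inter> L) \<inter> interior K = {}"
proof (rule face_of_disjoint_interior)
  show "K \<inter> L face_of K" using T KL triangle_mesh_face by blast
  show "K \<inter> L \<noteq> K"
  proof
    assume *: "K \<inter> L = K"
    have "L \<inter> K face_of L" using T KL triangle_mesh_face by blast
    then have "(L \<inter> K) \<inter> interior L = {}" by (rule face_of_disjoint_interior) (use * KL in auto)
    then have "interior K = {}" using * interior_subset[of K] interior_mono[of K L] by auto
    then show False using T KL simplex2_interior by (auto simp: triangle_mesh_def)
  qed
qed

lemma triangle_mesh_negligible_Int:
  assumes T: "triangle_mesh T" and KL: "K \<in> T" "L \<in> T" "K \<noteq> L"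
  shows "negligible (K \<inter> L)"
proof -
  have "convex (K \<inter> L)" using T KL simplex2_convex_compact by (auto simp: triangle_mesh_def intro!: convex_Int)
  moreover have "interior (K \<inter> L) = {}"
    using triangle_mesh_Int_interior[OF assms] interior_subset[of "K \<inter> L"] by auto
  ultimately show ?thesis by (simp add: negligible_convex_interior)
qed

text \<open>The intersection \<open>K \<inter> L\<close> is a face of both triangles, and a point of a face is extreme in the
  face if and only if it is extreme in the whole. Consequently a vertex of the mesh never lies in
  the relative interior of an edge.\<close>

lemma triangle_mesh_vertex:
  assumes T: "triangle_mesh T" and "K \<in> T" "L \<in> T" "v extreme_point_of K" "v \<in> L"
  shows "v extreme_point_of L"
proof -
  have "v \<in> K" using assms by (simp add: extreme_point_of_def)
  then have "v extreme_point_of (K \<inter> L)"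
    using extreme_point_of_face[OF triangle_mesh_face[OF T assms(2,3)], of v] assms by blast
  then show ?thesis
    using extreme_point_of_face[OF triangle_mesh_face[OF T assms(3,2)], of v] by (simp add: Int_commute)
qed

definition mesh_edge :: "point set set \<Rightarrow> point \<Rightarrow> point \<Rightarrow> bool" where
  "mesh_edge T c d \<longleftrightarrow> (\<exists>L\<in>T. closed_segment c d edge_of L)"

lemma mesh_edge_commute: "mesh_edge T c d \<longleftrightarrow> mesh_edge T d c"
  by (simp add: mesh_edge_def closed_segment_commute)

lemma edge_endpoints:
  assumes "closed_segment c d edge_of L"
  shows "c extreme_point_of L" "d extreme_point_of L" "c \<noteq> d"
proof -
  have f: "closed_segment c d face_of L" using assms by (simp add: edge_of_def)
  show "c extreme_point_of L" "d extreme_point_of L"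
    using extreme_point_of_face[OF f, of c] extreme_point_of_face[OF f, of d] by (simp_all add: extreme_point_of_segment)
  show "c \<noteq> d" using assms by (auto simp: edge_of_def)
qed

lemma mesh_edge_vertex:
  assumes T: "triangle_mesh T" and e: "mesh_edge T c d" and L: "L \<in> T" "p extreme_point_of L" and p: "p \<in> closed_segment c d"
  shows "p = c \<or> p = d"
proof -
  obtain K where K: "K \<in> T" "closed_segment c d edge_of K" using e by (auto simp: mesh_edge_def)
  then have f: "closed_segment c d face_of K" by (simp add: edge_of_def)
  have "p \<in> K" using p f face_of_imp_subset by blast
  then have "p extreme_point_of K" using triangle_mesh_vertex[OF T L(1) K(1) L(2)] by blast
  then show ?thesis using extreme_point_of_face[OF f, of p] p by (simp add: extreme_point_of_segment)
qed

lemma mesh_edge_subset: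
  assumes T: "triangle_mesh T" and ab: "mesh_edge T a b" and cd: "mesh_edge T c d"
    and sub: "closed_segment c d \<subseteq> closed_segment a b"
  shows "(c = a \<and> d = b) \<or> (c = b \<and> d = a)"
proof -
  obtain L where L: "L \<in> T" "closed_segment c d edge_of L" using cd by (auto simp: mesh_edge_def)
  note e = edge_endpoints[OF L(2)]
  have "c = a \<or> c = b" "d = a \<or> d = b"
    using mesh_edge_vertex[OF T ab L(1) e(1)] mesh_edge_vertex[OF T ab L(1) e(2)] sub by auto
  then show ?thesis using e(3) by blast
qed

lemma finite_mesh_edges:
  assumes T: "triangle_mesh T"
  shows "finite {(c, d). mesh_edge T c d \<and> P c d}"
proof (rule finite_subset)
  let ?V = "\<Union>L\<in>T. {v. v extreme_point_of L}"
  show "{(c, d). mesh_edge T c d \<and> P c d} \<subseteq> ?V \<times> ?V"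
    using edge_endpoints by (fastforce simp: mesh_edge_def)
  have "finite {v. v extreme_point_of L}" if "L \<in> T" for L
  proof -
    have "2 simplex L" using T that by (simp add: triangle_mesh_def)
    then obtain z x y where "L = convex hull {z, x, y}" "det2 (x - z) (y - z) \<noteq> 0"
      by (rule simplex2_obtain)
    then show ?thesis using extreme_point_of_triangle_iff[of x z y] by simp
  qed
  then show "finite (?V \<times> ?V)" using triangle_mesh_finite[OF T] by auto
qed

text \<open>Given the mean values \<open>m c d\<close> of a function on the edges of a mesh, \<open>edge_mean T m a b\<close> is
  its mean value on a segment that is a union of edges. It refers to the segment only and not to
  a triangle of a coarser mesh that the segment bounds, so it takes the same value from both
  sides of a coarse edge. The factor 2 makes up for counting every edge in both orientations.\<close>

definition edge_mean :: "point set set \<Rightarrow> (point \<Rightarrow> point \<Rightarrow> point) \<Rightarrow> point \<Rightarrow> point \<Rightarrow> point" where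
  "edge_mean T m a b = (1 / (2 * dist a b)) *\<^sub>R
     (\<Sum>(c, d)\<in>{(c, d). mesh_edge T c d \<and> closed_segment c d \<subseteq> closed_segment a b}. dist c d *\<^sub>R m c d)"

lemma edge_mean_commute: "edge_mean T m a b = edge_mean T m b a"
  by (simp add: edge_mean_def closed_segment_commute dist_commute)

lemma edge_mean_eq_0:
  assumes "\<And>c d. mesh_edge T c d \<Longrightarrow> closed_segment c d \<subseteq> closed_segment a b \<Longrightarrow> m c d = 0"
  shows "edge_mean T m a b = 0"
  unfolding edge_mean_def using assms by (simp add: sum.neutral case_prod_beta)

lemma edge_mean_mesh_edge:
  assumes T: "triangle_mesh T" and e: "mesh_edge T a b" and m: "m a b = m b a"
  shows "edge_mean T m a b = m a b"
proof -
  have ne: "a \<noteq> b" using e edge_endpoints(3) unfolding mesh_edge_def by blast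
  have "{(c, d). mesh_edge T c d \<and> closed_segment c d \<subseteq> closed_segment a b} = {(a, b), (b, a)}"
  proof -
    have ba: "closed_segment b a = closed_segment a b" by (rule closed_segment_commute)
    have e': "mesh_edge T b a" using e mesh_edge_commute by blast
    show ?thesis by (auto dest: mesh_edge_subset[OF T e] simp: e e' ba)
  qed
  then show ?thesis using ne m
    by (simp add: edge_mean_def dist_commute[of b a] flip: scaleR_add_left)
qed

text \<open>Additivity of the integral over the two halves of \<open>[a, b]\<close>. It requires that no edge straddles
  the midpoint: such an edge is connected, hence contains the midpoint, but the midpoint is a
  vertex of the mesh.\<close>

lemma edge_mean_midpoint:
  assumes T: "triangle_mesh T" and p: "L \<in> T" "midpoint a b extreme_point_of L" and ne: "a \<noteq> b"
  shows "edge_mean T m a b = (1 / 2) *\<^sub>R (edge_mean T m a (midpoint a b) + edge_mean T m (midpoint a b) b)"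
proof -
  define p where "p = midpoint a b"
  define E where "E = (\<lambda>a b. {(c, d). mesh_edge T c d \<and> closed_segment c d \<subseteq> closed_segment a b})"
  have pab: "p \<in> closed_segment a b" by (simp add: p_def)
  have un: "closed_segment a p \<union> closed_segment p b = closed_segment a b"
    and int: "closed_segment a p \<inter> closed_segment p b = {p}"
    using pab Un_closed_segment Int_closed_segment by blast+
  have sub: "E a b = E a p \<union> E p b"
  proof (intro equalityI subsetI)
    fix cd assume "cd \<in> E a b"
    then obtain c d where cd: "cd = (c, d)" "mesh_edge T c d" "closed_segment c d \<subseteq> closed_segment a b"
      by (auto simp: E_def)
    have pcd: "p \<in> closed_segment c d \<Longrightarrow> p = c \<or> p = d"
      using mesh_edge_vertex[OF T cd(2) assms(2,3)] by (simp add: p_def)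
    have "closed_segment c d \<subseteq> closed_segment a p \<or> closed_segment c d \<subseteq> closed_segment p b"
    proof (rule ccontr)
      assume neg: "\<not> ?thesis"
      have c: "c \<in> closed_segment a p \<or> c \<in> closed_segment p b" and d: "d \<in> closed_segment a p \<or> d \<in> closed_segment p b"
        using cd(3) un by auto
      have "p \<in> closed_segment c d"
      proof (rule ccontr)
        assume np: "p \<notin> closed_segment c d"
        have "connected (closed_segment c d)" by simp
        moreover have "closed_segment c d \<subseteq> closed_segment a p \<union> closed_segment p b" using cd un by simp
        moreover have "closed_segment a p \<inter> closed_segment p b \<inter> closed_segment c d = {}" using int np by auto
        ultimately have "closed_segment a p \<inter> closed_segment c d = {} \<or> closed_segment p b \<inter> closed_segment c d = {}"
          by (intro connected_closedD) auto
        then show False using neg cd(3) un by auto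
      qed
      then have "p = c \<or> p = d" by (rule pcd)
      then have "(c \<in> closed_segment a p \<and> d \<in> closed_segment a p) \<or> (c \<in> closed_segment p b \<and> d \<in> closed_segment p b)"
        using c d by auto
      then show False using neg by (simp add: subset_closed_segment)
    qed
    then show "cd \<in> E a p \<union> E p b" using cd by (auto simp: E_def)
  next
    fix cd assume "cd \<in> E a p \<union> E p b"
    then show "cd \<in> E a b" using un by (auto simp: E_def)
  qed
  have disj: "E a p \<inter> E p b = {}"
  proof -
    have False if "(c, d) \<in> E a p \<inter> E p b" for c d
    proof -
      have "closed_segment c d \<subseteq> {p}" using that int by (auto simp: E_def)
      then have "c = p" "d = p" by auto
      moreover have "mesh_edge T c d" using that by (simp add: E_def)
      then have "c \<noteq> d" using edge_endpoints(3) unfolding mesh_edge_def by blast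
      ultimately show False by simp
    qed
    then show ?thesis by fastforce
  qed
  have fin: "finite (E a p)" "finite (E p b)"
    unfolding E_def by (rule finite_mesh_edges[OF T])+
  have d: "dist a p = dist a b / 2" "dist p b = dist a b / 2" unfolding p_def by (rule dist_midpoint)+
  have em: "edge_mean T m u v = (1 / (2 * dist u v)) *\<^sub>R (\<Sum>(c, d)\<in>E u v. dist c d *\<^sub>R m c d)" for u v
    by (simp add: edge_mean_def E_def)
  show ?thesis unfolding p_def[symmetric]
    unfolding em sub sum.union_disjoint[OF fin disj] d using ne by (simp add: algebra_simps)
qed

section \<open>Affine functions with given edge means\<close>

text \<open>The mean of an affine function over an edge is its value at the midpoint.\<close>

definition cr_match :: "(point \<Rightarrow> point \<Rightarrow> point) \<Rightarrow> point set \<Rightarrow> real^2^2 \<Rightarrow> point \<Rightarrow> bool" where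
  "cr_match m K A b \<longleftrightarrow> (\<forall>c d. closed_segment c d edge_of K \<longrightarrow> A *v midpoint c d + b = m c d)"

lemma cr_match_edge_mean:
  assumes T: "triangle_mesh T" and K: "K \<in> T" and m: "\<And>c d. m c d = m d c"
    and A: "cr_match (edge_mean T m) K A b"
  shows "cr_match m K A b"
  unfolding cr_match_def
proof (intro allI impI)
  fix c d assume e: "closed_segment c d edge_of K"
  then have "mesh_edge T c d" using K by (auto simp: mesh_edge_def)
  from edge_mean_mesh_edge[OF T this, of m, OF m] show "A *v midpoint c d + b = m c d"
    using A e by (simp add: cr_match_def)
qed

text \<open>The sides of a triangle are twice the segments that join midpoints of sides. So the gradient maps
  sides to differences of edge means.\<close>

lemma cr_matchD:
  assumes d: "det2 (x - z) (y - z) \<noteq> 0" and m: "cr_match m (convex hull {z, x, y}) A b"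
  shows "A *v midpoint x y + b = m x y" "A *v midpoint z y + b = m z y" "A *v midpoint z x + b = m z x"
    and "A *v (x - z) = 2 *\<^sub>R (m x y - m z y)" "A *v (y - z) = 2 *\<^sub>R (m x y - m z x)"
proof -
  show e: "A *v midpoint x y + b = m x y" "A *v midpoint z y + b = m z y" "A *v midpoint z x + b = m z x"
    using m edge_of_triangle_iff[OF d] det2_nonzero_imp_affine_independent(2-4)[OF d]
    unfolding cr_match_def by auto
  have "x - z = 2 *\<^sub>R (midpoint x y - midpoint z y)" "y - z = 2 *\<^sub>R (midpoint x y - midpoint z x)"
    by (auto simp: midpoint_def algebra_simps)
  then show "A *v (x - z) = 2 *\<^sub>R (m x y - m z y)" "A *v (y - z) = 2 *\<^sub>R (m x y - m z x)"
    by (metis (no_types, lifting) e add_diff_cancel_right matrix_vector_mult_diff_distrib matrix_vector_mult_scaleR)+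
qed

lemma det2_expand:
  assumes "det2 a b \<noteq> 0"
  shows "v = (det2 v b / det2 a b) *\<^sub>R a + (det2 a v / det2 a b) *\<^sub>R b"
proof -
  have "det2 a b *\<^sub>R v = det2 v b *\<^sub>R a + det2 a v *\<^sub>R b"
    by (simp add: vec_eq_iff forall_2 det2_def algebra_simps)
  then have "(1 / det2 a b) *\<^sub>R (det2 a b *\<^sub>R v) = (1 / det2 a b) *\<^sub>R (det2 v b *\<^sub>R a + det2 a v *\<^sub>R b)" by simp
  then show ?thesis using assms by (simp add: scaleR_add_right)
qed

lemma matrix_eq_on_basis:
  fixes A B :: "real^2^2"
  assumes d: "det2 a b \<noteq> 0" and "A *v a = B *v a" "A *v b = B *v b"
  shows "A = B"
proof -
  have "A *v v = B *v v" for v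
    by (subst (1 2) det2_expand[OF d, of v]) (simp add: matrix_vector_right_distrib matrix_vector_mult_scaleR assms)
  then show ?thesis by (simp add: matrix_eq)
qed

lemma cr_match_exists:
  assumes K: "2 simplex K" and m: "\<And>c d. m c d = m d c"
  shows "\<exists>A b. cr_match m K A b"
proof -
  obtain z x y where K: "K = convex hull {z, x, y}" and d: "det2 (x - z) (y - z) \<noteq> 0"
    using K by (rule simplex2_obtain)
  define D where "D = det2 (x - z) (y - z)"
  define p q where "p = 2 *\<^sub>R (m x y - m z y)" and "q = 2 *\<^sub>R (m x y - m z x)"
  define f where "f = (\<lambda>v. (det2 v (y - z) / D) *\<^sub>R p + (det2 (x - z) v / D) *\<^sub>R q)"
  have "linear f" unfolding f_def
    by (intro linearI) (auto simp: det2_def algebra_simps add_divide_distrib diff_divide_distrib)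
  define A where "A = matrix f"
  have A: "A *v v = f v" for v unfolding A_def using \<open>linear f\<close> by (simp add: matrix_works)
  have Ax: "A *v (x - z) = p" unfolding A f_def using d by (simp add: D_def) (simp add: det2_def)
  have Ay: "A *v (y - z) = q" unfolding A f_def using d by (simp add: D_def) (simp add: det2_def)
  define b where "b = m x y - A *v midpoint x y"
  have m1: "midpoint z y = midpoint x y - (1/2) *\<^sub>R (x - z)" and m2: "midpoint z x = midpoint x y - (1/2) *\<^sub>R (y - z)"
    by (auto simp: midpoint_def algebra_simps)
  have lin: "A *v (u - (1/2) *\<^sub>R w) = A *v u - (1/2) *\<^sub>R (A *v w)" for u w
    by (simp add: matrix_vector_mult_diff_distrib matrix_vector_mult_scaleR)
  have e: "A *v midpoint x y + b = m x y" "A *v midpoint z y + b = m z y" "A *v midpoint z x + b = m z x"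
    unfolding m1 m2 lin Ax Ay by (simp_all add: b_def p_def q_def)
  have "cr_match m K A b"
    unfolding cr_match_def K edge_of_triangle_iff[OF d]
    using e m midpoint_sym by (metis insertE singletonD)
  then show ?thesis by blast
qed

text \<open>As the halves have equal area, this says that the gradient on a triangle is the mean value of
  those on its halves. The mean over the new edge from \<open>z\<close> to the midpoint cancels.\<close>

lemma bisection_gradients:
  fixes A B C :: "real^2^2"
  assumes d: "det2 (x - z) (y - z) \<noteq> 0" and m: "\<And>c d. m c d = m d c"
    and add: "m x y = (1/2) *\<^sub>R (m x (midpoint x y) + m (midpoint x y) y)"
    and A: "cr_match m (convex hull {z, x, y}) A a"
    and B: "cr_match m (convex hull {midpoint x y, z, x}) B b"
    and C: "cr_match m (convex hull {midpoint x y, z, y}) C c"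
  shows "B + C = 2 *\<^sub>R A"
proof -
  let ?p = "midpoint x y"
  have dB: "det2 (z - ?p) (x - ?p) \<noteq> 0" and dC: "det2 (z - ?p) (y - ?p) \<noteq> 0"
    using d by (auto simp: bisection_det2)
  note eA = cr_matchD(4,5)[OF d A] and eB = cr_matchD(4,5)[OF dB B] and eC = cr_matchD(4,5)[OF dC C]
  have y: "y - ?p = - (x - ?p)" by (simp add: midpoint_def vec_eq_iff field_simps)
  show ?thesis
  proof (rule matrix_eq_on_basis[OF dB])
    have "2 *\<^sub>R (z - ?p) = - (x - z) - (y - z)"
      by (simp add: midpoint_def algebra_simps scaleR_2)
    then have "(2 *\<^sub>R A) *v (z - ?p) = - (A *v (x - z)) - A *v (y - z)"
      by (metis (no_types, lifting) matrix_vector_mult_diff_distrib matrix_vector_mult_scaleR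
          scaleR_matrix_vector_assoc vec.neg)
    then show "(B + C) *v (z - ?p) = (2 *\<^sub>R A) *v (z - ?p)"
      unfolding matrix_vector_mult_add_rdistrib eA eB eC
      using m[of ?p x] m[of ?p y] add by (simp add: m[of y z] m[of x z] algebra_simps scaleR_2)
    have "2 *\<^sub>R (x - ?p) = (x - z) - (y - z)"
      by (simp add: midpoint_def algebra_simps scaleR_2)
    then have 2: "(2 *\<^sub>R A) *v (x - ?p) = A *v (x - z) - A *v (y - z)"
      by (metis (no_types, lifting) matrix_vector_mult_diff_distrib matrix_vector_mult_scaleR
          scaleR_matrix_vector_assoc)
    have C: "C *v (x - ?p) = - (2 *\<^sub>R (m z y - m ?p z))"
    proof -
      have x: "x - ?p = - (y - ?p)" unfolding y by (rule minus_minus[symmetric])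
      have "C *v (x - ?p) = - (C *v (y - ?p))" unfolding x by (rule vec.neg)
      then show ?thesis unfolding eC .
    qed
    show "(B + C) *v (x - ?p) = (2 *\<^sub>R A) *v (x - ?p)"
      unfolding matrix_vector_mult_add_rdistrib 2 C eA eB
      by (simp add: algebra_simps)
  qed
qed

section \<open>Functions on a mesh\<close>

lemma AE_lebesgue_on_subset:
  assumes "AE x in lebesgue_on S. P x" "T \<subseteq> S" "T \<in> sets lebesgue" "S \<in> sets lebesgue"
  shows "AE x in lebesgue_on T. P x"
proof -
  have "negligible {x \<in> S. \<not> P x}" using assms by (simp add: AE_lebesgue_on_iff_negligible)
  then have "negligible {x \<in> T. \<not> P x}" by (rule negligible_subset) (use assms(2) in auto)
  then show ?thesis using assms by (simp add: AE_lebesgue_on_iff_negligible)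
qed

lemma AE_lebesgue_on_superset:
  assumes "S \<in> sets lebesgue" "T \<in> sets lebesgue" "negligible (T - S)" "AE x in lebesgue_on S. P x"
  shows "AE x in lebesgue_on T. P x"
proof -
  have "negligible ({x \<in> S. \<not> P x} \<union> (T - S))"
    using assms by (intro negligible_Un) (auto simp: AE_lebesgue_on_iff_negligible)
  then have "negligible {x \<in> T. \<not> P x}" by (rule negligible_subset) auto
  then show ?thesis using assms by (simp add: AE_lebesgue_on_iff_negligible)
qed

lemma L2_indicator:
  assumes m: "S \<in> sets lebesgue" "T \<in> sets lebesgue" and f: "f \<in> L2 T" and sub: "T \<subseteq> S"
  shows "(\<lambda>x. indicator T x *\<^sub>R f x) \<in> L2 S"
proof -
  let ?g = "\<lambda>x. if x \<in> T then f x else 0"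
  have g: "(\<lambda>x. indicator T x *\<^sub>R f x) = ?g" by (auto simp: fun_eq_iff indicator_def)
  have gm: "?g \<in> borel_measurable lebesgue"
    using f m by (simp add: L2_def borel_measurable_if)
  have "integrable (lebesgue_on T) (\<lambda>x. (norm (f x))\<^sup>2)" using f by (simp add: L2_def)
  then have "integrable lebesgue (\<lambda>x. indicator T x *\<^sub>R (norm (f x))\<^sup>2)"
    using m by (simp add: integrable_restrict_space)
  moreover have "(\<lambda>x. indicator T x *\<^sub>R (norm (f x))\<^sup>2) = (\<lambda>x. indicator S x *\<^sub>R (norm (?g x))\<^sup>2)"
    using sub by (auto simp: fun_eq_iff indicator_def)
  ultimately have "integrable (lebesgue_on S) (\<lambda>x. (norm (?g x))\<^sup>2)"
    using m by (simp add: integrable_restrict_space)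
  moreover have "?g \<in> borel_measurable (lebesgue_on S)" using gm by (rule measurable_restrict_space1)
  ultimately show ?thesis unfolding g by (simp add: L2_def)
qed

lemma L2_superset:
  assumes m: "S \<in> sets lebesgue" "T \<in> sets lebesgue" and neg: "negligible (T - S)" and f: "f \<in> L2 S"
    and sub: "S \<subseteq> T"
  shows "f \<in> L2 T"
proof -
  have "(\<lambda>x. indicator S x *\<^sub>R f x) \<in> L2 T" by (rule L2_indicator[OF m(2,1) f sub])
  moreover have "negligible {x \<in> T. indicator S x *\<^sub>R f x \<noteq> f x}"
    by (rule negligible_subset[OF neg]) (auto simp: indicator_def)
  then have "AE x in lebesgue_on T. indicator S x *\<^sub>R f x = f x"
    unfolding AE_lebesgue_on_iff_negligible[OF m(2)] .
  ultimately show ?thesis by (rule L2_AE_cong[OF m(2)])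
qed

lemma conforming_triangle_mesh: "conforming_triangulation \<Omega> T \<Longrightarrow> triangle_mesh T"
  by (simp add: conforming_triangulation_def triangle_mesh_def)

lemma simplex2_sets:
  assumes "2 simplex (K :: point set)"
  shows "K \<in> sets lebesgue" "interior K \<in> sets lebesgue" "bounded K" "negligible (K - interior K)"
proof -
  have K: "convex K" "compact K" using simplex2_convex_compact[OF assms] by auto
  show "K \<in> sets lebesgue" using K by (simp add: borel_compact sets_completionI_sets)
  show "interior K \<in> sets lebesgue" by auto
  show "bounded K" using K compact_imp_bounded by blast
  have "K - interior K \<subseteq> frontier K" using K by (simp add: frontier_def compact_imp_closed)
  then show "negligible (K - interior K)" using K negligible_convex_frontier negligible_subset by blast
qed

lemma polygonal_domain_sets:
  assumes "polygonal_domain \<Omega>"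
  shows "open \<Omega>" "bounded \<Omega>" "\<Omega> \<in> sets lebesgue" "closure \<Omega> \<in> sets lebesgue"
  using assms by (auto simp: polygonal_domain_def)

lemma mesh_element:
  assumes \<Omega>: "polygonal_domain \<Omega>" and T: "conforming_triangulation \<Omega> T" and K: "K \<in> T"
  shows "2 simplex K" "K \<subseteq> closure \<Omega>" "interior K \<subseteq> \<Omega>"
proof -
  show "2 simplex K" using T K by (auto simp: conforming_triangulation_def)
  show *: "K \<subseteq> closure \<Omega>" using T K by (auto simp: conforming_triangulation_def)
  show "interior K \<subseteq> \<Omega>" using interior_mono[OF *] \<Omega> by (simp add: polygonal_domain_def)
qed

lemma mesh_element_sets:
  assumes "polygonal_domain \<Omega>" "conforming_triangulation \<Omega> T" "K \<in> T"
  shows "K \<in> sets lebesgue" "interior K \<in> sets lebesgue" "bounded K" "negligible (K - interior K)"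
  by (rule simplex2_sets[OF mesh_element(1)[OF assms]])+

lemma mesh_negligible_boundary:
  assumes \<Omega>: "polygonal_domain \<Omega>" and T: "conforming_triangulation \<Omega> T"
  shows "negligible (closure \<Omega> - \<Omega>)"
proof (rule negligible_subset)
  show "negligible (\<Union>K\<in>T. K - interior K)"
    using mesh_element[OF \<Omega> T] simplex2_sets triangle_mesh_finite[OF conforming_triangle_mesh[OF T]]
    by (intro negligible_Union) auto
  show "closure \<Omega> - \<Omega> \<subseteq> (\<Union>K\<in>T. K - interior K)"
  proof
    fix x assume x: "x \<in> closure \<Omega> - \<Omega>"
    then obtain K where "K \<in> T" "x \<in> K" using T unfolding conforming_triangulation_def by blast
    moreover have "x \<notin> interior K" using mesh_element(3)[OF \<Omega> T \<open>K \<in> T\<close>] x by blast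
    ultimately show "x \<in> (\<Union>K\<in>T. K - interior K)" by blast
  qed
qed

lemma L2_closure:
  assumes \<Omega>: "polygonal_domain \<Omega>" and T: "conforming_triangulation \<Omega> T" and f: "f \<in> L2 \<Omega>"
  shows "f \<in> L2 (closure \<Omega>)"
  using L2_superset[OF polygonal_domain_sets(3,4)[OF \<Omega>] mesh_negligible_boundary[OF \<Omega> T] f closure_subset] .

lemma L2_mesh_element:
  assumes \<Omega>: "polygonal_domain \<Omega>" and T: "conforming_triangulation \<Omega> T" and f: "f \<in> L2 \<Omega>" and K: "K \<in> T"
  shows "f \<in> L2 K"
  using L2_subset[OF L2_closure[OF \<Omega> T f] mesh_element(2)[OF \<Omega> T K]]
    mesh_element_sets(1)[OF \<Omega> T K] polygonal_domain_sets(4)[OF \<Omega>] by blast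

lemma AE_mesh:
  assumes \<Omega>: "polygonal_domain \<Omega>" and T: "conforming_triangulation \<Omega> T"
    and P: "\<And>K. K \<in> T \<Longrightarrow> AE x in lebesgue_on K. P x"
  shows "AE x in lebesgue_on \<Omega>. P x"
proof -
  have "negligible {x \<in> K. \<not> P x}" if "K \<in> T" for K
    using P[OF that] mesh_element_sets(1)[OF \<Omega> T that] by (simp add: AE_lebesgue_on_iff_negligible)
  then have "negligible (\<Union>K\<in>T. {x \<in> K. \<not> P x})"
    using triangle_mesh_finite[OF conforming_triangle_mesh[OF T]] by (intro negligible_Union) auto
  moreover have "{x \<in> \<Omega>. \<not> P x} \<subseteq> (\<Union>K\<in>T. {x \<in> K. \<not> P x})"
    using T closure_subset[of \<Omega>] by (auto simp: conforming_triangulation_def)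
  ultimately have "negligible {x \<in> \<Omega>. \<not> P x}" by (rule negligible_subset)
  then show ?thesis unfolding AE_lebesgue_on_iff_negligible[OF polygonal_domain_sets(3)[OF \<Omega>]] .
qed

lemma LINT_mesh:
  fixes F :: "point \<Rightarrow> 'b::euclidean_space"
  assumes \<Omega>: "polygonal_domain \<Omega>" and T: "conforming_triangulation \<Omega> T"
    and F: "integrable (lebesgue_on \<Omega>) F" "\<And>K. K \<in> T \<Longrightarrow> integrable (lebesgue_on K) F"
  shows "(LINT x|lebesgue_on \<Omega>. F x) = (\<Sum>K\<in>T. LINT x|lebesgue_on K. F x)"
proof -
  have "(F has_integral (\<Sum>K\<in>T. LINT x|lebesgue_on K. F x)) (\<Union>T)"
  proof (rule has_integral_Union)
    show "finite T" using triangle_mesh_finite[OF conforming_triangle_mesh[OF T]] .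
    show "(F has_integral (LINT x|lebesgue_on K. F x)) K" if "K \<in> T" for K
      using F(2)[OF that] mesh_element_sets(1)[OF \<Omega> T that]
      by (rule has_integral_integral_lebesgue_on)
    show "pairwise (\<lambda>K L. negligible (K \<inter> L)) T"
      using triangle_mesh_negligible_Int[OF conforming_triangle_mesh[OF T]] by (auto simp: pairwise_def)
  qed
  then have "integral (closure \<Omega>) F = (\<Sum>K\<in>T. LINT x|lebesgue_on K. F x)"
    using T by (auto simp: conforming_triangulation_def)
  moreover have "integral (closure \<Omega>) F = integral \<Omega> F"
    using closure_subset[of \<Omega>] by (intro integral_spike_set)
      (auto intro: negligible_subset[OF mesh_negligible_boundary[OF \<Omega> T]])
  ultimately show ?thesis
    using lebesgue_integral_eq_integral[OF F(1) polygonal_domain_sets(3)[OF \<Omega>]] by simp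
qed

lemma L2_inner_mesh:
  assumes \<Omega>: "polygonal_domain \<Omega>" and T: "conforming_triangulation \<Omega> T"
    and f: "f \<in> L2 \<Omega>" and g: "g \<in> L2 \<Omega>"
  shows "L2_inner \<Omega> f g = (\<Sum>K\<in>T. L2_inner K f g)"
  unfolding L2_inner_def
  by (intro LINT_mesh[OF \<Omega> T] L2_integrable_inner f g L2_mesh_element[OF \<Omega> T])

lemma indicator_sum_interior:
  fixes f :: "point set \<Rightarrow> 'b::real_vector"
  assumes T: "triangle_mesh T" and K: "K \<in> T" and x: "x \<in> interior K"
  shows "(\<Sum>L\<in>T. indicator (interior L) x *\<^sub>R f L) = f K"
proof -
  have "x \<notin> interior L" if "L \<in> T" "L \<noteq> K" for L
    using triangle_mesh_Int_interior[OF T K that(1)] that(2) x interior_subset by blast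
  then have "(\<Sum>L\<in>T. indicator (interior L) x *\<^sub>R f L) = (\<Sum>L\<in>T. if L = K then f K else 0)"
    using x by (intro sum.cong) auto
  then show ?thesis using K triangle_mesh_finite[OF T] by simp
qed

lemma broken_grad_interior:
  assumes T: "triangle_mesh T" and K: "K \<in> T" and x: "x \<in> interior K"
  shows "broken_grad T v x = weak_grad (interior K) v x"
  unfolding broken_grad_def by (rule indicator_sum_interior[OF assms, of "\<lambda>L. weak_grad (interior L) v x"])

lemma broken_grad_AE:
  assumes T: "triangle_mesh T" and K: "K \<in> T" and G: "has_weak_gradient (interior K) v G"
  shows "AE x in lebesgue_on K. broken_grad T v x = G x"
proof -
  have s: "2 simplex K" using T K by (simp add: triangle_mesh_def)
  note m = simplex2_sets[OF s]
  have "AE x in lebesgue_on (interior K). weak_grad (interior K) v x = G x"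
    using m by (intro weak_grad_eq G) (auto intro: bounded_subset interior_subset)
  then have "AE x in lebesgue_on (interior K). broken_grad T v x = G x"
    using broken_grad_interior[OF T K] by (auto simp: AE_restrict_space_iff m(2))
  then show ?thesis by (rule AE_lebesgue_on_superset[OF m(2,1,4)])
qed

lemma has_weak_gradient_P1:
  assumes s: "2 simplex K" and v: "AE x in lebesgue_on K. v x = A *v x + b"
  shows "has_weak_gradient (interior K) v (\<lambda>x. A)"
proof -
  note m = simplex2_sets[OF s]
  have bi: "bounded (interior K)" using m(3) interior_subset bounded_subset by blast
  have "AE x in lebesgue_on (interior K). v x = A *v x + b"
    by (rule AE_lebesgue_on_subset[OF v interior_subset m(2,1)])
  then have "AE x in lebesgue_on (interior K). A *v x + b = v x" by eventually_elim simp
  then show ?thesis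
    by (rule has_weak_gradient_AE_cong[OF m(2) bi has_weak_gradient_affine[OF open_interior bi]])
qed

section \<open>The nonconforming space in terms of edge means\<close>

text \<open>The points of the interior where two affine functions differ form an open set. If it is a null
  set, it is empty.\<close>

lemma affine_AE_unique:
  fixes A A' :: "real^2^2"
  assumes s: "2 simplex K" and ae: "AE x in lebesgue_on K. A *v x + b = A' *v x + b'"
  shows "A = A'" "b = b'"
proof -
  let ?D = "{x \<in> interior K. A *v x + b \<noteq> A' *v x + b'}"
  have "negligible {x \<in> K. A *v x + b \<noteq> A' *v x + b'}"
    using ae simplex2_sets(1)[OF s] by (simp add: AE_lebesgue_on_iff_negligible)
  then have "negligible ?D" by (rule negligible_subset) (use interior_subset in auto)
  moreover have "open ?D"
  proof -
    have "open {x. A *v x + b \<noteq> A' *v x + b'}"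
      by (intro open_Collect_neq continuous_intros matrix_vector_mult_linear_continuous_on)
    moreover have "?D = interior K \<inter> {x. A *v x + b \<noteq> A' *v x + b'}" by auto
    ultimately show ?thesis by (simp only: open_Int open_interior)
  qed
  ultimately have eq: "A *v x + b = A' *v x + b'" if "x \<in> interior K" for x
    using open_not_negligible[of ?D] that by blast
  obtain x where x: "x \<in> interior K" using simplex2_interior[OF s] by blast
  have "A *v v = A' *v v" for v
  proof -
    obtain e where e: "e > 0" "ball x e \<subseteq> interior K" using x open_contains_ball open_interior by blast
    define n where "n = norm v + 1"
    have n: "n > 0" "norm v \<le> n" by (auto simp: n_def add_nonneg_pos)
    define t where "t = e / (2 * n)"
    have t: "t > 0" using e n by (simp add: t_def)
    have "t * norm v \<le> t * n" using t n by simp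
    also have "t * n = e / 2" using n by (simp add: t_def)
    finally have "t * norm v < e" using e by simp
    then have "x + t *\<^sub>R v \<in> interior K" using e t by (intro subsetD[OF e(2)]) (simp add: dist_norm)
    have lin: "B *v (x + t *\<^sub>R v) = B *v x + t *\<^sub>R (B *v v)" for B :: "real^2^2"
      by (simp add: matrix_vector_right_distrib matrix_vector_mult_scaleR)
    have "(A *v x + b) + t *\<^sub>R (A *v v) = (A' *v x + b') + t *\<^sub>R (A' *v v)"
      using eq[OF \<open>x + t *\<^sub>R v \<in> interior K\<close>] unfolding lin by (simp add: algebra_simps)
    then have "t *\<^sub>R (A *v v) = t *\<^sub>R (A' *v v)" unfolding eq[OF x] by simp
    then show ?thesis using t by simp
  qed
  then show "A = A'" by (simp add: matrix_eq)
  with eq[OF x] show "b = b'" by simp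
qed

lemma P1_restrict_eq:
  assumes s: "2 simplex K" and v: "AE x in lebesgue_on K. v x = A *v x + b"
  shows "P1_restrict K v = (\<lambda>x. A *v x + b)"
  unfolding P1_restrict_def
proof (rule the_equality)
  show "P1_rep K v (\<lambda>x. A *v x + b)" unfolding P1_rep_def using v by blast
  fix f assume "P1_rep K v f"
  then obtain A' b' where f: "f = (\<lambda>x. A' *v x + b')" "AE x in lebesgue_on K. v x = A' *v x + b'"
    unfolding P1_rep_def by auto
  have "AE x in lebesgue_on K. A *v x + b = A' *v x + b'"
    using v f(2) by eventually_elim simp
  from affine_AE_unique[OF s this] show "f = (\<lambda>x. A *v x + b)" using f by simp
qed

lemma segment_integral_affine:
  "segment_integral c d (\<lambda>x. A *v x + b) = dist c d *\<^sub>R (A *v midpoint c d + b)" for A :: "real^2^2"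
proof -
  let ?p = "A *v c + b" and ?q = "A *v (d - c)"
  have 1: "A *v ((1 - t) *\<^sub>R c + t *\<^sub>R d) + b = ?p + t *\<^sub>R ?q" for t
  proof -
    have "(1 - t) *\<^sub>R c + t *\<^sub>R d = c + t *\<^sub>R (d - c)" by (simp add: algebra_simps)
    then show ?thesis by (simp add: matrix_vector_right_distrib matrix_vector_mult_scaleR)
  qed
  have 2: "((\<lambda>t. ?p + t *\<^sub>R ?q) has_integral (?p + (1/2) *\<^sub>R ?q)) {0..1}"
    using has_integral_add[OF has_integral_const_real[of ?p 0 1] has_integral_scaleR_left[OF ident_has_integral[of 0 "1::real"], of ?q]]
    by simp
  have 3: "?p + (1/2) *\<^sub>R ?q = A *v midpoint c d + b"
  proof -
    have "midpoint c d = c + (1/2) *\<^sub>R (d - c)" by (simp add: midpoint_def vec_eq_iff field_simps)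
    then show ?thesis by (simp add: matrix_vector_right_distrib matrix_vector_mult_scaleR)
  qed
  show ?thesis unfolding segment_integral_def 1 integral_unique[OF 2] 3 ..
qed

text \<open>A description of the nonconforming space by gradients \<open>A\<close>, constant terms \<open>b\<close> and edge means
  \<open>m\<close>. That a single \<open>m\<close> serves all elements expresses the continuity of the edge means.\<close>

definition nc_family :: "point set \<Rightarrow> point set set \<Rightarrow> (point \<Rightarrow> point) \<Rightarrow> (point set \<Rightarrow> real^2^2) \<Rightarrow>
    (point set \<Rightarrow> point) \<Rightarrow> (point \<Rightarrow> point \<Rightarrow> point) \<Rightarrow> bool" where
  "nc_family \<Omega> T v A b m \<longleftrightarrow> (\<forall>c d. m c d = m d c) \<and>
     (\<forall>K\<in>T. (AE x in lebesgue_on K. v x = A K *v x + b K) \<and> cr_match m K (A K) (b K)) \<and>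
     (\<forall>c d. mesh_edge T c d \<longrightarrow> closed_segment c d \<subseteq> frontier \<Omega> \<longrightarrow> m c d = 0)"

text \<open>The mean on an edge is read off from an arbitrarily chosen triangle at that edge. By the jump
  condition, or the boundary condition, every other choice gives the same value.\<close>

lemma V_nc_imp_family:
  assumes T: "triangle_mesh T" and v: "v \<in> V_nc \<Omega> T"
  obtains A b m where "nc_family \<Omega> T v A b m"
proof -
  have "\<forall>K\<in>T. \<exists>Ab. AE x in lebesgue_on K. v x = fst Ab *v x + snd Ab"
  proof
    fix K assume "K \<in> T"
    then obtain f where "P1_rep K v f" using v by (auto simp: V_nc_def)
    then obtain A b where "f = (\<lambda>x. A *v x + b)" "AE x in lebesgue_on K. v x = f x"
      by (auto simp: P1_rep_def)
    then show "\<exists>Ab. AE x in lebesgue_on K. v x = fst Ab *v x + snd Ab"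
      by (intro exI[of _ "(A, b)"]) simp
  qed
  from bchoice[OF this] obtain Ab where
    Ab: "\<And>K. K \<in> T \<Longrightarrow> AE x in lebesgue_on K. v x = fst (Ab K) *v x + snd (Ab K)" by blast
  define A b where "A = (\<lambda>K. fst (Ab K))" and "b = (\<lambda>K. snd (Ab K))"
  have ae: "AE x in lebesgue_on K. v x = A K *v x + b K" if "K \<in> T" for K
    using Ab[OF that] by (simp add: A_def b_def)
  have s: "2 simplex K" if "K \<in> T" for K using T that by (simp add: triangle_mesh_def)
  have P: "P1_restrict K v = (\<lambda>x. A K *v x + b K)" if "K \<in> T" for K
    by (rule P1_restrict_eq[OF s[OF that] ae[OF that]])
  define Q where "Q = (\<lambda>c d. SOME K. K \<in> T \<and> closed_segment c d edge_of K)"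
  define m where "m = (\<lambda>c d. A (Q c d) *v midpoint c d + b (Q c d))"
  have Q: "Q c d \<in> T" "closed_segment c d edge_of Q c d" if "K \<in> T" "closed_segment c d edge_of K" for K c d
    using someI[of "\<lambda>K. K \<in> T \<and> closed_segment c d edge_of K" K] that by (auto simp: Q_def)
  have bd: "A K *v midpoint c d + b K = 0"
    if "K \<in> T" "closed_segment c d edge_of K" "closed_segment c d \<subseteq> frontier \<Omega>" for K c d
  proof -
    have "segment_integral c d (P1_restrict K v) = 0" using v that by (simp add: V_nc_def)
    then show ?thesis using edge_endpoints(3)[OF that(2)] by (simp add: P[OF that(1)] segment_integral_affine)
  qed
  have match: "A K *v midpoint c d + b K = m c d" if K: "K \<in> T" "closed_segment c d edge_of K" for K c d
  proof (cases "closed_segment c d \<subseteq> frontier \<Omega> \<or> Q c d = K")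
    case True
    then show ?thesis using bd[OF K] bd[OF Q[OF K]] by (auto simp: m_def)
  next
    case False
    then have "segment_integral c d (\<lambda>x. P1_restrict K v x - P1_restrict (Q c d) v x) = 0"
      using v K Q[OF K] unfolding V_nc_def by blast
    moreover have "(\<lambda>x. P1_restrict K v x - P1_restrict (Q c d) v x) = (\<lambda>x. (A K - A (Q c d)) *v x + (b K - b (Q c d)))"
      by (simp add: P[OF K(1)] P[OF Q(1)[OF K]] fun_eq_iff matrix_vector_mult_diff_rdistrib)
    ultimately have "(A K - A (Q c d)) *v midpoint c d + (b K - b (Q c d)) = 0"
      using edge_endpoints(3)[OF K(2)] by (simp add: segment_integral_affine)
    then show ?thesis by (simp add: m_def matrix_vector_mult_diff_rdistrib algebra_simps)
  qed
  have "m c d = m d c" for c d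
  proof -
    have "Q c d = Q d c" unfolding Q_def closed_segment_commute[of c d] by (rule refl)
    then show ?thesis unfolding m_def midpoint_sym[of c d] by simp
  qed
  moreover have "m c d = 0" if "mesh_edge T c d" "closed_segment c d \<subseteq> frontier \<Omega>" for c d
    using that match bd by (metis mesh_edge_def)
  ultimately have "nc_family \<Omega> T v A b m"
    unfolding nc_family_def cr_match_def using ae match by blast
  then show ?thesis by (rule that)
qed

lemma V_nc_if_family:
  assumes T: "triangle_mesh T" and v: "v \<in> L2 \<Omega>" and f: "nc_family \<Omega> T v A b m"
  shows "v \<in> V_nc \<Omega> T"
proof -
  have s: "2 simplex K" if "K \<in> T" for K using T that by (simp add: triangle_mesh_def)
  have ae: "AE x in lebesgue_on K. v x = A K *v x + b K" if "K \<in> T" for K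
    using f that by (simp add: nc_family_def)
  have P: "P1_restrict K v = (\<lambda>x. A K *v x + b K)" if "K \<in> T" for K
    by (rule P1_restrict_eq[OF s[OF that] ae[OF that]])
  have match: "A K *v midpoint c d + b K = m c d" if "K \<in> T" "closed_segment c d edge_of K" for K c d
    using f that by (auto simp: nc_family_def cr_match_def)
  have "\<exists>f. P1_rep K v f" if "K \<in> T" for K
    unfolding P1_rep_def using ae[OF that] by blast
  moreover have "segment_integral c d (\<lambda>x. P1_restrict K v x - P1_restrict L v x) = 0"
    if "K \<in> T" "L \<in> T" "closed_segment c d edge_of K" "closed_segment c d edge_of L" for K L c d
  proof -
    have "(\<lambda>x. P1_restrict K v x - P1_restrict L v x) = (\<lambda>x. (A K - A L) *v x + (b K - b L))"
      by (simp add: P that fun_eq_iff matrix_vector_mult_diff_rdistrib)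
    moreover have "(A K - A L) *v midpoint c d + (b K - b L) = 0"
      using match[OF that(1,3)] match[OF that(2,4)] by (simp add: matrix_vector_mult_diff_rdistrib algebra_simps)
    ultimately show ?thesis by (simp only: segment_integral_affine) simp
  qed
  moreover have "segment_integral c d (P1_restrict K v) = 0"
    if "K \<in> T" "closed_segment c d edge_of K" "closed_segment c d \<subseteq> frontier \<Omega>" for K c d
  proof -
    have "mesh_edge T c d" using that by (auto simp: mesh_edge_def)
    then show ?thesis using match[OF that(1,2)] that f
      by (simp add: P segment_integral_affine nc_family_def)
  qed
  ultimately show ?thesis using v unfolding V_nc_def by blast
qed

lemma nc_family_broken_grad:
  assumes T: "triangle_mesh T" and f: "nc_family \<Omega> T v A b m" and K: "K \<in> T"
  shows "AE x in lebesgue_on K. broken_grad T v x = A K"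
  using f K T by (intro broken_grad_AE[OF T K] has_weak_gradient_P1[where b = "b K"])
    (auto simp: nc_family_def triangle_mesh_def)

section \<open>The local estimate\<close>

lemma norm_matrix_vector_le: "norm (A *v x) \<le> norm A * norm x" for A :: "real^2^2"
proof (rule power2_le_imp_le)
  have "(norm (A *v x))\<^sup>2 = (\<Sum>i\<in>UNIV. (A $ i \<bullet> x)\<^sup>2)"
    unfolding power2_norm_eq_inner inner_vec_def[of "A *v x"]
    by (simp add: matrix_vector_mul_component power2_eq_square)
  also have "\<dots> \<le> (\<Sum>i\<in>UNIV. (A $ i \<bullet> A $ i) * (x \<bullet> x))"
    by (intro sum_mono Cauchy_Schwarz_ineq)
  also have "\<dots> = (norm A * norm x)\<^sup>2"
    by (simp add: power_mult_distrib power2_norm_eq_inner inner_vec_def[of A] sum_distrib_right)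
  finally show "(norm (A *v x))\<^sup>2 \<le> (norm A * norm x)\<^sup>2" .
qed simp

lemma triangle_diameter_le:
  assumes "u \<in> convex hull {z, x, y}" "v \<in> convex hull {z, x, y}"
  shows "(norm (u - v))\<^sup>2 \<le> 2 * ((norm (x - z))\<^sup>2 + (norm (y - z))\<^sup>2)"
proof -
  define a b where "a = x - z" and "b = y - z"
  have K: "convex hull {z, x, y} = (\<lambda>p. z + (p $ 1 *\<^sub>R a + p $ 2 *\<^sub>R b)) ` ref_triangle"
    using triangle_eq_image[of z a b] by (simp add: a_def b_def)
  obtain p where p: "p \<in> ref_triangle" "u = z + (p $ 1 *\<^sub>R a + p $ 2 *\<^sub>R b)" using assms(1) K by auto
  obtain q where q: "q \<in> ref_triangle" "v = z + (q $ 1 *\<^sub>R a + q $ 2 *\<^sub>R b)" using assms(2) K by auto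
  have "u - v = (p $ 1 - q $ 1) *\<^sub>R a + (p $ 2 - q $ 2) *\<^sub>R b"
    unfolding p q by (simp add: algebra_simps)
  then have "norm (u - v) \<le> \<bar>p $ 1 - q $ 1\<bar> * norm a + \<bar>p $ 2 - q $ 2\<bar> * norm b"
    using norm_triangle_ineq[of "(p $ 1 - q $ 1) *\<^sub>R a" "(p $ 2 - q $ 2) *\<^sub>R b"] by simp
  also have "\<dots> \<le> 1 * norm a + 1 * norm b"
    using p q by (intro add_mono mult_right_mono) (auto simp: ref_triangle_def)
  finally have "(norm (u - v))\<^sup>2 \<le> (norm a + norm b)\<^sup>2" by (simp add: power_mono)
  also have "\<dots> \<le> 2 * ((norm a)\<^sup>2 + (norm b)\<^sup>2)"
    using sum_squares_bound[of "norm a" "norm b"] by (simp add: power2_sum)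
  finally show ?thesis by (simp add: a_def b_def)
qed

lemma L2_const: "bounded S \<Longrightarrow> S \<in> sets lebesgue \<Longrightarrow> (\<lambda>x. c) \<in> L2 S"
  by (intro L2_continuous) auto

lemma L2_affine: "bounded S \<Longrightarrow> S \<in> sets lebesgue \<Longrightarrow> (\<lambda>x. A *v x + b) \<in> L2 S" for A :: "real^2^2"
  by (intro L2_continuous continuous_intros matrix_vector_mult_linear_continuous_on)

lemma LINT_lebesgue_on_const:
  fixes c :: "'b::euclidean_space"
  assumes "bounded S" "S \<in> sets lebesgue"
  shows "(LINT x|lebesgue_on S. c) = measure lebesgue S *\<^sub>R c"
  unfolding lebesgue_integral_const using assms by (simp add: measure_restrict_space)

lemma L2_integrable_vec:
  fixes G :: "point \<Rightarrow> real^2^2"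
  assumes "G \<in> L2 S" "bounded S" "S \<in> sets lebesgue"
  shows "integrable (lebesgue_on S) G"
proof -
  have m: "G \<in> borel_measurable (lebesgue_on S)" using assms by (simp add: L2_def)
  have "(\<lambda>x. norm (G x)) \<in> L2 S"
    using assms(1) m by (simp add: L2_def)
  then have "integrable (lebesgue_on S) (\<lambda>x. norm (G x))" by (rule L2_integrable[OF _ assms(2,3)])
  then show ?thesis using m by (simp add: integrable_norm_iff)
qed

text \<open>Jensen's inequality: integrate \<open>|G - B|\<^sup>2 \<ge> 0\<close>.\<close>

lemma mean_value_le:
  fixes G :: "point \<Rightarrow> real^2^2"
  assumes G: "G \<in> L2 K" and K: "bounded K" "K \<in> sets lebesgue"
    and B: "(LINT x|lebesgue_on K. G x) = measure lebesgue K *\<^sub>R B"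
  shows "measure lebesgue K * (norm B)\<^sup>2 \<le> L2_inner K G G"
proof -
  have C: "(\<lambda>x. B) \<in> L2 K" by (rule L2_const[OF K])
  have GB: "L2_inner K G (\<lambda>x. B) = measure lebesgue K * (norm B)\<^sup>2"
    unfolding L2_inner_def using B L2_integrable_vec[OF G K]
    by (simp add: power2_norm_eq_inner)
  have BB: "L2_inner K (\<lambda>x. B) (\<lambda>x. B) = measure lebesgue K * (norm B)\<^sup>2"
    unfolding L2_inner_def LINT_lebesgue_on_const[OF K] by (simp add: power2_norm_eq_inner)
  have "0 \<le> L2_inner K (\<lambda>x. G x - B) (\<lambda>x. G x - B)" by (rule L2_inner_self_nonneg)
  also have "\<dots> = L2_inner K G G - measure lebesgue K * (norm B)\<^sup>2"
    by (simp add: L2_inner_diff_left L2_inner_diff_right L2_diff G C GB BB L2_inner_commute[of K "\<lambda>x. B" G])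
  finally show ?thesis by simp
qed

text \<open>In the recursion along the bisection tree the first term is multiplied by the decay factor 1/2.
  The customary weight 2 would exactly cancel this decay; any smaller one, such as 3/2, leaves a
  convergent geometric series.\<close>

lemma L2_inner_add_self_le:
  assumes f: "f \<in> L2 S" and g: "g \<in> L2 S"
  shows "L2_inner S (\<lambda>x. f x + g x) (\<lambda>x. f x + g x) \<le> 3 / 2 * L2_inner S f f + 3 * L2_inner S g g"
proof -
  have g2: "(\<lambda>x. 2 *\<^sub>R g x) \<in> L2 S" using g by (rule L2_scaleR)
  \<comment> \<open>Expanding this square bounds twice the mixed term by \<open>1/2 (f, f) + 2 (g, g)\<close>.\<close>
  have "0 \<le> L2_inner S (\<lambda>x. f x - 2 *\<^sub>R g x) (\<lambda>x. f x - 2 *\<^sub>R g x)" by (rule L2_inner_self_nonneg)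
  also have "\<dots> = L2_inner S f f - 4 * L2_inner S f g + 4 * L2_inner S g g"
    unfolding L2_inner_diff_left[OF f g2 L2_diff[OF f g2]] L2_inner_diff_right[OF f g2 f] L2_inner_diff_right[OF f g2 g2]
    by (simp add: L2_inner_scaleR_left L2_inner_scaleR_right L2_inner_commute[of S g f])
  finally have "2 * L2_inner S f g \<le> 1 / 2 * L2_inner S f f + 2 * L2_inner S g g" by simp
  moreover have "L2_inner S (\<lambda>x. f x + g x) (\<lambda>x. f x + g x) = L2_inner S f f + 2 * L2_inner S f g + L2_inner S g g"
    unfolding L2_inner_add_left[OF f g L2_add[OF f g]] L2_inner_add_right[OF f g f] L2_inner_add_right[OF f g g]
    by (simp add: L2_inner_commute[of S g f])
  ultimately show ?thesis by simp
qed

lemma L2_inner_self_le_const: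
  assumes f: "f \<in> L2 S" and S: "bounded S" "S \<in> sets lebesgue" and c: "\<And>x. x \<in> S \<Longrightarrow> (norm (f x))\<^sup>2 \<le> c"
  shows "L2_inner S f f \<le> measure lebesgue S * c"
proof -
  have "L2_inner S f f \<le> (LINT x|lebesgue_on S. c)"
    unfolding L2_inner_def
  proof (rule integral_mono)
    show "integrable (lebesgue_on S) (\<lambda>x. f x \<bullet> f x)" by (rule L2_integrable_inner[OF f f])
    show "integrable (lebesgue_on S) (\<lambda>x. c)" by (rule L2_integrable[OF L2_const[OF S] S])
  qed (use c in \<open>auto simp: power2_norm_eq_inner\<close>)
  then show ?thesis unfolding LINT_lebesgue_on_const[OF S] by simp
qed

lemma integrable_lebesgue_on_subset:
  fixes F :: "point \<Rightarrow> 'b::euclidean_space"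
  assumes "integrable (lebesgue_on S) F" "T \<subseteq> S" "T \<in> sets lebesgue" "S \<in> sets lebesgue"
  shows "integrable (lebesgue_on T) F"
proof -
  have "set_integrable lebesgue S F" using assms by (simp add: set_integrable_def integrable_restrict_space)
  then have "set_integrable lebesgue T F" using assms by (meson set_integrable_subset)
  then show ?thesis using assms by (simp add: set_integrable_def integrable_restrict_space)
qed

lemma LINT_bisection:
  fixes F :: "point \<Rightarrow> 'b::euclidean_space"
  assumes F: "integrable (lebesgue_on (convex hull {z, x, y})) F"
  shows "(LINT u|lebesgue_on (convex hull {z, x, y}). F u) =
    (LINT u|lebesgue_on (convex hull {midpoint x y, z, x}). F u) + (LINT u|lebesgue_on (convex hull {midpoint x y, z, y}). F u)"
proof -
  have s: "convex hull {p, q, r} \<in> sets lebesgue" for p q r :: point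
    using compact_triangle by (simp add: borel_compact sets_completionI_sets)
  let ?K1 = "convex hull {midpoint x y, z, x}" and ?K2 = "convex hull {midpoint x y, z, y}"
  have i: "integrable (lebesgue_on ?K1) F" "integrable (lebesgue_on ?K2) F"
    by (rule integrable_lebesgue_on_subset[OF F _ s s], simp add: bisection_union[of z x y])+
  have h: "F integrable_on ?K1" "F integrable_on ?K2"
    using has_integral_integral_lebesgue_on[OF i(1) s] has_integral_integral_lebesgue_on[OF i(2) s]
    by (auto simp: integrable_on_def)
  show ?thesis
    using Henstock_Kurzweil_Integration.integral_Un[OF h bisection_negligible_Int]
    unfolding bisection_union[of z x y, symmetric]
    by (simp add: lebesgue_integral_eq_integral[OF F s] lebesgue_integral_eq_integral[OF i(1) s] lebesgue_integral_eq_integral[OF i(2) s])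
qed

lemma cr_match_unique:
  assumes s: "2 simplex K" and A: "cr_match m K A a" and B: "cr_match m K B b"
  shows "A = B" "a = b"
proof -
  obtain z x y where K: "K = convex hull {z, x, y}" and d: "det2 (x - z) (y - z) \<noteq> 0"
    using s by (rule simplex2_obtain)
  show AB: "A = B"
    using matrix_eq_on_basis[OF d, of A B] cr_matchD(4,5)[OF d A[unfolded K]] cr_matchD(4,5)[OF d B[unfolded K]] by simp
  show "a = b"
    using cr_matchD(1)[OF d A[unfolded K]] cr_matchD(1)[OF d B[unfolded K]] AB by (metis add_left_cancel)
qed

text \<open>If two affine functions agree at a point of a triangle, they differ by at most the diameter
  times the difference of the gradients.\<close>

lemma L2_inner_affine_diff_le:
  fixes A B :: "real^2^2"
  assumes K: "K \<subseteq> convex hull {z, x, y}" "K \<in> sets lebesgue" and p: "p \<in> convex hull {z, x, y}"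
    and eq: "A *v p + a = B *v p + b"
  shows "L2_inner K (\<lambda>u. (A *v u + a) - (B *v u + b)) (\<lambda>u. (A *v u + a) - (B *v u + b)) \<le>
    measure lebesgue K * (2 * ((norm (x - z))\<^sup>2 + (norm (y - z))\<^sup>2) * (norm (A - B))\<^sup>2)"
proof (rule L2_inner_self_le_const)
  show bK: "bounded K" using K(1) compact_imp_bounded[OF compact_triangle] bounded_subset by blast
  then show "(\<lambda>u. (A *v u + a) - (B *v u + b)) \<in> L2 K" using K by (intro L2_diff L2_affine)
  fix u assume u: "u \<in> K"
  have "(A *v u + a) - (B *v u + b) = (A - B) *v (u - p)"
    using eq by (simp add: matrix_vector_mult_diff_distrib matrix_vector_mult_diff_rdistrib algebra_simps)
  then have "norm ((A *v u + a) - (B *v u + b)) \<le> norm (A - B) * norm (u - p)"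
    by (simp only: norm_matrix_vector_le)
  then have "(norm ((A *v u + a) - (B *v u + b)))\<^sup>2 \<le> (norm (A - B))\<^sup>2 * (norm (u - p))\<^sup>2"
    by (metis norm_ge_zero power_mono power_mult_distrib)
  also have "\<dots> \<le> (norm (A - B))\<^sup>2 * (2 * ((norm (x - z))\<^sup>2 + (norm (y - z))\<^sup>2))"
    using u K p by (intro mult_left_mono triangle_diameter_le) auto
  finally show "(norm ((A *v u + a) - (B *v u + b)))\<^sup>2 \<le> 2 * ((norm (x - z))\<^sup>2 + (norm (y - z))\<^sup>2) * (norm (A - B))\<^sup>2"
    by (simp add: mult.commute)
qed (rule K)

text \<open>The induction starts from the final mesh, where \<open>w\<close> is affine, and undoes one bisection at a time.
  Let \<open>q\<close> be the sum of the squared sides at the newest vertex, so that it is \<open>q/2\<close> for both halves.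
  On each half, \<open>w\<close> minus the interpolant \<open>(B, c)\<close> of the parent is the error of the half plus the
  difference of two interpolants. If the claim holds with a constant \<open>\<gamma>\<close> for the halves, the
  first part contributes \<open>3/2 (\<gamma> q/2)\<close> and the second one \<open>3 (2 q)\<close>, in units of the squared norm
  of \<open>W\<close>. The constant 24 solves \<open>3/4 \<gamma> + 6 = \<gamma>\<close>. The gradients of the interpolants are
  controlled because they are the mean values of \<open>W\<close>, which is the other half of the claim.\<close>

lemma nvb_local_estimate:
  fixes w :: "point \<Rightarrow> point" and W :: "point \<Rightarrow> real^2^2"
  assumes T: "triangle_mesh (elements M)" and sym: "\<And>c d. m c d = m d c"
    and leaf: "\<And>K. K \<in> elements M \<Longrightarrow> AE x in lebesgue_on K. w x = A K *v x + b K"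
      "\<And>K. K \<in> elements M \<Longrightarrow> AE x in lebesgue_on K. W x = A K"
      "\<And>K. K \<in> elements M \<Longrightarrow> cr_match m K (A K) (b K)"
    and S: "w \<in> L2 S" "W \<in> L2 S" "S \<in> sets lebesgue" "\<Union>(elements M) \<subseteq> S"
    and N: "bisect\<^sup>*\<^sup>* N M" "(K, z) \<in> N" "K = convex hull {z, x, y}" "det2 (x - z) (y - z) \<noteq> 0"
    and B: "cr_match (edge_mean (elements M) m) K B c"
  shows "(LINT u|lebesgue_on K. W u) = measure lebesgue K *\<^sub>R B \<and>
    L2_inner K (\<lambda>u. w u - (B *v u + c)) (\<lambda>u. w u - (B *v u + c)) \<le>
      24 * ((norm (x - z))\<^sup>2 + (norm (y - z))\<^sup>2) * L2_inner K W W"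
  using N B
proof (induction arbitrary: K z x y B c rule: converse_rtranclp_induct)
  case base
  have K: "K \<in> elements M" using base by (force simp: elements_def)
  have s: "2 simplex K" using T K by (simp add: triangle_mesh_def)
  note ms = simplex2_sets[OF s]
  have KS: "K \<subseteq> S" using K S by blast
  have "cr_match m K B c" by (rule cr_match_edge_mean[OF T K sym base(4)])
  then have AB: "A K = B" "b K = c" using cr_match_unique[OF s leaf(3)[OF K]] by auto
  have wK: "w \<in> L2 K" "W \<in> L2 K" using S KS ms(1) by (auto intro: L2_subset)
  have "(LINT u|lebesgue_on K. W u) = (LINT u|lebesgue_on K. B)"
    using leaf(2)[OF K] wK AB by (intro integral_cong_AE) (auto simp: L2_def)
  then have 1: "(LINT u|lebesgue_on K. W u) = measure lebesgue K *\<^sub>R B"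
    by (simp only: LINT_lebesgue_on_const[OF ms(3,1)])
  have r: "(\<lambda>u. w u - (B *v u + c)) \<in> L2 K" using wK ms by (intro L2_diff L2_affine)
  have "AE u in lebesgue_on K. w u - (B *v u + c) = 0" using leaf(1)[OF K] AB by simp
  then have "L2_inner K (\<lambda>u. w u - (B *v u + c)) (\<lambda>u. w u - (B *v u + c)) = L2_inner K (\<lambda>u. 0) (\<lambda>u. 0 :: point)"
    by (intro L2_inner_AE_cong[OF ms(1) r r])
  also have "\<dots> = 0" by (simp add: L2_inner_def)
  finally show ?case using 1 by (simp add: L2_inner_self_nonneg)
next
  case (step N N')
  let ?T = "elements M" and ?\<mu> = "edge_mean (elements M) m"
  show ?case
  proof (cases "(K, z) \<in> N'")
    case True
    then show ?thesis using step by blast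
  next
    case False
    from bisect_Union[OF step(1) step(4) False] obtain x' y' where K': "K = convex hull {z, x', y'}" and
      d: "det2 (x' - z) (y' - z) \<noteq> 0" and
      N': "(convex hull {midpoint x' y', z, x'}, midpoint x' y') \<in> N'"
          "(convex hull {midpoint x' y', z, y'}, midpoint x' y') \<in> N'" by blast
    have "(x' = x \<and> y' = y) \<or> (x' = y \<and> y' = x)"
      using triangle_vertices_unique[of z x y x' y'] K' step by simp
    then have q: "(norm (x - z))\<^sup>2 + (norm (y - z))\<^sup>2 = (norm (x' - z))\<^sup>2 + (norm (y' - z))\<^sup>2" by auto
    define p where "p = midpoint x' y'"
    define K1 K2 where "K1 = convex hull {p, z, x'}" and "K2 = convex hull {p, z, y'}"
    define Q where "Q = (norm (x' - z))\<^sup>2 + (norm (y' - z))\<^sup>2"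
    have d1: "det2 (z - p) (x' - p) \<noteq> 0" and d2: "det2 (z - p) (y' - p) \<noteq> 0"
      using d by (auto simp: p_def bisection_det2)
    have K12: "K = K1 \<union> K2" unfolding K' K1_def K2_def p_def by (rule bisection_union)
    have N'': "(K1, p) \<in> N'" "(K2, p) \<in> N'" using N' by (auto simp: K1_def K2_def p_def)
    have s1: "2 simplex K1" and s2: "2 simplex K2" unfolding K1_def K2_def simplex2_iff using d1 d2 by auto
    have s: "2 simplex K" unfolding K' simplex2_iff using d .
    note m1 = simplex2_sets[OF s1] and m2 = simplex2_sets[OF s2] and m0 = simplex2_sets[OF s]
    have KS: "K \<subseteq> S"
    proof -
      have "bisect\<^sup>*\<^sup>* N M" using step(1,2) by (rule converse_rtranclp_into_rtranclp)
      from bisect_rtranclp_cover[OF this step(4)] show ?thesis using S(4) by blast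
    qed
    obtain B1 c1 where B1: "cr_match ?\<mu> K1 B1 c1" using cr_match_exists[OF s1, of ?\<mu>] edge_mean_commute by blast
    obtain B2 c2 where B2: "cr_match ?\<mu> K2 B2 c2" using cr_match_exists[OF s2, of ?\<mu>] edge_mean_commute by blast
    note ih1 = step.IH[OF N''(1) K1_def d1 B1] and ih2 = step.IH[OF N''(2) K2_def d2 B2]
    have L: "w \<in> L2 K1" "w \<in> L2 K2" "w \<in> L2 K" "W \<in> L2 K1" "W \<in> L2 K2" "W \<in> L2 K"
      using S KS K12 m0 m1 m2 by (auto intro: L2_subset)
    have "p extreme_point_of K1" unfolding K1_def extreme_point_of_triangle_iff[OF d1] by simp
    moreover have "p \<in> \<Union> {L \<in> ?T. L \<subseteq> K1}"
      using bisect_rtranclp_cover[OF step(2) N''(1)] by (simp add: K1_def hull_inc)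
    ultimately obtain L where "L \<in> ?T" "p extreme_point_of L"
      by (auto simp: extreme_point_of_def)
    then have "?\<mu> x' y' = (1/2) *\<^sub>R (?\<mu> x' p + ?\<mu> p y')"
      unfolding p_def using det2_nonzero_imp_affine_independent(4)[OF d] by (intro edge_mean_midpoint[OF T])
    then have BB: "B1 + B2 = 2 *\<^sub>R B"
      using bisection_gradients[OF d _ _ step(7)[unfolded K'] B1[unfolded K1_def p_def] B2[unfolded K2_def p_def]] edge_mean_commute
      by (simp add: p_def)
    define h where "h = measure lebesgue K / 2"
    have h: "measure lebesgue K1 = h" "measure lebesgue K2 = h" "measure lebesgue K = 2 * h" "h \<ge> 0"
      unfolding h_def K1_def K2_def K' p_def measure_triangle bisection_det2 by auto
    have split: "(LINT u|lebesgue_on K. F u) = (LINT u|lebesgue_on K1. F u) + (LINT u|lebesgue_on K2. F u)"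
      if "integrable (lebesgue_on K) F" for F :: "point \<Rightarrow> 'b::euclidean_space"
      using that unfolding K' K1_def K2_def p_def by (rule LINT_bisection)
    have 1: "(LINT u|lebesgue_on K. W u) = measure lebesgue K *\<^sub>R B"
    proof -
      have "(LINT u|lebesgue_on K. W u) = h *\<^sub>R (B1 + B2)"
        using split[OF L2_integrable_vec[OF L(6) m0(3,1)]] ih1 ih2 h by (simp add: scaleR_add_right)
      then show ?thesis unfolding BB h by (simp add: mult.commute)
    qed
    define r where "r = (\<lambda>u. w u - (B *v u + c))"
    have r: "r \<in> L2 K" unfolding r_def using L m0 by (intro L2_diff L2_affine)
    define E1 E2 where "E1 = L2_inner K1 W W" and "E2 = L2_inner K2 W W"
    have E: "L2_inner K W W = E1 + E2" "E1 \<ge> 0" "E2 \<ge> 0"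
      using split[OF L2_integrable_inner[OF L(6) L(6)]] by (auto simp: E1_def E2_def L2_inner_def)
    have R: "L2_inner K r r = L2_inner K1 r r + L2_inner K2 r r"
      using split[OF L2_integrable_inner[OF r r]] by (simp add: L2_inner_def)
    have part: "L2_inner Ki r r \<le> 3 / 2 * (24 * (Q / 2) * L2_inner Ki W W) + 3 * (h * (2 * Q * (norm (Bi - B))\<^sup>2))"
      if Ki: "Ki \<subseteq> K" "Ki \<in> sets lebesgue" "bounded Ki" "measure lebesgue Ki = h" "w \<in> L2 Ki"
        and eq: "pi \<in> K" "Bi *v pi + ci = B *v pi + c"
        and ih: "L2_inner Ki (\<lambda>u. w u - (Bi *v u + ci)) (\<lambda>u. w u - (Bi *v u + ci)) \<le> 24 * (Q / 2) * L2_inner Ki W W"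
      for Ki Bi ci pi
    proof -
      let ?f = "\<lambda>u. w u - (Bi *v u + ci)" and ?g = "\<lambda>u. (Bi *v u + ci) - (B *v u + c)"
      have rfg: "r = (\<lambda>u. ?f u + ?g u)" by (simp add: r_def fun_eq_iff)
      have "?f \<in> L2 Ki" "?g \<in> L2 Ki" using Ki by (auto intro!: L2_diff L2_affine)
      then have "L2_inner Ki r r \<le> 3 / 2 * L2_inner Ki ?f ?f + 3 * L2_inner Ki ?g ?g"
        unfolding rfg by (rule L2_inner_add_self_le)
      also have "L2_inner Ki ?g ?g \<le> h * (2 * Q * (norm (Bi - B))\<^sup>2)"
        using L2_inner_affine_diff_le[of Ki z x' y' pi Bi ci B c] Ki eq by (simp add: K'[symmetric] Q_def)
      finally show ?thesis using ih by simp
    qed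
    have side: "(norm (z - p))\<^sup>2 + (norm (x' - p))\<^sup>2 = Q / 2" "(norm (z - p))\<^sup>2 + (norm (y' - p))\<^sup>2 = Q / 2"
      using bisection_sides[of z x' y'] bisection_sides[of z y' x'] by (simp_all add: p_def Q_def midpoint_sym add.commute)
    have conv: "convex K" using simplex2_convex_compact[OF s] by simp
    have zx: "z \<in> K" "x' \<in> K" "y' \<in> K" by (auto simp: K' hull_inc)
    have mid: "midpoint z x' \<in> K" "midpoint z y' \<in> K"
      using closed_segment_subset[OF zx(1,2) conv] closed_segment_subset[OF zx(1,3) conv] by auto
    have P1: "L2_inner K1 r r \<le> 3 / 2 * (24 * (Q / 2) * E1) + 3 * (h * (2 * Q * (norm (B1 - B))\<^sup>2))"
      unfolding E1_def
    proof (rule part)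
      show "B1 *v midpoint z x' + c1 = B *v midpoint z x' + c"
        using cr_matchD(1)[OF d1 B1[unfolded K1_def]] cr_matchD(3)[OF d step(7)[unfolded K']] by simp
    qed (use K12 m1 h L ih1 side mid in auto)
    have P2: "L2_inner K2 r r \<le> 3 / 2 * (24 * (Q / 2) * E2) + 3 * (h * (2 * Q * (norm (B2 - B))\<^sup>2))"
      unfolding E2_def
    proof (rule part)
      show "B2 *v midpoint z y' + c2 = B *v midpoint z y' + c"
        using cr_matchD(1)[OF d2 B2[unfolded K2_def]] cr_matchD(2)[OF d step(7)[unfolded K']] by simp
    qed (use K12 m2 h L ih2 side mid in auto)
    have G: "h * (norm B1)\<^sup>2 \<le> E1" "h * (norm B2)\<^sup>2 \<le> E2"
      using mean_value_le[OF L(4) m1(3,1), of B1] mean_value_le[OF L(5) m2(3,1), of B2] ih1 ih2 h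
      by (auto simp: E1_def E2_def)
    have "(norm (B1 - B))\<^sup>2 + (norm (B2 - B))\<^sup>2 \<le> (norm B1)\<^sup>2 + (norm B2)\<^sup>2"
    proof -
      have B: "B = (1/2) *\<^sub>R (B1 + B2)" using BB by simp
      have "(norm (B1 - B))\<^sup>2 + (norm (B2 - B))\<^sup>2 + 2 * (norm B)\<^sup>2 = (norm B1)\<^sup>2 + (norm B2)\<^sup>2"
        unfolding B by (simp add: power2_norm_eq_inner inner_diff_left inner_diff_right inner_add_left inner_add_right
            inner_commute field_simps)
      then show ?thesis using zero_le_power2[of "norm B"] by linarith
    qed
    then have "h * ((norm (B1 - B))\<^sup>2 + (norm (B2 - B))\<^sup>2) \<le> h * ((norm B1)\<^sup>2 + (norm B2)\<^sup>2)"
      using h by (intro mult_left_mono)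
    also have "\<dots> \<le> E1 + E2" using G by (simp add: distrib_left)
    finally have D: "6 * Q * (h * ((norm (B1 - B))\<^sup>2 + (norm (B2 - B))\<^sup>2)) \<le> 6 * Q * (E1 + E2)"
      by (intro mult_left_mono) (auto simp: Q_def)
    have "L2_inner K r r \<le> 18 * Q * (E1 + E2) + 6 * Q * (h * ((norm (B1 - B))\<^sup>2 + (norm (B2 - B))\<^sup>2))"
      unfolding R using P1 P2 by (simp add: algebra_simps)
    also have "\<dots> \<le> 24 * Q * (E1 + E2)" using D by (simp add: algebra_simps)
    finally have "L2_inner K r r \<le> 24 * Q * L2_inner K W W" by (simp only: E)
    with 1 show ?thesis unfolding q Q_def[symmetric] r_def by blast
  qed
qed

section \<open>Piecewise functions\<close>

lemma L2_zero: "(\<lambda>x. 0) \<in> L2 S"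
  by (simp add: L2_def)

lemma L2_sum: "finite I \<Longrightarrow> (\<And>i. i \<in> I \<Longrightarrow> f i \<in> L2 S) \<Longrightarrow> (\<lambda>x. \<Sum>i\<in>I. f i x) \<in> L2 S"
  by (induction I rule: finite_induct) (auto intro: L2_zero L2_add)

lemma AE_indicator_sum:
  fixes f :: "point set \<Rightarrow> point \<Rightarrow> 'b::real_vector"
  assumes T: "triangle_mesh T" and K: "K \<in> T"
  shows "AE x in lebesgue_on K. (\<Sum>L\<in>T. indicator (interior L) x *\<^sub>R f L x) = f K x"
proof -
  have s: "2 simplex K" using T K by (simp add: triangle_mesh_def)
  note m = simplex2_sets[OF s]
  have "AE x in lebesgue_on (interior K). (\<Sum>L\<in>T. indicator (interior L) x *\<^sub>R f L x) = f K x"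
    using m by (intro AE_I2) (simp add: indicator_sum_interior[OF T K, of _ "\<lambda>L. f L _"])
  then show ?thesis by (rule AE_lebesgue_on_superset[OF m(2,1,4)])
qed

lemma L2_piecewise:
  assumes \<Omega>: "polygonal_domain \<Omega>" and T: "conforming_triangulation \<Omega> T"
    and f: "\<And>K. K \<in> T \<Longrightarrow> f K \<in> L2 K"
  shows "(\<lambda>x. \<Sum>L\<in>T. indicator (interior L) x *\<^sub>R f L x) \<in> L2 \<Omega>"
proof (rule L2_sum)
  show "finite T" using triangle_mesh_finite[OF conforming_triangle_mesh[OF T]] .
  fix K assume K: "K \<in> T"
  note m = mesh_element_sets[OF \<Omega> T K]
  have "f K \<in> L2 (interior K)" using L2_subset[OF f[OF K] interior_subset m(2,1)] .
  then show "(\<lambda>x. indicator (interior K) x *\<^sub>R f K x) \<in> L2 \<Omega>"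
    by (rule L2_indicator[OF polygonal_domain_sets(3)[OF \<Omega>] m(2) _ mesh_element(3)[OF \<Omega> T K]])
qed

lemma L2_meshI:
  assumes \<Omega>: "polygonal_domain \<Omega>" and T: "conforming_triangulation \<Omega> T"
    and f: "\<And>K. K \<in> T \<Longrightarrow> f \<in> L2 K"
  shows "f \<in> L2 \<Omega>"
proof -
  have "(\<lambda>x. \<Sum>L\<in>T. indicator (interior L) x *\<^sub>R f x) \<in> L2 \<Omega>" by (rule L2_piecewise[OF \<Omega> T f])
  moreover have "AE x in lebesgue_on \<Omega>. (\<Sum>L\<in>T. indicator (interior L) x *\<^sub>R f x) = f x"
    by (rule AE_mesh[OF \<Omega> T]) (rule AE_indicator_sum[OF conforming_triangle_mesh[OF T]])
  ultimately show ?thesis by (rule L2_AE_cong[OF polygonal_domain_sets(3)[OF \<Omega>]])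
qed

lemma nc_piecewise:
  assumes \<Omega>: "polygonal_domain \<Omega>" and T: "conforming_triangulation \<Omega> T"
    and sym: "\<And>c d. m c d = m d c"
    and match: "\<And>K. K \<in> T \<Longrightarrow> cr_match m K (A K) (b K)"
    and bd: "\<And>c d. mesh_edge T c d \<Longrightarrow> closed_segment c d \<subseteq> frontier \<Omega> \<Longrightarrow> m c d = 0"
  obtains v where "v \<in> V_nc \<Omega> T" "nc_family \<Omega> T v A b m"
proof -
  define v where "v = (\<lambda>x. \<Sum>L\<in>T. indicator (interior L) x *\<^sub>R (A L *v x + b L))"
  have "v \<in> L2 \<Omega>" unfolding v_def
    using mesh_element_sets[OF \<Omega> T] by (intro L2_piecewise[OF \<Omega> T] L2_affine)
  moreover have "nc_family \<Omega> T v A b m"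
    unfolding nc_family_def using sym match bd AE_indicator_sum[OF conforming_triangle_mesh[OF T], of _ "\<lambda>L x. A L *v x + b L"]
    by (simp add: v_def)
  ultimately show ?thesis using that V_nc_if_family[OF conforming_triangle_mesh[OF T]] by blast
qed

lemma V_nc_L2: "v \<in> V_nc \<Omega> T \<Longrightarrow> v \<in> L2 \<Omega>"
  by (simp add: V_nc_def)

lemma V_nc_broken_grad_constant:
  assumes T: "triangle_mesh T" and v: "v \<in> V_nc \<Omega> T" and K: "K \<in> T"
  obtains B where "AE x in lebesgue_on K. broken_grad T v x = B"
  using V_nc_imp_family[OF T v] nc_family_broken_grad[OF T _ K] by metis

lemma V_nc_broken_grad_L2:
  assumes \<Omega>: "polygonal_domain \<Omega>" and T: "conforming_triangulation \<Omega> T" and v: "v \<in> V_nc \<Omega> T"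
  shows "broken_grad T v \<in> L2 \<Omega>"
proof (rule L2_meshI[OF \<Omega> T])
  fix K assume K: "K \<in> T"
  note m = mesh_element_sets[OF \<Omega> T K]
  obtain B where B: "AE x in lebesgue_on K. broken_grad T v x = B"
    by (rule V_nc_broken_grad_constant[OF conforming_triangle_mesh[OF T] v K])
  have "AE x in lebesgue_on K. B = broken_grad T v x" using B by eventually_elim simp
  then show "broken_grad T v \<in> L2 K"
    by (rule L2_AE_cong[OF m(1) L2_const[OF m(3,1)]])
qed

lemma nc_family_LINT_broken_grad:
  assumes \<Omega>: "polygonal_domain \<Omega>" and T: "conforming_triangulation \<Omega> T" and v: "v \<in> V_nc \<Omega> T"
    and f: "nc_family \<Omega> T v A b m" and K: "K \<in> T"
  shows "(LINT x|lebesgue_on K. broken_grad T v x) = measure lebesgue K *\<^sub>R A K"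
proof -
  have "broken_grad T v \<in> L2 K" by (rule L2_mesh_element[OF \<Omega> T V_nc_broken_grad_L2[OF \<Omega> T v] K])
  then have "(LINT x|lebesgue_on K. broken_grad T v x) = (LINT x|lebesgue_on K. A K)"
    using nc_family_broken_grad[OF conforming_triangle_mesh[OF T] f K]
    by (intro integral_cong_AE) (auto simp: L2_def)
  then show ?thesis by (simp only: LINT_lebesgue_on_const[OF mesh_element_sets(3,1)[OF \<Omega> T K]])
qed

lemma V_nc_weak_gradient:
  assumes T: "triangle_mesh T" and v: "v \<in> V_nc \<Omega> T" and K: "K \<in> T"
  obtains B where "has_weak_gradient (interior K) v (\<lambda>x. B)" "AE x in lebesgue_on K. broken_grad T v x = B"
proof -
  obtain A b m where f: "nc_family \<Omega> T v A b m" by (rule V_nc_imp_family[OF T v])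
  have "has_weak_gradient (interior K) v (\<lambda>x. A K)"
    using f K T by (intro has_weak_gradient_P1[where b = "b K"]) (auto simp: nc_family_def triangle_mesh_def)
  then show ?thesis using that broken_grad_AE[OF T K] by blast
qed

lemma V_nc_diff:
  assumes T: "triangle_mesh T" and v: "v \<in> V_nc \<Omega> T" and w: "w \<in> V_nc \<Omega> T"
  shows "(\<lambda>x. v x - w x) \<in> V_nc \<Omega> T"
proof -
  obtain A b m where f: "nc_family \<Omega> T v A b m" by (rule V_nc_imp_family[OF T v])
  obtain A' b' m' where f': "nc_family \<Omega> T w A' b' m'" by (rule V_nc_imp_family[OF T w])
  have "AE x in lebesgue_on K. v x - w x = (A K - A' K) *v x + (b K - b' K)" if "K \<in> T" for K
  proof -
    have "AE x in lebesgue_on K. v x = A K *v x + b K" "AE x in lebesgue_on K. w x = A' K *v x + b' K"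
      using f f' that by (auto simp: nc_family_def)
    then show ?thesis by eventually_elim (simp add: matrix_vector_mult_diff_rdistrib algebra_simps)
  qed
  moreover have "cr_match (\<lambda>c d. m c d - m' c d) K (A K - A' K) (b K - b' K)" if "K \<in> T" for K
  proof -
    have "cr_match m K (A K) (b K)" "cr_match m' K (A' K) (b' K)" using f f' that by (auto simp: nc_family_def)
    then show ?thesis unfolding cr_match_def by (simp add: matrix_vector_mult_diff_rdistrib) (metis add_diff_add)
  qed
  moreover have "m c d - m' c d = m d c - m' d c" for c d
    using f f' unfolding nc_family_def by metis
  ultimately have "nc_family \<Omega> T (\<lambda>x. v x - w x) (\<lambda>K. A K - A' K) (\<lambda>K. b K - b' K) (\<lambda>c d. m c d - m' c d)"
    using f f' unfolding nc_family_def by auto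
  then show ?thesis using V_nc_if_family[OF T L2_diff[OF V_nc_L2[OF v] V_nc_L2[OF w]]] by blast
qed

lemma broken_grad_diff:
  assumes T: "triangle_mesh T" and K: "K \<in> T"
    and v: "has_weak_gradient (interior K) v G" and w: "has_weak_gradient (interior K) w H"
  shows "AE x in lebesgue_on K. broken_grad T (\<lambda>x. v x - w x) x = broken_grad T v x - broken_grad T w x"
proof -
  have s: "2 simplex K" using T K by (simp add: triangle_mesh_def)
  have "bounded (interior K)" using simplex2_sets(3)[OF s] interior_subset bounded_subset by blast
  then have "has_weak_gradient (interior K) (\<lambda>x. v x - w x) (\<lambda>x. G x - H x)"
    by (intro has_weak_gradient_diff v w simplex2_sets(2)[OF s])
  from broken_grad_AE[OF T K this] broken_grad_AE[OF T K v] broken_grad_AE[OF T K w]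
  show ?thesis by eventually_elim simp
qed

text \<open>Against functions that are constant on every element only the mean values on the elements
  count. This is how interpolants replace functions in the bilinear forms.\<close>

lemma L2_inner_piecewise_constant:
  fixes F W W' :: "point \<Rightarrow> real^2^2"
  assumes \<Omega>: "polygonal_domain \<Omega>" and T: "conforming_triangulation \<Omega> T"
    and L: "F \<in> L2 \<Omega>" "W \<in> L2 \<Omega>" "W' \<in> L2 \<Omega>"
    and F: "\<And>K. K \<in> T \<Longrightarrow> \<exists>c. AE x in lebesgue_on K. F x = c"
    and W: "\<And>K. K \<in> T \<Longrightarrow> (LINT x|lebesgue_on K. W x) = (LINT x|lebesgue_on K. W' x)"
  shows "L2_inner \<Omega> W F = L2_inner \<Omega> W' F"
proof -
  have "L2_inner K W F = L2_inner K W' F" if K: "K \<in> T" for K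
  proof -
    note m = mesh_element_sets[OF \<Omega> T K]
    note LK = L2_mesh_element[OF \<Omega> T L(1) K] L2_mesh_element[OF \<Omega> T L(2) K] L2_mesh_element[OF \<Omega> T L(3) K]
    obtain c where c: "AE x in lebesgue_on K. F x = c" using F[OF K] by blast
    have *: "L2_inner K V F = (LINT x|lebesgue_on K. V x) \<bullet> c" if "V \<in> L2 K" for V
    proof -
      have "L2_inner K V F = L2_inner K V (\<lambda>x. c)"
        by (rule L2_inner_AE_cong[OF m(1) that LK(1)]) (use c in auto)
      also have "\<dots> = (LINT x|lebesgue_on K. V x) \<bullet> c"
        unfolding L2_inner_def using L2_integrable_vec[OF that m(3,1)] by simp
      finally show ?thesis .
    qed
    show ?thesis unfolding *[OF LK(2)] *[OF LK(3)] W[OF K] ..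
  qed
  then show ?thesis by (simp add: L2_inner_mesh[OF \<Omega> T] L)
qed

text \<open>Replacing a function by its mean values on the elements is an orthogonal projection.\<close>

lemma L2_norm_piecewise_mean_le:
  fixes F W :: "point \<Rightarrow> real^2^2"
  assumes \<Omega>: "polygonal_domain \<Omega>" and T: "conforming_triangulation \<Omega> T"
    and L: "F \<in> L2 \<Omega>" "W \<in> L2 \<Omega>"
    and W: "\<And>K. K \<in> T \<Longrightarrow> \<exists>c. AE x in lebesgue_on K. W x = c"
    and WF: "\<And>K. K \<in> T \<Longrightarrow> (LINT x|lebesgue_on K. W x) = (LINT x|lebesgue_on K. F x)"
  shows "L2_norm \<Omega> W \<le> L2_norm \<Omega> F"
proof -
  have WW: "L2_inner \<Omega> W W = L2_inner \<Omega> F W"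
    by (rule L2_inner_piecewise_constant[OF \<Omega> T L(2,2,1) W WF])
  have "L2_norm \<Omega> W * L2_norm \<Omega> W \<le> L2_norm \<Omega> F * L2_norm \<Omega> W"
    using L2_Cauchy_Schwarz[OF L] WW L2_norm_power2[of \<Omega> W] by (simp add: power2_eq_square)
  then show ?thesis using L2_norm_nonneg[of \<Omega> W] L2_norm_nonneg[of \<Omega> F]
    by (metis mult_right_le_imp_le order_less_le)
qed

section \<open>Interpolation\<close>

lemma integral_reflect_unit:
  fixes f :: "point \<Rightarrow> point"
  shows "integral {0..1} (\<lambda>t. f ((1 - t) *\<^sub>R c + t *\<^sub>R d)) = integral {0..1} (\<lambda>t. f ((1 - t) *\<^sub>R d + t *\<^sub>R c))"
proof -
  define h where "h = (\<lambda>t. f ((1 - t) *\<^sub>R c + t *\<^sub>R d))"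
  define k where "k = (\<lambda>t. f ((1 - t) *\<^sub>R d + t *\<^sub>R c))"
  have "(\<lambda>t. h (- t)) = k \<circ> (+) 1"
    by (simp add: h_def k_def fun_eq_iff add.commute)
  then show ?thesis unfolding h_def[symmetric] k_def[symmetric]
    using Henstock_Kurzweil_Integration.integral_reflect_real[of 1 0 h] integral_shift_Icc_real[of "-1" 0 k 1]
    by simp
qed

text \<open>By the divergence theorem the integral of the gradient depends on the edge means only, and the
  affine function has the same edge means as \<open>\<phi>\<close>.\<close>

lemma LINT_gradient_triangle:
  fixes \<phi> :: "point \<Rightarrow> point" and A :: "real^2^2"
  assumes C: "\<And>i. Ck (Suc 0) (\<lambda>x. \<phi> x $ i)" and s: "2 simplex K"
    and A: "cr_match (\<lambda>c d. integral {0..1} (\<lambda>t. \<phi> ((1 - t) *\<^sub>R c + t *\<^sub>R d))) K A b"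
  shows "(LINT x|lebesgue_on K. (\<chi> i j. partial j (\<lambda>x. \<phi> x $ i) x)) = measure lebesgue K *\<^sub>R A"
proof -
  define m where "m = (\<lambda>c d. integral {0..1} (\<lambda>t. \<phi> ((1 - t) *\<^sub>R c + t *\<^sub>R d)))"
  let ?\<Phi> = "\<lambda>x. (\<chi> i j. partial j (\<lambda>x. \<phi> x $ i) x) :: real^2^2"
  obtain z x y where K: "K = convex hull {z, x, y}" and d: "det2 (x - z) (y - z) \<noteq> 0"
    using s by (rule simplex2_obtain)
  note ms = simplex2_sets[OF s]
  have "continuous_on UNIV (\<lambda>x. \<chi> i. \<phi> x $ i)"
    using Ck_SucD[OF C] by (intro continuous_on_vec_lambda) auto
  then have c\<phi>: "continuous_on UNIV \<phi>" by simp
  have c\<Phi>: "continuous_on UNIV ?\<Phi>" using C by (intro continuous_on_vec_lambda) auto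
  have i\<Phi>: "integrable (lebesgue_on K) ?\<Phi>"
    using L2_integrable_vec[OF L2_continuous[OF c\<Phi> ms(3,1)] ms(3,1)] .
  have m_nth: "m c d $ i = integral {0..1} (\<lambda>t. \<phi> ((1 - t) *\<^sub>R c + t *\<^sub>R d) $ i)" for c d i
    unfolding m_def
    by (intro integral_component_eq_cart[symmetric] integrable_continuous_real
        continuous_on_compose2[OF c\<phi>]) (auto intro!: continuous_intros)
  have m_sym: "m c d = m d c" for c d unfolding m_def by (rule integral_reflect_unit)
  have dir: "(LINT x|lebesgue_on K. ?\<Phi> x) *v a = (2 * measure lebesgue K) *\<^sub>R (m (z + a) (z + b) - m z (z + b))"
    if ab: "K = convex hull {z, z + a, z + b}" "det2 a b \<noteq> 0" for a b
  proof -
    have "((LINT x|lebesgue_on K. ?\<Phi> x) *v a) $ i = ((2 * measure lebesgue K) *\<^sub>R (m (z + a) (z + b) - m z (z + b))) $ i" for i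
    proof -
      have bl: "bounded_linear (\<lambda>G::real^2^2. (G *v a) $ i)"
        unfolding linear_conv_bounded_linear[symmetric]
        by (intro linearI) (auto simp: matrix_vector_mult_add_rdistrib scaleR_matrix_vector_assoc[symmetric])
      have F: "(?\<Phi> u *v a) $ i = a $ 1 * partial 1 (\<lambda>x. \<phi> x $ i) u + a $ 2 * partial 2 (\<lambda>x. \<phi> x $ i) u" for u
        by (simp add: matrix_vector_mult_def sum_2 mult.commute)
      have "((LINT x|lebesgue_on K. ?\<Phi> x) *v a) $ i = (LINT u|lebesgue_on K. (?\<Phi> u *v a) $ i)"
        using integral_bounded_linear[OF bl i\<Phi>] by simp
      also have "\<dots> = integral K (\<lambda>u. (?\<Phi> u *v a) $ i)"
        by (rule lebesgue_integral_eq_integral[OF integrable_bounded_linear[OF bl i\<Phi>] ms(1)])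
      also have "\<dots> = \<bar>det2 a b\<bar> * (integral {0..1} (\<lambda>t. \<phi> (z + ((1 - t) *\<^sub>R a + t *\<^sub>R b)) $ i) -
          integral {0..1} (\<lambda>t. \<phi> (z + t *\<^sub>R b) $ i))"
        unfolding F ab(1) by (rule integral_triangle_derivative[OF ab(2) C])
      also have "(\<lambda>t. \<phi> (z + ((1 - t) *\<^sub>R a + t *\<^sub>R b)) $ i) = (\<lambda>t. \<phi> ((1 - t) *\<^sub>R (z + a) + t *\<^sub>R (z + b)) $ i)"
        by (simp add: algebra_simps)
      also have "(\<lambda>t. \<phi> (z + t *\<^sub>R b) $ i) = (\<lambda>t. \<phi> ((1 - t) *\<^sub>R z + t *\<^sub>R (z + b)) $ i)"
        by (simp add: algebra_simps)
      also have "\<bar>det2 a b\<bar> = 2 * measure lebesgue K" unfolding ab(1) measure_triangle by simp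
      finally show ?thesis by (simp add: m_nth)
    qed
    then show ?thesis by (simp add: vec_eq_iff)
  qed
  have A': "cr_match m (convex hull {z, x, y}) A b" using A by (simp add: m_def K)
  show ?thesis
  proof (rule matrix_eq_on_basis[OF d])
    show "(LINT x|lebesgue_on K. ?\<Phi> x) *v (x - z) = (measure lebesgue K *\<^sub>R A) *v (x - z)"
      using dir[of "x - z" "y - z"] d cr_matchD(4)[OF d A']
      by (simp add: K scaleR_matrix_vector_assoc[symmetric] mult.commute)
    have "det2 (y - z) (x - z) \<noteq> 0" using d by (simp add: det2_def algebra_simps)
    then show "(LINT x|lebesgue_on K. ?\<Phi> x) *v (y - z) = (measure lebesgue K *\<^sub>R A) *v (y - z)"
      using dir[of "y - z" "x - z"] cr_matchD(5)[OF d A'] m_sym[of x y]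
      by (simp add: K scaleR_matrix_vector_assoc[symmetric] mult.commute insert_commute[of x y])
  qed
qed

lemma fine_interpolation:
  fixes \<phi> :: "point \<Rightarrow> point"
  assumes \<Omega>: "polygonal_domain \<Omega>" and T: "conforming_triangulation \<Omega> T"
    and t: "\<And>i. test_function \<Omega> (\<lambda>x. \<phi> x $ i)"
  obtains v where "v \<in> V_nc \<Omega> T"
    "\<And>K. K \<in> T \<Longrightarrow> (LINT x|lebesgue_on K. broken_grad T v x) =
       (LINT x|lebesgue_on K. (\<chi> i j. partial j (\<lambda>x. \<phi> x $ i) x))"
proof -
  define m where "m = (\<lambda>c d. integral {0..1} (\<lambda>t. \<phi> ((1 - t) *\<^sub>R c + t *\<^sub>R d)))"
  have C: "Ck (Suc 0) (\<lambda>x. \<phi> x $ i)" for i using t[of i] unfolding test_function_def by blast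
  have TM: "triangle_mesh T" by (rule conforming_triangle_mesh[OF T])
  have sym: "m c d = m d c" for c d unfolding m_def by (rule integral_reflect_unit)
  have "\<forall>K\<in>T. \<exists>Ab. cr_match m K (fst Ab) (snd Ab)"
    using cr_match_exists[OF mesh_element(1)[OF \<Omega> T], of _ m] sym by simp
  from bchoice[OF this] obtain Ab where Ab: "\<And>K. K \<in> T \<Longrightarrow> cr_match m K (fst (Ab K)) (snd (Ab K))" by blast
  have out: "\<phi> x = 0" if "x \<in> frontier \<Omega>" for x
  proof -
    have "x \<notin> \<Omega>" using that polygonal_domain_sets(1)[OF \<Omega>] by (simp add: frontier_def interior_open)
    then have "\<phi> x $ i = 0" for i
      using t[of i] closure_subset[of "{x. \<phi> x $ i \<noteq> 0}"] unfolding test_function_def by blast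
    then show ?thesis by (simp add: vec_eq_iff)
  qed
  have "m c d = 0" if "closed_segment c d \<subseteq> frontier \<Omega>" for c d
  proof -
    have "\<phi> ((1 - t) *\<^sub>R c + t *\<^sub>R d) = 0" if "t \<in> {0..1}" for t
      using that \<open>closed_segment c d \<subseteq> frontier \<Omega>\<close> by (intro out) (auto simp: closed_segment_def)
    then show ?thesis unfolding m_def using integral_cong[of "{0..1}" "\<lambda>t. \<phi> ((1 - t) *\<^sub>R c + t *\<^sub>R d)" "\<lambda>t. 0"] by simp
  qed
  then obtain v where v: "v \<in> V_nc \<Omega> T" "nc_family \<Omega> T v (\<lambda>K. fst (Ab K)) (\<lambda>K. snd (Ab K)) m"
    using nc_piecewise[OF \<Omega> T sym Ab] by blast
  have "(LINT x|lebesgue_on K. broken_grad T v x) = (LINT x|lebesgue_on K. (\<chi> i j. partial j (\<lambda>x. \<phi> x $ i) x))"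
    if K: "K \<in> T" for K
  proof -
    show ?thesis
      using nc_family_LINT_broken_grad[OF \<Omega> T v K]
        LINT_gradient_triangle[OF C mesh_element(1)[OF \<Omega> T K] Ab[OF K, unfolded m_def]] by simp
  qed
  then show ?thesis using that v(1) by blast
qed

text \<open>The interpolant is built from the edge means of \<open>w\<close> on the coarse edges. On an element that is
  not refined it coincides with \<open>w\<close>, so that only the refined elements contribute.\<close>

lemma coarse_interpolation:
  assumes \<Omega>: "polygonal_domain \<Omega>" and M: "marked_triangulation \<Omega> M" and M': "marked_triangulation \<Omega> M'"
    and b: "bisect\<^sup>*\<^sup>* M M'" and reg: "\<forall>Kz\<in>M. regular s Kz" and s: "s \<ge> 0"
    and w: "w \<in> V_nc \<Omega> (elements M')" and g: "g \<in> L2 \<Omega>"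
  obtains v where "v \<in> V_nc \<Omega> (elements M)"
    "\<And>K. K \<in> elements M \<Longrightarrow> (LINT x|lebesgue_on K. broken_grad (elements M) v x) =
       (LINT x|lebesgue_on K. broken_grad (elements M') w x)"
    "\<bar>L2_inner \<Omega> g (\<lambda>x. w x - v x)\<bar> \<le> sqrt (24 * s) * L2_norm \<Omega> (broken_grad (elements M') w) *
       sqrt (\<Sum>K\<in>elements M - elements M'. (mesh_size K)\<^sup>2 * (L2_norm K g)\<^sup>2)"
proof -
  let ?T = "elements M" and ?T' = "elements M'"
  have T: "conforming_triangulation \<Omega> ?T" and T': "conforming_triangulation \<Omega> ?T'"
    using M M' by (auto simp: marked_triangulation_def)
  note TM = conforming_triangle_mesh[OF T] and TM' = conforming_triangle_mesh[OF T']
  obtain A a m where f: "nc_family \<Omega> ?T' w A a m" by (rule V_nc_imp_family[OF TM' w])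
  have sym: "m c d = m d c" for c d using f by (simp add: nc_family_def)
  define W where "W = broken_grad ?T' w"
  have WL: "W \<in> L2 \<Omega>" unfolding W_def by (rule V_nc_broken_grad_L2[OF \<Omega> T' w])
  have wL: "w \<in> L2 \<Omega>" by (rule V_nc_L2[OF w])
  let ?\<mu> = "edge_mean ?T' m"
  have \<mu>sym: "?\<mu> c d = ?\<mu> d c" for c d by (rule edge_mean_commute)
  have "\<forall>K\<in>?T. \<exists>Bc. cr_match ?\<mu> K (fst Bc) (snd Bc)"
    using cr_match_exists[OF mesh_element(1)[OF \<Omega> T], of _ ?\<mu>] \<mu>sym by simp
  from bchoice[OF this] obtain Bc where Bc: "\<And>K. K \<in> ?T \<Longrightarrow> cr_match ?\<mu> K (fst (Bc K)) (snd (Bc K))" by blast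
  have "?\<mu> c d = 0" if "closed_segment c d \<subseteq> frontier \<Omega>" for c d
    using f that by (intro edge_mean_eq_0) (auto simp: nc_family_def)
  then obtain v where v: "v \<in> V_nc \<Omega> ?T" "nc_family \<Omega> ?T v (\<lambda>K. fst (Bc K)) (\<lambda>K. snd (Bc K)) ?\<mu>"
    using nc_piecewise[OF \<Omega> T \<mu>sym Bc] by blast
  have vL: "v \<in> L2 \<Omega>" by (rule V_nc_L2[OF v(1)])
  have leaf: "AE x in lebesgue_on K. w x = A K *v x + a K" "AE x in lebesgue_on K. W x = A K" "cr_match m K (A K) (a K)"
    if "K \<in> ?T'" for K
    using f that nc_family_broken_grad[OF TM' f that] by (auto simp: nc_family_def W_def)
  have cl: "\<Union>?T' \<subseteq> closure \<Omega>" using T' by (simp add: conforming_triangulation_def)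
  have local: "(LINT x|lebesgue_on K. W x) = measure lebesgue K *\<^sub>R fst (Bc K) \<and>
      L2_inner K (\<lambda>x. w x - v x) (\<lambda>x. w x - v x) \<le> 24 * (s * (mesh_size K)\<^sup>2) * L2_inner K W W" if K: "K \<in> ?T" for K
  proof -
    obtain z where z: "(K, z) \<in> M" using K by (auto simp: elements_def)
    then obtain x y where xy: "K = convex hull {z, x, y}" "det2 (x - z) (y - z) \<noteq> 0"
      "(norm (x - z))\<^sup>2 + (norm (y - z))\<^sup>2 \<le> s * measure lebesgue K"
      using reg by (fastforce simp: regular_def)
    note ms = mesh_element_sets[OF \<Omega> T K]
    let ?r = "\<lambda>x. w x - (fst (Bc K) *v x + snd (Bc K))"
    have est: "(LINT u|lebesgue_on K. W u) = measure lebesgue K *\<^sub>R fst (Bc K) \<and>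
      L2_inner K ?r ?r \<le> 24 * ((norm (x - z))\<^sup>2 + (norm (y - z))\<^sup>2) * L2_inner K W W"
      by (rule nvb_local_estimate[OF TM' sym leaf L2_closure[OF \<Omega> T wL] L2_closure[OF \<Omega> T WL]
            polygonal_domain_sets(4)[OF \<Omega>] cl b z xy(1,2) Bc[OF K]])
    have "AE x in lebesgue_on K. v x = fst (Bc K) *v x + snd (Bc K)"
      using v(2) K by (simp add: nc_family_def)
    then have "AE x in lebesgue_on K. ?r x = w x - v x" by eventually_elim simp
    then have e: "L2_inner K ?r ?r = L2_inner K (\<lambda>x. w x - v x) (\<lambda>x. w x - v x)"
      using L2_mesh_element[OF \<Omega> T wL K] ms
      by (intro L2_inner_AE_cong[OF ms(1)] L2_diff L2_affine)
    have "L2_inner K ?r ?r \<le> 24 * (s * (mesh_size K)\<^sup>2) * L2_inner K W W"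
    proof -
      have "24 * ((norm (x - z))\<^sup>2 + (norm (y - z))\<^sup>2) * L2_inner K W W \<le> 24 * (s * (mesh_size K)\<^sup>2) * L2_inner K W W"
        using xy(3) by (intro mult_right_mono mult_left_mono L2_inner_self_nonneg) (auto simp: mesh_size_def)
      then show ?thesis using est by linarith
    qed
    then show ?thesis using est unfolding e by blast
  qed
  have mean: "(LINT x|lebesgue_on K. broken_grad ?T v x) = (LINT x|lebesgue_on K. W x)" if K: "K \<in> ?T" for K
    using nc_family_LINT_broken_grad[OF \<Omega> T v K] local[OF K] by simp
  define D where "D = ?T - ?T'"
  have common: "L2_inner K g (\<lambda>x. w x - v x) = 0" if K: "K \<in> ?T" "K \<in> ?T'" for K
  proof -
    note sK = mesh_element(1)[OF \<Omega> T K(1)]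
    note ms = simplex2_sets[OF sK]
    have "cr_match m K (fst (Bc K)) (snd (Bc K))" by (rule cr_match_edge_mean[OF TM' K(2) sym Bc[OF K(1)]])
    then have eq: "A K = fst (Bc K)" "a K = snd (Bc K)" using cr_match_unique[OF sK leaf(3)[OF K(2)]] by auto
    have "AE x in lebesgue_on K. v x = fst (Bc K) *v x + snd (Bc K)" using v(2) K by (simp add: nc_family_def)
    with leaf(1)[OF K(2)] have "AE x in lebesgue_on K. w x - v x = 0"
      unfolding eq by eventually_elim simp
    then have "L2_inner K g (\<lambda>x. w x - v x) = L2_inner K g (\<lambda>x. 0)"
      using L2_mesh_element[OF \<Omega> T _ K(1)] g wL vL by (intro L2_inner_AE_cong[OF ms(1)] L2_diff) auto
    then show ?thesis by (simp add: L2_inner_def)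
  qed
  have fin: "finite ?T" by (rule triangle_mesh_finite[OF TM])
  have "L2_inner \<Omega> g (\<lambda>x. w x - v x) = (\<Sum>K\<in>?T. L2_inner K g (\<lambda>x. w x - v x))"
    by (rule L2_inner_mesh[OF \<Omega> T g L2_diff[OF wL vL]])
  also have "\<dots> = (\<Sum>K\<in>D. L2_inner K g (\<lambda>x. w x - v x))"
    using common fin by (intro sum.mono_neutral_right) (auto simp: D_def)
  finally have "\<bar>L2_inner \<Omega> g (\<lambda>x. w x - v x)\<bar> \<le> (\<Sum>K\<in>D. \<bar>L2_inner K g (\<lambda>x. w x - v x)\<bar>)"
    by simp
  also have "\<dots> \<le> (\<Sum>K\<in>D. (mesh_size K * L2_norm K g) * (sqrt (24 * s) * L2_norm K W))"
  proof (rule sum_mono)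
    fix K assume "K \<in> D"
    then have K: "K \<in> ?T" by (simp add: D_def)
    have "L2_norm K (\<lambda>x. w x - v x) \<le> sqrt (24 * (s * (mesh_size K)\<^sup>2) * L2_inner K W W)"
      unfolding L2_norm_def using local[OF K] by simp
    also have "\<dots> = sqrt (24 * s) * mesh_size K * L2_norm K W"
      by (simp add: L2_norm_def real_sqrt_mult mesh_size_def)
    finally have "L2_norm K g * L2_norm K (\<lambda>x. w x - v x) \<le> L2_norm K g * (sqrt (24 * s) * mesh_size K * L2_norm K W)"
      by (intro mult_left_mono L2_norm_nonneg)
    also have "\<dots> = (mesh_size K * L2_norm K g) * (sqrt (24 * s) * L2_norm K W)" by (simp only: mult_ac)
    moreover have "\<bar>L2_inner K g (\<lambda>x. w x - v x)\<bar> \<le> L2_norm K g * L2_norm K (\<lambda>x. w x - v x)"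
      using L2_mesh_element[OF \<Omega> T _ K] g wL vL by (intro L2_Cauchy_Schwarz L2_diff) auto
    ultimately show "\<bar>L2_inner K g (\<lambda>x. w x - v x)\<bar> \<le> (mesh_size K * L2_norm K g) * (sqrt (24 * s) * L2_norm K W)"
      by linarith
  qed
  also have "\<dots> \<le> sqrt (\<Sum>K\<in>D. (mesh_size K * L2_norm K g)\<^sup>2) * sqrt (\<Sum>K\<in>D. (sqrt (24 * s) * L2_norm K W)\<^sup>2)"
    unfolding real_sqrt_mult[symmetric]
    by (rule real_le_rsqrt) (rule Cauchy_Schwarz_ineq_sum)
  finally have 1: "\<bar>L2_inner \<Omega> g (\<lambda>x. w x - v x)\<bar> \<le>
      sqrt (\<Sum>K\<in>D. (mesh_size K * L2_norm K g)\<^sup>2) * sqrt (\<Sum>K\<in>D. (sqrt (24 * s) * L2_norm K W)\<^sup>2)" .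
  have 2: "sqrt (\<Sum>K\<in>D. (sqrt (24 * s) * L2_norm K W)\<^sup>2) \<le> sqrt (24 * s) * L2_norm \<Omega> W"
  proof -
    have "(\<Sum>K\<in>D. (sqrt (24 * s) * L2_norm K W)\<^sup>2) = 24 * s * (\<Sum>K\<in>D. L2_inner K W W)"
      using s by (simp add: power_mult_distrib L2_norm_power2 sum_distrib_left)
    also have "(\<Sum>K\<in>D. L2_inner K W W) \<le> (\<Sum>K\<in>?T. L2_inner K W W)"
      using fin by (intro sum_mono2) (auto simp: D_def L2_inner_self_nonneg)
    also have "\<dots> = L2_inner \<Omega> W W" by (rule L2_inner_mesh[OF \<Omega> T WL WL, symmetric])
    finally have "(\<Sum>K\<in>D. (sqrt (24 * s) * L2_norm K W)\<^sup>2) \<le> 24 * s * L2_inner \<Omega> W W"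
      using s by (simp add: mult_left_mono)
    then have "sqrt (\<Sum>K\<in>D. (sqrt (24 * s) * L2_norm K W)\<^sup>2) \<le> sqrt (24 * s * L2_inner \<Omega> W W)" by simp
    then show ?thesis by (simp only: L2_norm_def real_sqrt_mult)
  qed
  have "\<bar>L2_inner \<Omega> g (\<lambda>x. w x - v x)\<bar> \<le>
      sqrt (\<Sum>K\<in>D. (mesh_size K * L2_norm K g)\<^sup>2) * (sqrt (24 * s) * L2_norm \<Omega> W)"
    using 1 mult_left_mono[OF 2, of "sqrt (\<Sum>K\<in>D. (mesh_size K * L2_norm K g)\<^sup>2)"]
    by (simp add: sum_nonneg)
  then have "\<bar>L2_inner \<Omega> g (\<lambda>x. w x - v x)\<bar> \<le> sqrt (24 * s) * L2_norm \<Omega> W *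
       sqrt (\<Sum>K\<in>D. (mesh_size K)\<^sup>2 * (L2_norm K g)\<^sup>2)"
    by (simp only: power_mult_distrib mult_ac)
  then show ?thesis using that v(1) mean by (simp add: W_def D_def)
qed

section \<open>Quasi-orthogonality\<close>

lemma bisect_rtranclp_refines:
  assumes "bisect\<^sup>*\<^sup>* M M'" "L \<in> elements M'"
  shows "\<exists>K\<in>elements M. L \<subseteq> K"
  using assms
proof (induction arbitrary: L rule: rtranclp_induct)
  case (step N N')
  from step(2) have "\<exists>K\<in>elements N. L \<subseteq> K"
  proof cases
    case (1 K z x y m)
    have N': "N' = N - {(K, z)} \<union> {(convex hull {m, z, x}, m), (convex hull {m, z, y}, m)}"
      using 1 by (simp add: insert_commute)
    have K: "K \<in> elements N" using 1 by (force simp: elements_def)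
    have sub: "convex hull {m, z, x} \<subseteq> K" "convex hull {m, z, y} \<subseteq> K"
      unfolding \<open>K = convex hull {z, x, y}\<close> \<open>m = midpoint x y\<close> bisection_union[of z x y] by auto
    obtain z' where "(L, z') \<in> N'" using step.prems by (auto simp: elements_def)
    then consider "(L, z') \<in> N" | "L = convex hull {m, z, x}" | "L = convex hull {m, z, y}"
      unfolding N' by (elim UnE DiffE insertE emptyE Pair_inject) (rule that; assumption)+
    then show ?thesis
    proof cases
      case 1
      then have "L \<in> elements N" by (force simp: elements_def)
      then show ?thesis by blast
    next
      case 2
      then show ?thesis using K sub(1) by blast
    next
      case 3
      then show ?thesis using K sub(2) by blast
    qed
  qed
  then obtain K where K: "K \<in> elements N" "L \<subseteq> K" by (elim bexE)
  from step.IH[OF K(1)] obtain K' where "K' \<in> elements M" "K \<subseteq> K'" by (elim bexE)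
  with K(2) show ?case by (intro bexI[of _ K'] order_trans[of L K K'])
qed auto

lemma trace_times_eq_inner: "trace G * q = G \<bullet> (q *\<^sub>R mat 1)" for G :: "real^2^2"
  by (simp add: trace_def inner_vec_def mat_def sum_2 algebra_simps)

lemma L2_inner_trace: "L2_inner S (\<lambda>x. trace (G x)) q = L2_inner S G (\<lambda>x. q x *\<^sub>R mat 1)" for G :: "point \<Rightarrow> real^2^2"
  by (simp add: L2_inner_def trace_times_eq_inner)

lemma L2_pressure: "q \<in> L2 S \<Longrightarrow> (\<lambda>x. q x *\<^sub>R (mat 1 :: real^2^2)) \<in> L2 S"
  by (rule L2_linear[OF _ bounded_linear_scaleR_left])

lemma zero_in_L2_0: "(\<lambda>x. 0) \<in> L2_0 S"
  by (simp add: L2_0_def L2_zero)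

lemma zero_in_Q_nc: "(\<lambda>x. 0) \<in> Q_nc \<Omega> T"
  unfolding Q_nc_def P0_on_def using zero_in_L2_0 by (auto intro: exI[of _ 0])

lemma discrete_solutionD:
  assumes "discrete_solution \<mu> \<Omega> T g u p"
  shows "u \<in> V_nc \<Omega> T" "p \<in> Q_nc \<Omega> T"
    and "v \<in> V_nc \<Omega> T \<Longrightarrow> \<mu> * L2_inner \<Omega> (broken_grad T u) (broken_grad T v) +
      L2_inner \<Omega> (broken_grad T v) (\<lambda>x. p x *\<^sub>R mat 1) = L2_inner \<Omega> g v"
    and "q \<in> Q_nc \<Omega> T \<Longrightarrow> L2_inner \<Omega> (broken_grad T u) (\<lambda>x. q x *\<^sub>R mat 1) = 0"
proof -
  show u: "u \<in> V_nc \<Omega> T" "p \<in> Q_nc \<Omega> T" using assms by (auto simp: discrete_solution_def)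
  have eq: "\<mu> * L2_inner \<Omega> (broken_grad T u) (broken_grad T v) +
      L2_inner \<Omega> (broken_grad T v) (\<lambda>x. p x *\<^sub>R mat 1) +
      L2_inner \<Omega> (broken_grad T u) (\<lambda>x. q x *\<^sub>R mat 1) = L2_inner \<Omega> g v"
    if "v \<in> V_nc \<Omega> T" "q \<in> Q_nc \<Omega> T" for v q
    using assms that unfolding discrete_solution_def broken_a_def broken_b_def L2_inner_trace by blast
  have z: "L2_inner \<Omega> (broken_grad T u) (\<lambda>x. 0 *\<^sub>R mat 1) = 0" by (simp add: L2_inner_def)
  show e: "\<mu> * L2_inner \<Omega> (broken_grad T u) (broken_grad T v) +
      L2_inner \<Omega> (broken_grad T v) (\<lambda>x. p x *\<^sub>R mat 1) = L2_inner \<Omega> g v" if "v \<in> V_nc \<Omega> T" for v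
    using eq[OF that zero_in_Q_nc] z by simp
  show "L2_inner \<Omega> (broken_grad T u) (\<lambda>x. q x *\<^sub>R mat 1) = 0" if "q \<in> Q_nc \<Omega> T"
    using eq[OF u(1) that] e[OF u(1)] by simp
qed

text \<open>Testing with \<open>u\<close> itself, once together with \<open>q\<close> and once with zero.\<close>

lemma stokes_solution_divergence_free:
  assumes "stokes_solution \<mu> \<Omega> g u p" "q \<in> L2_0 \<Omega>"
  shows "L2_inner \<Omega> (weak_grad \<Omega> u) (\<lambda>x. q x *\<^sub>R mat 1) = 0"
proof -
  have u: "u \<in> H1_0 \<Omega>" and eq: "\<And>q. q \<in> L2_0 \<Omega> \<Longrightarrow>
        form_a \<mu> \<Omega> u u + form_b \<Omega> u p + form_b \<Omega> u q = L2_inner \<Omega> g u"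
    using assms by (auto simp: stokes_solution_def)
  have "form_b \<Omega> u q = form_b \<Omega> u (\<lambda>x. 0)"
    using eq[OF assms(2)] eq[OF zero_in_L2_0] by simp
  also have "\<dots> = 0" by (simp add: form_b_def L2_inner_def)
  finally show ?thesis by (simp add: form_b_def L2_inner_trace)
qed

text \<open>The argument for \<open>w = I\<^sub>k \<phi> - u\<^sub>k\<close> with a test function \<open>\<phi>\<close> in place of \<open>u\<close>. The bound differs from
  the final one by multiples of \<open>\<delta>\<close>, with factors that do not depend on \<open>\<phi>\<close>.\<close>

lemma quasi_orthogonality_test_function:
  fixes \<phi> :: "point \<Rightarrow> point"
  assumes \<Omega>: "polygonal_domain \<Omega>" and \<mu>: "\<mu> > 0"
    and M: "marked_triangulation \<Omega> M" and M': "marked_triangulation \<Omega> M'" and b: "bisect\<^sup>*\<^sup>* M M'"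
    and reg: "\<forall>Kz\<in>M. regular s Kz" and s: "s \<ge> 0"
    and g: "g \<in> L2 \<Omega>" and st: "stokes_solution \<mu> \<Omega> g u p"
    and dk: "discrete_solution \<mu> \<Omega> (elements M') g uk pk" and dc: "discrete_solution \<mu> \<Omega> (elements M) g uc pc"
    and t: "\<And>i. test_function \<Omega> (\<lambda>x. \<phi> x $ i)"
  defines "\<delta> \<equiv> L2_norm \<Omega> (weak_grad \<Omega> (\<lambda>x. \<phi> x - u x))"
    and "N \<equiv> L2_norm \<Omega> (broken_grad (elements M') (\<lambda>x. u x - uk x))"
    and "R \<equiv> sqrt (\<Sum>K\<in>elements M - elements M'. (mesh_size K)\<^sup>2 * (L2_norm K g)\<^sup>2)"
  shows "\<bar>broken_a \<mu> \<Omega> (elements M') (\<lambda>x. u x - uk x) (\<lambda>x. uk x - uc x)\<bar> \<le>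
    sqrt (24 * s) * (N + \<delta>) * R + \<delta> * (L2_norm \<Omega> (\<lambda>x. pk x *\<^sub>R (mat 1 :: real^2^2)) +
      L2_norm \<Omega> (\<lambda>x. pc x *\<^sub>R (mat 1 :: real^2^2)) +
      \<mu> * L2_norm \<Omega> (\<lambda>x. broken_grad (elements M') uk x - broken_grad (elements M) uc x))"
proof -
  let ?T = "elements M" and ?T' = "elements M'"
  have T: "conforming_triangulation \<Omega> ?T" and T': "conforming_triangulation \<Omega> ?T'"
    using M M' by (auto simp: marked_triangulation_def)
  note TM = conforming_triangle_mesh[OF T] and TM' = conforming_triangle_mesh[OF T']
  note \<Omega>s = polygonal_domain_sets[OF \<Omega>]
  note k = discrete_solutionD[OF dk] and c = discrete_solutionD[OF dc]
  define U \<Phi> where "U = weak_grad \<Omega> u" and "\<Phi> = (\<lambda>x. (\<chi> i j. partial j (\<lambda>x. \<phi> x $ i) x) :: real^2^2)"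
  define Gk Gc where "Gk = broken_grad ?T' uk" and "Gc = broken_grad ?T uc"
  have "u \<in> H1 \<Omega>" using st by (simp add: stokes_solution_def H1_0_def)
  then obtain G where "has_weak_gradient \<Omega> u G" by (auto simp: H1_def)
  then have wu: "has_weak_gradient \<Omega> u U" unfolding U_def weak_grad_def by (rule someI[of "has_weak_gradient \<Omega> u"])
  have "Ck (Suc 0) (\<lambda>x. \<phi> x $ i)" for i using t[of i] unfolding test_function_def by blast
  then have w\<phi>: "has_weak_gradient \<Omega> \<phi> \<Phi>"
    unfolding \<Phi>_def by (intro has_weak_gradient_C1 \<Omega>s)
  have L: "U \<in> L2 \<Omega>" "\<Phi> \<in> L2 \<Omega>" "Gk \<in> L2 \<Omega>" "Gc \<in> L2 \<Omega>"
    using wu w\<phi> V_nc_broken_grad_L2[OF \<Omega> T' k(1)] V_nc_broken_grad_L2[OF \<Omega> T c(1)]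
    by (auto simp: has_weak_gradient_def Gk_def Gc_def)
  define D E where "D = (\<lambda>x. \<Phi> x - U x)" and "E = (\<lambda>x. Gk x - Gc x)"
  have DL: "D \<in> L2 \<Omega>" and EL: "E \<in> L2 \<Omega>" unfolding D_def E_def by (intro L2_diff L)+
  have wD: "AE x in lebesgue_on \<Omega>. weak_grad \<Omega> (\<lambda>x. \<phi> x - u x) x = D x"
    unfolding D_def by (intro weak_grad_eq has_weak_gradient_diff \<Omega>s w\<phi> wu)
  have \<delta>: "\<delta> = L2_norm \<Omega> D"
  proof -
    have *: "AE x in lebesgue_on \<Omega>. D x = weak_grad \<Omega> (\<lambda>x. \<phi> x - u x) x"
      using wD by eventually_elim simp
    show ?thesis unfolding \<delta>_def L2_norm_def
      using L2_inner_AE_cong[OF \<Omega>s(3) DL DL * *] by simp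
  qed
  have Gk_const: "\<exists>B. AE x in lebesgue_on K. Gk x = B" if "K \<in> ?T'" for K
    unfolding Gk_def by (rule V_nc_broken_grad_constant[OF TM' k(1) that]) blast
  have Gc_const: "\<exists>B. AE x in lebesgue_on K. Gc x = B" if "K \<in> ?T" for K
    unfolding Gc_def by (rule V_nc_broken_grad_constant[OF TM c(1) that]) blast
  have AE_sub: "AE x in lebesgue_on L. P x"
    if "AE x in lebesgue_on K. P x" "L \<subseteq> K" "L \<in> ?T'" "K \<in> ?T" for K L P
    by (rule AE_lebesgue_on_subset[OF that(1,2) mesh_element_sets(1)[OF \<Omega> T' that(3)] mesh_element_sets(1)[OF \<Omega> T that(4)]])
  have Gc_fine: "\<exists>B. has_weak_gradient (interior L) uc (\<lambda>x. B) \<and> (AE x in lebesgue_on L. Gc x = B)" if Lt: "L \<in> ?T'" for L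
  proof -
    obtain K where K: "K \<in> ?T" "L \<subseteq> K" using bisect_rtranclp_refines[OF b Lt] by blast
    obtain B where B: "has_weak_gradient (interior K) uc (\<lambda>x. B)" "AE x in lebesgue_on K. Gc x = B"
      unfolding Gc_def by (rule V_nc_weak_gradient[OF TM c(1) K(1)])
    have "has_weak_gradient (interior L) uc (\<lambda>x. B)"
      by (rule has_weak_gradient_subset[OF B(1) interior_mono[OF K(2)] open_interior open_interior])
    then show ?thesis using AE_sub[OF B(2) K(2) Lt K(1)] by blast
  qed
  have E_const: "\<exists>B. AE x in lebesgue_on K. E x = B" if K: "K \<in> ?T'" for K
  proof -
    obtain B where B: "AE x in lebesgue_on K. Gk x = B" using Gk_const[OF K] by blast
    obtain B' where B': "AE x in lebesgue_on K. Gc x = B'" using Gc_fine[OF K] by blast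
    have "AE x in lebesgue_on K. E x = B - B'" using B B' by eventually_elim (simp add: E_def)
    then show ?thesis by blast
  qed
  have wuK: "has_weak_gradient (interior K) u U" if "K \<in> ?T'" for K
    by (rule has_weak_gradient_subset[OF wu mesh_element(3)[OF \<Omega> T' that] open_interior \<Omega>s(1)])
  have bg1: "AE x in lebesgue_on \<Omega>. broken_grad ?T' (\<lambda>x. u x - uk x) x = U x - Gk x"
  proof (rule AE_mesh[OF \<Omega> T'])
    fix K assume K: "K \<in> ?T'"
    obtain B where B: "has_weak_gradient (interior K) uk (\<lambda>x. B)"
      by (rule V_nc_weak_gradient[OF TM' k(1) K])
    from broken_grad_diff[OF TM' K wuK[OF K] B] broken_grad_AE[OF TM' K wuK[OF K]]
    show "AE x in lebesgue_on K. broken_grad ?T' (\<lambda>x. u x - uk x) x = U x - Gk x"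
      by eventually_elim (simp add: Gk_def)
  qed
  have bg2: "AE x in lebesgue_on \<Omega>. broken_grad ?T' (\<lambda>x. uk x - uc x) x = E x"
  proof (rule AE_mesh[OF \<Omega> T'])
    fix K assume K: "K \<in> ?T'"
    obtain B where B: "has_weak_gradient (interior K) uk (\<lambda>x. B)"
      by (rule V_nc_weak_gradient[OF TM' k(1) K])
    obtain B' where B': "has_weak_gradient (interior K) uc (\<lambda>x. B')" "AE x in lebesgue_on K. Gc x = B'"
      using Gc_fine[OF K] by blast
    from broken_grad_diff[OF TM' K B B'(1)] broken_grad_AE[OF TM' K B'(1)] B'(2)
    show "AE x in lebesgue_on K. broken_grad ?T' (\<lambda>x. uk x - uc x) x = E x"
      by eventually_elim (simp add: E_def Gk_def)
  qed
  define F where "F = (\<lambda>x. \<Phi> x - Gk x)"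
  have FL: "F \<in> L2 \<Omega>" unfolding F_def by (intro L2_diff L)
  have UGk: "(\<lambda>x. U x - Gk x) \<in> L2 \<Omega>" by (intro L2_diff L)
  have bg1': "AE x in lebesgue_on \<Omega>. U x - Gk x = broken_grad ?T' (\<lambda>x. u x - uk x) x"
    using bg1 by eventually_elim simp
  have bg2': "AE x in lebesgue_on \<Omega>. E x = broken_grad ?T' (\<lambda>x. uk x - uc x) x"
    using bg2 by eventually_elim simp
  have N: "N = L2_norm \<Omega> (\<lambda>x. U x - Gk x)"
    unfolding N_def L2_norm_def using L2_inner_AE_cong[OF \<Omega>s(3) UGk UGk bg1' bg1'] by simp
  have lhs: "broken_a \<mu> \<Omega> ?T' (\<lambda>x. u x - uk x) (\<lambda>x. uk x - uc x) = \<mu> * L2_inner \<Omega> (\<lambda>x. U x - Gk x) E"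
    unfolding broken_a_def using L2_inner_AE_cong[OF \<Omega>s(3) UGk EL bg1' bg2'] by simp
  obtain I where I: "I \<in> V_nc \<Omega> ?T'"
    "\<And>K. K \<in> ?T' \<Longrightarrow> (LINT x|lebesgue_on K. broken_grad ?T' I x) = (LINT x|lebesgue_on K. \<Phi> x)"
    unfolding \<Phi>_def by (rule fine_interpolation[OF \<Omega> T' t]) blast
  define w where "w = (\<lambda>x. I x - uk x)"
  define W where "W = broken_grad ?T' w"
  have w: "w \<in> V_nc \<Omega> ?T'" unfolding w_def by (rule V_nc_diff[OF TM' I(1) k(1)])
  have WL: "W \<in> L2 \<Omega>" unfolding W_def by (rule V_nc_broken_grad_L2[OF \<Omega> T' w])
  have W_const: "\<exists>B. AE x in lebesgue_on K. W x = B" if "K \<in> ?T'" for K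
    unfolding W_def by (rule V_nc_broken_grad_constant[OF TM' w that]) blast
  have WF: "(LINT x|lebesgue_on K. W x) = (LINT x|lebesgue_on K. F x)" if K: "K \<in> ?T'" for K
  proof -
    note ms = mesh_element_sets[OF \<Omega> T' K]
    have LK: "W \<in> L2 K" "\<Phi> \<in> L2 K" "Gk \<in> L2 K" "broken_grad ?T' I \<in> L2 K"
      using WL L V_nc_broken_grad_L2[OF \<Omega> T' I(1)] by (auto intro: L2_mesh_element[OF \<Omega> T' _ K])
    obtain B where B: "has_weak_gradient (interior K) I (\<lambda>x. B)" by (rule V_nc_weak_gradient[OF TM' I(1) K])
    obtain B' where B': "has_weak_gradient (interior K) uk (\<lambda>x. B')" by (rule V_nc_weak_gradient[OF TM' k(1) K])
    have "AE x in lebesgue_on K. W x = broken_grad ?T' I x - Gk x"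
      unfolding W_def w_def Gk_def by (rule broken_grad_diff[OF TM' K B B'])
    then have "(LINT x|lebesgue_on K. W x) = (LINT x|lebesgue_on K. broken_grad ?T' I x - Gk x)"
      using LK by (intro integral_cong_AE) (auto simp: L2_def)
    also have "\<dots> = (LINT x|lebesgue_on K. F x)"
      using L2_integrable_vec[OF LK(2) ms(3,1)] L2_integrable_vec[OF LK(3) ms(3,1)] L2_integrable_vec[OF LK(4) ms(3,1)] I(2)[OF K]
      by (simp add: F_def)
    finally show ?thesis .
  qed
  have WnF: "L2_norm \<Omega> W \<le> L2_norm \<Omega> F"
    by (rule L2_norm_piecewise_mean_le[OF \<Omega> T' FL WL W_const WF])
  have FN: "L2_norm \<Omega> F \<le> N + \<delta>"
    unfolding N \<delta> using L2_norm_add_le[OF UGk DL] by (simp add: F_def D_def)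
  obtain v where v: "v \<in> V_nc \<Omega> ?T"
    "\<And>K. K \<in> ?T \<Longrightarrow> (LINT x|lebesgue_on K. broken_grad ?T v x) = (LINT x|lebesgue_on K. W x)"
    "\<bar>L2_inner \<Omega> g (\<lambda>x. w x - v x)\<bar> \<le> sqrt (24 * s) * L2_norm \<Omega> W * R"
    unfolding W_def R_def by (rule coarse_interpolation[OF \<Omega> M M' b reg s w g]) blast
  define V where "V = broken_grad ?T v"
  have VL: "V \<in> L2 \<Omega>" unfolding V_def by (rule V_nc_broken_grad_L2[OF \<Omega> T v(1)])
  define Pk Pc where "Pk = (\<lambda>x. pk x *\<^sub>R (mat 1 :: real^2^2))" and "Pc = (\<lambda>x. pc x *\<^sub>R (mat 1 :: real^2^2))"
  have q0: "pk \<in> L2_0 \<Omega>" "pc \<in> L2_0 \<Omega>" using k(2) c(2) by (auto simp: Q_nc_def)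
  have PL: "Pk \<in> L2 \<Omega>" "Pc \<in> L2 \<Omega>" unfolding Pk_def Pc_def using q0 by (auto simp: L2_0_def intro: L2_pressure)
  have pc': "pc \<in> Q_nc \<Omega> ?T'"
  proof -
    have "P0_on L pc" if L': "L \<in> ?T'" for L
    proof -
      obtain K where K: "K \<in> ?T" "L \<subseteq> K" using bisect_rtranclp_refines[OF b L'] by blast
      obtain r where "AE x in lebesgue_on K. pc x = r" using c(2) K by (auto simp: Q_nc_def P0_on_def)
      from AE_sub[OF this K(2) L' K(1)] show ?thesis by (auto simp: P0_on_def)
    qed
    then show ?thesis using q0 by (simp add: Q_nc_def)
  qed
  \<comment> \<open>The divergence of \<open>w\<close> is of the order of \<open>\<delta>\<close>: against elementwise constants \<open>W\<close> acts
    like \<open>F\<close>, and both \<open>U\<close> and \<open>Gk\<close> are orthogonal to \<open>q\<close> times the identity.\<close>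
  have div: "\<bar>L2_inner \<Omega> W (\<lambda>x. q x *\<^sub>R mat 1)\<bar> \<le> \<delta> * L2_norm \<Omega> (\<lambda>x. q x *\<^sub>R (mat 1 :: real^2^2))"
    if q: "q \<in> Q_nc \<Omega> ?T'" for q
  proof -
    have ql: "q \<in> L2_0 \<Omega>" using q by (simp add: Q_nc_def)
    then have qL: "(\<lambda>x. q x *\<^sub>R (mat 1 :: real^2^2)) \<in> L2 \<Omega>" by (auto simp: L2_0_def intro: L2_pressure)
    have "\<exists>c. AE x in lebesgue_on K. q x *\<^sub>R (mat 1 :: real^2^2) = c" if K: "K \<in> ?T'" for K
    proof -
      obtain r where "AE x in lebesgue_on K. q x = r" using q K by (auto simp: Q_nc_def P0_on_def)
      then have "AE x in lebesgue_on K. q x *\<^sub>R (mat 1 :: real^2^2) = r *\<^sub>R mat 1" by eventually_elim simp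
      then show ?thesis by blast
    qed
    then have "L2_inner \<Omega> W (\<lambda>x. q x *\<^sub>R mat 1) = L2_inner \<Omega> F (\<lambda>x. q x *\<^sub>R mat 1)"
      by (intro L2_inner_piecewise_constant[OF \<Omega> T' qL WL FL _ WF])
    also have "\<dots> = L2_inner \<Omega> D (\<lambda>x. q x *\<^sub>R mat 1)"
      unfolding F_def D_def L2_inner_diff_left[OF L(2,3) qL] L2_inner_diff_left[OF L(2,1) qL]
      using k(4)[OF q] stokes_solution_divergence_free[OF st ql] by (simp add: Gk_def U_def)
    finally show ?thesis unfolding \<delta> using L2_Cauchy_Schwarz[OF DL qL] by simp
  qed
  have "L2_inner \<Omega> F E = L2_inner \<Omega> W E"
    by (rule L2_inner_piecewise_constant[OF \<Omega> T' EL FL WL E_const WF[symmetric]])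
  also have "\<dots> = L2_inner \<Omega> Gk W - L2_inner \<Omega> Gc W"
    unfolding E_def L2_inner_diff_right[OF L(3,4) WL] by (simp add: L2_inner_commute)
  finally have FE: "L2_inner \<Omega> F E = L2_inner \<Omega> Gk W - L2_inner \<Omega> Gc W" .
  \<comment> \<open>The fine equation tested with \<open>w\<close>, the coarse one with its interpolant \<open>v\<close>.\<close>
  have e1: "\<mu> * L2_inner \<Omega> Gk W + L2_inner \<Omega> W Pk = L2_inner \<Omega> g w"
    using k(3)[OF w] by (simp add: Gk_def W_def Pk_def)
  have "L2_inner \<Omega> V Gc = L2_inner \<Omega> W Gc"
    by (rule L2_inner_piecewise_constant[OF \<Omega> T L(4) VL WL Gc_const]) (use v(2) in \<open>auto simp: V_def\<close>)
  then have VG: "L2_inner \<Omega> Gc V = L2_inner \<Omega> Gc W" by (simp add: L2_inner_commute)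
  have VP: "L2_inner \<Omega> V Pc = L2_inner \<Omega> W Pc"
  proof (rule L2_inner_piecewise_constant[OF \<Omega> T PL(2) VL WL])
    fix K assume K: "K \<in> ?T"
    obtain r where "AE x in lebesgue_on K. pc x = r" using c(2) K by (auto simp: Q_nc_def P0_on_def)
    then have "AE x in lebesgue_on K. Pc x = r *\<^sub>R mat 1" by eventually_elim (simp add: Pc_def)
    then show "\<exists>c. AE x in lebesgue_on K. Pc x = c" by blast
  qed (use v(2) in \<open>auto simp: V_def\<close>)
  have e2: "\<mu> * L2_inner \<Omega> Gc W + L2_inner \<Omega> W Pc = L2_inner \<Omega> g v"
    using c(3)[OF v(1)] VG VP by (simp add: Gc_def V_def Pc_def)
  have gwv: "L2_inner \<Omega> g (\<lambda>x. w x - v x) = L2_inner \<Omega> g w - L2_inner \<Omega> g v"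
    by (rule L2_inner_diff_right[OF V_nc_L2[OF w] V_nc_L2[OF v(1)] g])
  have main: "\<mu> * L2_inner \<Omega> F E = L2_inner \<Omega> g (\<lambda>x. w x - v x) - L2_inner \<Omega> W Pk + L2_inner \<Omega> W Pc"
    unfolding FE gwv using e1 e2 by (simp add: right_diff_distrib)
  have "L2_inner \<Omega> (\<lambda>x. U x - Gk x) E = L2_inner \<Omega> F E - L2_inner \<Omega> D E"
    using L2_inner_diff_left[OF FL DL EL] by (simp add: F_def D_def)
  then have "broken_a \<mu> \<Omega> ?T' (\<lambda>x. u x - uk x) (\<lambda>x. uk x - uc x) =
      L2_inner \<Omega> g (\<lambda>x. w x - v x) - L2_inner \<Omega> W Pk + L2_inner \<Omega> W Pc - \<mu> * L2_inner \<Omega> D E"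
    unfolding lhs using main by (simp add: right_diff_distrib)
  moreover have "\<bar>L2_inner \<Omega> g (\<lambda>x. w x - v x)\<bar> \<le> sqrt (24 * s) * (N + \<delta>) * R"
  proof -
    have "R \<ge> 0" unfolding R_def by (intro real_sqrt_ge_zero sum_nonneg) simp
    then have "sqrt (24 * s) * L2_norm \<Omega> W * R \<le> sqrt (24 * s) * (N + \<delta>) * R"
      using WnF FN s by (intro mult_right_mono mult_left_mono) auto
    then show ?thesis using v(3) by linarith
  qed
  moreover have "\<bar>L2_inner \<Omega> W Pk\<bar> \<le> \<delta> * L2_norm \<Omega> Pk" "\<bar>L2_inner \<Omega> W Pc\<bar> \<le> \<delta> * L2_norm \<Omega> Pc"
    unfolding Pk_def Pc_def by (rule div[OF k(2)], rule div[OF pc'])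
  moreover have "\<bar>\<mu> * L2_inner \<Omega> D E\<bar> \<le> \<delta> * (\<mu> * L2_norm \<Omega> E)"
    using L2_Cauchy_Schwarz[OF DL EL] \<mu> unfolding \<delta> by (simp add: abs_mult mult.left_commute mult_left_mono)
  ultimately show ?thesis
    unfolding Pk_def[symmetric] Pc_def[symmetric] Gk_def[symmetric] Gc_def[symmetric] E_def[symmetric] distrib_left
    by linarith
qed

theorem lemma3p4:
  fixes \<Omega> :: "(real^2) set" and \<mu> \<sigma> :: real
  assumes "polygonal_domain \<Omega>" and "\<mu> > 0"
  shows "\<exists>C>0. \<forall>(M :: nat \<Rightarrow> marked_mesh) (g :: real^2 \<Rightarrow> real^2) u p (k::nat) u\<^sub>k p\<^sub>k u' p'.
    marked_triangulation \<Omega> (M 0) \<longrightarrow> shape_regular \<sigma> (elements (M 0)) \<longrightarrow>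
    (\<forall>j. nvb_refinement \<Omega> (M j) (M (Suc j))) \<longrightarrow>
    g \<in> L2 \<Omega> \<longrightarrow> stokes_solution \<mu> \<Omega> g u p \<longrightarrow>
    k \<ge> 1 \<longrightarrow>
    discrete_solution \<mu> \<Omega> (elements (M k)) g u\<^sub>k p\<^sub>k \<longrightarrow>
    discrete_solution \<mu> \<Omega> (elements (M (k - 1))) g u' p' \<longrightarrow>
    \<bar>broken_a \<mu> \<Omega> (elements (M k)) (\<lambda>x. u x - u\<^sub>k x) (\<lambda>x. u\<^sub>k x - u' x)\<bar>
      \<le> C * L2_norm \<Omega> (broken_grad (elements (M k)) (\<lambda>x. u x - u\<^sub>k x))
          * sqrt (\<Sum>K \<in> elements (M (k - 1)) - elements (M k).
                    (mesh_size K)\<^sup>2 * (L2_norm K g)\<^sup>2)"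
proof -
  define s where "s = 2 * \<sigma>\<^sup>2"
  have s: "s \<ge> 0" by (simp add: s_def)
  \<comment> \<open>The added 1 only makes the constant positive if \<open>\<sigma> = 0\<close>.\<close>
  define C where "C = sqrt (24 * s) + 1"
  have "\<bar>broken_a \<mu> \<Omega> (elements (M k)) (\<lambda>x. u x - uk x) (\<lambda>x. uk x - u' x)\<bar>
      \<le> C * L2_norm \<Omega> (broken_grad (elements (M k)) (\<lambda>x. u x - uk x))
          * sqrt (\<Sum>K \<in> elements (M (k - 1)) - elements (M k). (mesh_size K)\<^sup>2 * (L2_norm K g)\<^sup>2)"
    if M0: "marked_triangulation \<Omega> (M 0)" and sr: "shape_regular \<sigma> (elements (M 0))"
      and nvb: "\<forall>j. nvb_refinement \<Omega> (M j) (M (Suc j))" and g: "g \<in> L2 \<Omega>"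
      and st: "stokes_solution \<mu> \<Omega> g u p" and k: "k \<ge> 1"
      and dk: "discrete_solution \<mu> \<Omega> (elements (M k)) g uk pk"
      and dc: "discrete_solution \<mu> \<Omega> (elements (M (k - 1))) g u' p'"
    for M :: "nat \<Rightarrow> marked_mesh" and g u p k uk pk u' p'
  proof -
    have mt: "marked_triangulation \<Omega> (M j)" for j
      using M0 nvb by (cases j) (auto simp: nvb_refinement_def)
    have reg: "\<forall>Kz\<in>M j. regular s Kz" for j
    proof (induction j)
      case 0
      then show ?case using initial_regular[OF M0 sr] by (simp add: s_def)
    next
      case (Suc j)
      have "bisect\<^sup>*\<^sup>* (M j) (M (Suc j))" using nvb by (simp add: nvb_refinement_def)
      then show ?case by (rule bisect_rtranclp_regular[OF _ Suc])
    qed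
    have b: "bisect\<^sup>*\<^sup>* (M (k - 1)) (M k)"
      using nvb k by (metis Suc_diff_1 nvb_refinement_def order_less_le_trans zero_less_one)
    define N where "N = L2_norm \<Omega> (broken_grad (elements (M k)) (\<lambda>x. u x - uk x))"
    define R where "R = sqrt (\<Sum>K \<in> elements (M (k - 1)) - elements (M k). (mesh_size K)\<^sup>2 * (L2_norm K g)\<^sup>2)"
    define X where "X = \<bar>broken_a \<mu> \<Omega> (elements (M k)) (\<lambda>x. u x - uk x) (\<lambda>x. uk x - u' x)\<bar>"
    define P where "P = L2_norm \<Omega> (\<lambda>x. pk x *\<^sub>R (mat 1 :: real^2^2)) +
      L2_norm \<Omega> (\<lambda>x. p' x *\<^sub>R (mat 1 :: real^2^2)) +
      \<mu> * L2_norm \<Omega> (\<lambda>x. broken_grad (elements (M k)) uk x - broken_grad (elements (M (k - 1))) u' x)"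
    obtain \<phi> :: "nat \<Rightarrow> point \<Rightarrow> point" where \<phi>: "\<And>n i. test_function \<Omega> (\<lambda>x. \<phi> n x $ i)"
      "(\<lambda>n. H1_norm \<Omega> (\<lambda>x. \<phi> n x - u x)) \<longlonglongrightarrow> 0"
      using st by (auto simp: stokes_solution_def H1_0_def)
    define \<delta> where "\<delta> = (\<lambda>n. L2_norm \<Omega> (weak_grad \<Omega> (\<lambda>x. \<phi> n x - u x)))"
    have \<delta>0: "\<delta> \<longlonglongrightarrow> 0"
    proof (rule tendsto_sandwich[OF _ _ tendsto_const \<phi>(2)])
      show "\<forall>\<^sub>F n in sequentially. 0 \<le> \<delta> n" by (simp add: \<delta>_def L2_norm_nonneg)
      show "\<forall>\<^sub>F n in sequentially. \<delta> n \<le> H1_norm \<Omega> (\<lambda>x. \<phi> n x - u x)"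
        unfolding \<delta>_def H1_norm_def by (intro always_eventually allI real_le_rsqrt) simp
    qed
    \<comment> \<open>The right-hand side tends to the claim along test functions that approximate \<open>u\<close>.\<close>
    have bound: "X \<le> sqrt (24 * s) * (N + \<delta> n) * R + \<delta> n * P" for n
      unfolding X_def N_def R_def P_def \<delta>_def
      by (rule quasi_orthogonality_test_function[OF assms mt mt b reg s g st dk dc \<phi>(1)])
    have "(\<lambda>n. sqrt (24 * s) * (N + \<delta> n) * R + \<delta> n * P) \<longlonglongrightarrow> sqrt (24 * s) * (N + 0) * R + 0 * P"
      by (intro tendsto_intros \<delta>0)
    then have "X \<le> sqrt (24 * s) * (N + 0) * R + 0 * P"
      by (rule LIMSEQ_le_const) (use bound in auto)
    also have "\<dots> \<le> C * N * R"
    proof -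
      have "R \<ge> 0" unfolding R_def by (intro real_sqrt_ge_zero sum_nonneg) simp
      then show ?thesis unfolding C_def N_def by (simp add: L2_norm_nonneg mult_right_mono)
    qed
    finally show ?thesis unfolding X_def N_def R_def .
  qed
  moreover have "C > 0" using s by (simp add: C_def add_nonneg_pos)
  ultimately show ?thesis by blast
qed

end
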